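(* Let $(v_l(0))_{l\ge1}$ be non-negative with $\sum_l v_l(0)=1$ and $\sum_l l^3v_l(0)<\infty$, let $C$ be the associated limiting tagged-cluster process and $\varphi$ the associated control function. Then for all $t\ge0$, $$\mathbb{E}(1/C_t)=\mathbb{E}(1/C_0)+\int_0^t\left(\varphi(s)-\tfrac12\right)ds .$$
   Context: Here $\mathbb{N}=\{1,2,\dots\}$. Critical forest fire equations. Given $v_l(0)\ge0$ with $\sum_l v_l(0)=1$ and $\sum_l l^3v_l(0)<\infty$, it is known (Ráth–Tóth) that there is a unique solution $(v_k(t))_{k\ge1,\,t\ge0}$, with values in $[0,1]$ and each $v_k$ continuous, of $$\frac{dv_k(t)}{dt}=-kv_k(t)+\frac k2\sum_{l=1}^{k-1}v_l(t)v_{k-l}(t)\ \ (k\ge2),\qquad \sum_{l=1}^\infty v_l(t)=1\ \ (t\ge0).$$ Put $T_{gel}=\big(\sum_l l v_l(0)\big)^{-1}$. It is also known that there is a function $\varphi:[0,\infty)\to\mathbb{R}$ (the control function), equal to $0$ on $[0,T_{gel})$ and positive and locally Lipschitz on $[T_{gel},\infty)$, such that $\frac{dv_1(t)}{dt}=-v_1(t)+\varphi(t)$ for all $t\ne T_{gel}$. State space $E$. $E=\mathbb{N}$ with the metric $d_E(i,j)=|f(i)-f(j)|$, where $f(1)=0$ and $f(i)=1/i$ for $i\ge2$. Thus $E$ is compact, $n\to1$ in $E$ as $n\to\infty$, and $1$ is the only non-isolated point. Process $C$. $C=(C_t)_{t\ge0}$ is the unique càdlàg $E$-valued strong Markov process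 such that: the law of $C_0$ is $k\mapsto v_k(0)$; $C$ jumps out of state $k$ at rate $k$, and when such a jump occurs at time $\tau$, then, conditionally on $\tau$, the value of $C$ increases by $L$, where $L$ has law $\mathbb{P}_\tau[L=l]=v_l(\tau)$. (When infinitely many jumps accumulate, i.e. $C$ explodes, the topology of $E$ and càdlàg paths mean that $C$ is in state $1$ at the explosion time and continues from there.) *)

theory Defs
  imports "HOL-Probability.Probability"
begin

section \<open>The critical forest fire equations\<close>

text \<open>
  Throughout, cluster sizes range over the positive integers; they are represented by type
  \<^typ>\<open>nat\<close>, with index \<open>0\<close> excluded explicitly.  Time is \<^typ>\<open>real\<close>, restricted to
  \<open>t \<ge> 0\<close>; derivatives at \<open>t = 0\<close> are one-sided.
\<close>

definition critical_forest_fire :: "(nat \<Rightarrow> real) \<Rightarrow> (nat \<Rightarrow> real \<Rightarrow> real) \<Rightarrow> bool" where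
  "critical_forest_fire v0 v \<longleftrightarrow>
     (\<forall>k\<ge>1. v k 0 = v0 k) \<and>
     (\<forall>k\<ge>1. \<forall>t\<ge>0. v k t \<in> {0..1}) \<and>
     (\<forall>k\<ge>1. continuous_on {0..} (v k)) \<and>
     (\<forall>k\<ge>2. \<forall>t\<ge>0.
        (v k has_real_derivative
           (- real k * v k t + real k / 2 * (\<Sum>l=1..k-1. v l t * v (k - l) t)))
        (at t within {0..})) \<and>
     (\<forall>t\<ge>0. ((\<lambda>l. v l t) has_sum 1) {1..})"

definition T_gel :: "(nat \<Rightarrow> real) \<Rightarrow> real" where
  "T_gel v0 = inverse (\<Sum>\<^sub>\<infinity>l\<in>{1..}. real l * v0 l)"

definition control_function ::
    "(nat \<Rightarrow> real) \<Rightarrow> (nat \<Rightarrow> real \<Rightarrow> real) \<Rightarrow> (real \<Rightarrow> real) \<Rightarrow> bool" where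
  "control_function v0 v \<phi> \<longleftrightarrow>
     (\<forall>t\<in>{0..<T_gel v0}. \<phi> t = 0) \<and>
     (\<forall>t\<ge>T_gel v0. \<phi> t > 0) \<and>
     (\<forall>t\<ge>T_gel v0. \<exists>\<epsilon>>0. \<exists>L. L-lipschitz_on (cball t \<epsilon> \<inter> {T_gel v0..}) \<phi>) \<and>
     (\<forall>t\<ge>0. t \<noteq> T_gel v0 \<longrightarrow>
        (v 1 has_real_derivative (- v 1 t + \<phi> t)) (at t within {0..}))"


section \<open>The state space\<close>

definition f_E :: "nat \<Rightarrow> real" where
  "f_E i = (if i = 1 then 0 else 1 / real i)"

definition d_E :: "nat \<Rightarrow> nat \<Rightarrow> real" where
  "d_E i j = \<bar>f_E i - f_E j\<bar>"

interpretation E: Metric_space "{1::nat..}" d_E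
  by unfold_locales (auto simp: d_E_def f_E_def abs_minus_commute)

definition cadlag_E :: "(real \<Rightarrow> nat) \<Rightarrow> bool" where
  "cadlag_E c \<longleftrightarrow>
     (\<forall>t\<ge>0. limitin E.mtopology c (c t) (at_right t)) \<and>
     (\<forall>t>0. \<exists>x. limitin E.mtopology c x (at_left t))"

definition jump_times :: "(real \<Rightarrow> nat) \<Rightarrow> real set" where
  "jump_times c = {t. t > 0 \<and> \<not> limitin E.mtopology c (c t) (at_left t)}"

definition explodes_at :: "(real \<Rightarrow> nat) \<Rightarrow> real \<Rightarrow> bool" where
  "explodes_at c t \<longleftrightarrow> t > 0 \<and> (\<forall>s<t. infinite (jump_times c \<inter> {s<..<t}))"

text \<open>The path \<open>c\<close> leaves, at time \<open>r\<close> and by a jump, the state which it occupies at time \<open>s\<close>.\<close>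

definition leaves_at :: "(real \<Rightarrow> nat) \<Rightarrow> real \<Rightarrow> real \<Rightarrow> bool" where
  "leaves_at c s r \<longleftrightarrow> s < r \<and> (\<forall>u\<in>{s..<r}. c u = c s) \<and> c r \<noteq> c s"


section \<open>The limiting tagged-cluster process\<close>

text \<open>
  The Borel sets of \<open>E\<close> are all its subsets, since \<open>E\<close> is a countable metric space.  For \<open>t < 0\<close>
  the following \<open>\<sigma>\<close>-algebra is trivial.
\<close>

definition natural_filtration :: "'a measure \<Rightarrow> (real \<Rightarrow> 'a \<Rightarrow> nat) \<Rightarrow> real \<Rightarrow> 'a measure" where
  "natural_filtration M C t =
     sigma (space M) {C s -` A \<inter> space M | s A. 0 \<le> s \<and> s \<le> t}"

lemma filtration_natural_filtration: "filtration (space M) (natural_filtration M C)"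
proof
  show "space (natural_filtration M C i) = space M" for i
    unfolding natural_filtration_def by (rule space_measure_of) auto
  fix i j :: real
  assume "i \<le> j"
  then have "{C s -` A \<inter> space M | s A. 0 \<le> s \<and> s \<le> i}
      \<subseteq> {C s -` A \<inter> space M | s A. 0 \<le> s \<and> s \<le> j}"
    by (blast intro: order_trans)
  then show "sets (natural_filtration M C i) \<le> sets (natural_filtration M C j)"
    unfolding natural_filtration_def
    by (subst (1 2) sets_measure_of) (auto simp del: Collect_mono_iff intro!: sigma_sets_mono')
qed

abbreviation stopped_algebra ::
    "'a measure \<Rightarrow> (real \<Rightarrow> 'a \<Rightarrow> nat) \<Rightarrow> ('a \<Rightarrow> real) \<Rightarrow> 'a measure" where
  "stopped_algebra M C \<equiv> filtration.pre_sigma (space M) (natural_filtration M C)"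

definition finite_stopping_time ::
    "'a measure \<Rightarrow> (real \<Rightarrow> 'a \<Rightarrow> nat) \<Rightarrow> ('a \<Rightarrow> real) \<Rightarrow> bool" where
  "finite_stopping_time M C T \<longleftrightarrow>
     stopping_time (natural_filtration M C) T \<and> (\<forall>\<omega>\<in>space M. T \<omega> \<ge> 0)"

text \<open>
  The (time-inhomogeneous) strong Markov property: \<open>p s i u\<close> is the law of the state at time
  \<open>s + u\<close> given that the state at time \<open>s\<close> is \<open>i\<close>.  A stopping time \<open>T\<close> with infinite values is
  covered, on the event that it is finite, by the stopping times \<open>min T n\<close>.
\<close>

definition strong_Markov :: "'a measure \<Rightarrow> (real \<Rightarrow> 'a \<Rightarrow> nat) \<Rightarrow> bool" where
  "strong_Markov M C \<longleftrightarrow>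
     (\<exists>p :: real \<Rightarrow> nat \<Rightarrow> real \<Rightarrow> nat pmf.
        (\<forall>i u j. (\<lambda>s. pmf (p s i u) j) \<in> borel_measurable borel) \<and>
        (\<forall>T u j. finite_stopping_time M C T \<and> u \<ge> 0 \<longrightarrow>
           (AE \<omega> in M.
              real_cond_exp M (stopped_algebra M C T)
                (indicator {\<omega> \<in> space M. C (T \<omega> + u) \<omega> = j}) \<omega>
              = pmf (p (T \<omega>) (C (T \<omega>) \<omega>) u) j)))"

text \<open>
  State \<open>k\<close> is left at rate \<open>k\<close>, so the holding time after a stopping time \<open>T\<close> is exponential
  with parameter \<open>k = C\<^sub>T\<close> given the past.  Given also the time \<open>T + r\<close> of the jump, the increment
  has law \<open>l \<mapsto> v l (T + r)\<close>; hence the joint law of the holding time and of the increment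
  has density \<open>k exp (-k r) v l (T + r)\<close> with respect to \<open>dr\<close> times counting measure.
\<close>

definition jump_mechanism ::
    "'a measure \<Rightarrow> (nat \<Rightarrow> real \<Rightarrow> real) \<Rightarrow> (real \<Rightarrow> 'a \<Rightarrow> nat) \<Rightarrow> bool" where
  "jump_mechanism M v C \<longleftrightarrow>
     (\<forall>T u. finite_stopping_time M C T \<and> u \<ge> 0 \<longrightarrow>
        (AE \<omega> in M.
           real_cond_exp M (stopped_algebra M C T)
             (indicator {\<omega> \<in> space M. \<forall>s\<in>{T \<omega>..T \<omega> + u}. C s \<omega> = C (T \<omega>) \<omega>}) \<omega>
           = exp (- real (C (T \<omega>) \<omega>) * u)) \<and>
        (\<forall>l\<ge>1. AE \<omega> in M.
           real_cond_exp M (stopped_algebra M C T)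
             (indicator {\<omega> \<in> space M. \<exists>r\<in>{T \<omega><..T \<omega> + u}.
                leaves_at (\<lambda>s. C s \<omega>) (T \<omega>) r \<and> C r \<omega> = C (T \<omega>) \<omega> + l}) \<omega>
           = (LBINT r:{0..u}.
                real (C (T \<omega>) \<omega>) * exp (- real (C (T \<omega>) \<omega>) * r) * v l (T \<omega> + r))))"

text \<open>
  The last clause records that the process is in state \<open>1\<close> at each explosion time.  It has to be
  stated: a path that is cadlag in \<open>E\<close> has left limit \<open>1\<close> there, but could still jump.
\<close>

definition tagged_cluster_process ::
    "'a measure \<Rightarrow> (nat \<Rightarrow> real \<Rightarrow> real) \<Rightarrow> (real \<Rightarrow> 'a \<Rightarrow> nat) \<Rightarrow> bool" where
  "tagged_cluster_process M v C \<longleftrightarrow>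
     prob_space M \<and>
     (\<forall>t\<ge>0. C t \<in> measurable M (count_space UNIV)) \<and>
     (\<forall>t\<ge>0. \<forall>\<omega>\<in>space M. C t \<omega> \<ge> 1) \<and>
     (\<forall>\<omega>\<in>space M. cadlag_E (\<lambda>t. C t \<omega>)) \<and>
     (\<forall>k\<ge>1. measure M {\<omega> \<in> space M. C 0 \<omega> = k} = v k 0) \<and>
     strong_Markov M C \<and>
     jump_mechanism M v C \<and>
     (AE \<omega> in M. \<forall>t. explodes_at (\<lambda>s. C s \<omega>) t \<longrightarrow> C t \<omega> = 1)"

end

theory Submission
  imports Defs
begin

text \<open>
  The law \<open>p\<close> of \<open>C\<^sub>t\<close> satisfies, for \<open>k \<ge> 2\<close>, the forward equation
  \<open>p\<^sub>k' = - k p\<^sub>k + \<Sum>\<^bsub>j<k\<^esub> j p\<^sub>j v\<^bsub>k-j\<^esub>\<close>, and so does \<open>v\<close>, by the symmetry of the convolution; a Gronwall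
  argument gives \<open>p = v\<close>. Hence \<open>\<E>(1/C\<^sub>t) = \<Sum>\<^sub>k v\<^sub>k(t)/k\<close>, and the derivative of the partial sums tends to
  \<open>\<phi> - 1 + 1/2\<close>, because \<open>v\<close> and its convolution square both have total mass \<open>1\<close>.

  The forward equation is obtained by summing one-cell estimates over finer and finer grids. The
  scaled law \<open>e\<^bsup>kt\<^esup> p\<^sub>k(t)\<close> is nondecreasing, so that the errors telescope. A cell in which the path enters \<open>k\<close>
  otherwise than by its first jump is bad; by compactness a path has no bad cells once the grid is fine
  enough, and the expected number of bad cells tends to \<open>0\<close>, since after a bad cell the path
  stays in \<open>k\<close> until the end with probability at least \<open>e\<^bsup>-kt\<^esup>\<close>, which can happen
  only once.
\<close>

section \<open>Uniqueness for the forward equation\<close>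

text \<open>Explosions shape the argument. A path may jump infinitely often in bounded time, so one
  can neither condition on the number of jumps nor choose cells with at most one jump. What stays
  finite is the number of visits to a fixed \<open>k \<ge> 2\<close>: the point \<open>k\<close> is
  isolated in \<open>E\<close>, so the indicator of being in \<open>k\<close> is itself a cadlag
  function with values 0 and 1. State 1 lacks this property and is also fed by explosions, so no
  forward equation is derived for it. The missing equation is replaced by conservation of mass: both
  families sum to 1, so \<open>p 1 - v 1\<close> is minus the sum of all other differences. The jump
  rates \<open>k\<close> are unbounded, so a Gronwall estimate for the sum of all differences has no
  finite constant; the damping has to be integrated exactly, and Gronwall is applied to
  \<open>\<bar>p 1 - v 1\<bar>\<close> alone. Conditioning takes place at deterministic grid times.
  Continuity of the law in time is not known beforehand; monotonicity of the scaled law takes its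
  place in the error estimates.\<close>

lemma set_integrable_bounded_Icc:
  fixes g :: "real \<Rightarrow> real"
  assumes "g \<in> borel_measurable borel" and "\<And>r. r \<in> {a..b} \<Longrightarrow> \<bar>g r\<bar> \<le> B"
  shows "set_integrable lborel {a..b} g"
  unfolding set_integrable_def
proof (rule integrableI_bounded_set[where A = "{a..b}" and B = B])
  show "(\<lambda>x. indicator {a..b} x *\<^sub>R g x) \<in> borel_measurable lborel"
    using assms(1) by measurable
  show "AE x in lborel. x \<in> {a..b} \<longrightarrow> norm (indicator {a..b} x *\<^sub>R g x) \<le> B"
    using assms(2) by (auto simp: indicator_def)
qed (auto simp: emeasure_lborel_Icc_eq)

lemma set_lebesgue_sum:
  fixes f :: "'i \<Rightarrow> 'a \<Rightarrow> real"
  assumes "\<And>i. i \<in> I \<Longrightarrow> set_integrable M A (f i)"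
  shows "set_integrable M A (\<lambda>x. \<Sum>i\<in>I. f i x)"
    and "(LINT x:A|M. (\<Sum>i\<in>I. f i x)) = (\<Sum>i\<in>I. (LINT x:A|M. f i x))"
  using assms unfolding set_integrable_def set_lebesgue_integral_def scaleR_sum_right by auto

lemma LBINT_exp_kernel:
  fixes c r t :: real
  assumes "r \<le> t"
  shows "(\<integral>s. indicator {r..t} s * (c * exp (- c * (s - r))) \<partial>lborel) = 1 - exp (- c * (t - r))"
proof -
  have "(\<integral>s. c * exp (- c * (s - r)) * indicator {r..t} s \<partial>lborel)
      = - exp (- c * (t - r)) - (- exp (- c * (r - r)))"
    by (rule integral_FTC_Icc_real[OF assms])
       (auto intro!: derivative_eq_intros continuous_intros)
  then show ?thesis by (simp add: mult.commute)
qed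

text \<open>Fubini on the triangle \<open>0 \<le> r \<le> s \<le> t\<close>: for fixed
  \<open>r\<close> the exponential density integrates over \<open>s\<close> to its distribution
  function \<open>1 - exp (- c * (t - r))\<close>.\<close>

lemma exp_convolution_integral:
  fixes g :: "real \<Rightarrow> real" and c t :: real
  assumes g: "g \<in> borel_measurable borel" and bd: "\<And>r. r \<in> {0..t} \<Longrightarrow> \<bar>g r\<bar> \<le> B"
    and c: "c \<ge> 0"
  shows "(LBINT s:{0..t}. c * (LBINT r:{0..s}. exp (- c * (s - r)) * g r))
    = (LBINT r:{0..t}. (1 - exp (- c * (t - r))) * g r)"
proof -
  define F where "F = (\<lambda>s r. indicator {0..t} r * (indicator {r..t} s * (c * exp (- c * (s - r)))) * g r)"
  \<comment> \<open>The interval moves with \<open>r\<close>; joint measurability is obtained by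
    viewing it as a section of one closed subset of the plane.\<close>
  have ind: "indicator {r..t} s = indicator {x. fst x \<le> snd x \<and> snd x \<le> t} (r, s)" for r s :: real
    by (auto simp: indicator_def)
  have "{x::real \<times> real. fst x \<le> snd x \<and> snd x \<le> t} \<in> sets borel"
    by (intro borel_closed closed_Collect_conj closed_Collect_le continuous_intros)
  then have ms: "{x::real \<times> real. fst x \<le> snd x \<and> snd x \<le> t} \<in> sets (borel \<Otimes>\<^sub>M borel)"
    unfolding borel_prod .
  have "integrable (lborel \<Otimes>\<^sub>M lborel) (\<lambda>(s, r). F s r)"
  proof (rule integrableI_bounded_set[where A = "{0..t} \<times> {0..t}" and B = "c * B"])
    show "(\<lambda>(s, r). F s r) \<in> borel_measurable (lborel \<Otimes>\<^sub>M lborel)"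
      unfolding F_def ind using g ms by measurable
    show "emeasure (lborel \<Otimes>\<^sub>M lborel) ({0..t} \<times> {0..t}) < \<infinity>"
      by (subst lborel.emeasure_pair_measure_Times)
         (auto simp: emeasure_lborel_Icc_eq ennreal_mult_less_top)
    show "AE x in lborel \<Otimes>\<^sub>M lborel. x \<in> {0..t} \<times> {0..t} \<longrightarrow> norm ((\<lambda>(s, r). F s r) x) \<le> c * B"
    proof (rule AE_I2, clarsimp)
      fix s r :: real assume *: "0 \<le> s" "s \<le> t" "0 \<le> r" "r \<le> t"
      have B: "0 \<le> B" using bd[of r] * by auto
      show "\<bar>F s r\<bar> \<le> c * B"
      proof (cases "r \<le> s")
        case True
        have "c * (s - r) \<ge> 0" using True c by simp
        then have "exp (- c * (s - r)) \<le> 1" by simp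
        then have "exp (- c * (s - r)) * \<bar>g r\<bar> \<le> 1 * B"
          using bd[of r] * by (intro mult_mono) auto
        then have "c * (exp (- c * (s - r)) * \<bar>g r\<bar>) \<le> c * B"
          using c by (intro mult_left_mono) auto
        then show ?thesis using True * c by (simp add: F_def abs_mult)
      qed (use B c in \<open>simp add: F_def\<close>)
    qed
  qed (auto simp: F_def indicator_def pair_measureI)
  from lborel_pair.Fubini_integral[OF this]
  have "(\<integral>r. (\<integral>s. F s r \<partial>lborel) \<partial>lborel) = (\<integral>s. (\<integral>r. F s r \<partial>lborel) \<partial>lborel)" .
  moreover have "(\<integral>s. F s r \<partial>lborel) = indicator {0..t} r * ((1 - exp (- c * (t - r))) * g r)" for r
  proof (cases "r \<in> {0..t}")
    case True
    have "(\<integral>s. F s r \<partial>lborel)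
      = indicator {0..t} r * (\<integral>s. indicator {r..t} s * (c * exp (- c * (s - r))) \<partial>lborel) * g r"
      unfolding F_def by simp
    then show ?thesis using True LBINT_exp_kernel[of r t c] by simp
  qed (simp add: F_def)
  moreover have "(\<integral>r. F s r \<partial>lborel)
      = indicator {0..t} s * (c * (LBINT r:{0..s}. exp (- c * (s - r)) * g r))" for s
  proof -
    have "F s r = (indicator {0..t} s * c) * (indicator {0..s} r *\<^sub>R (exp (- c * (s - r)) * g r))" for r
      by (auto simp: F_def indicator_def)
    then show ?thesis by (simp add: set_lebesgue_integral_def)
  qed
  ultimately show ?thesis by (simp only: set_lebesgue_integral_def real_scaleR_def)
qed

lemma set_integrable_exp_mult:
  fixes g :: "real \<Rightarrow> real" and c t :: real
  assumes g: "g \<in> borel_measurable borel" and bd: "\<And>r. r \<in> {0..s} \<Longrightarrow> \<bar>g r\<bar> \<le> B"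
    and c: "c \<ge> 0" and st: "s \<le> t"
  shows "set_integrable lborel {0..s} (\<lambda>r. exp (- c * (t - r)) * g r)"
proof (rule set_integrable_bounded_Icc[where B = B])
  fix r assume r: "r \<in> {0..s}"
  have "exp (- c * (t - r)) * \<bar>g r\<bar> \<le> 1 * B"
    using r c st bd[OF r] by (intro mult_mono) auto
  then show "\<bar>exp (- c * (t - r)) * g r\<bar> \<le> B" by (simp add: abs_mult)
qed (use g in measurable)

text \<open>By \<open>eq\<close>, \<open>w\<close> solves \<open>w' = - c * w + g\<close> with
  \<open>w 0 = 0\<close> in integrated form. It is dominated by the solution \<open>h\<close> driven
  by \<open>\<bar>g\<bar>\<close>, and integrating the equation of \<open>h\<close> gives an exact
  balance: \<open>h t\<close> plus \<open>c\<close> times the integral of \<open>h\<close> is the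
  integral of \<open>\<bar>g\<bar>\<close>. The damping thus survives with its full weight
  \<open>c\<close>, as the cancellation in the summed estimate requires.\<close>

lemma damped_integral_bound:
  fixes w g :: "real \<Rightarrow> real" and c t :: real
  assumes w: "w \<in> borel_measurable borel" and wb: "\<And>s. s \<in> {0..t} \<Longrightarrow> \<bar>w s\<bar> \<le> W"
    and g: "g \<in> borel_measurable borel" and gb: "\<And>r. r \<in> {0..t} \<Longrightarrow> \<bar>g r\<bar> \<le> B"
    and c: "c \<ge> 0" and t: "t \<ge> 0"
    and eq: "\<And>s. s \<in> {0..t} \<Longrightarrow> exp (c * s) * w s = (LBINT r:{0..s}. exp (c * r) * g r)"
  shows "\<bar>w t\<bar> + c * (LBINT s:{0..t}. \<bar>w s\<bar>) \<le> (LBINT r:{0..t}. \<bar>g r\<bar>)"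
proof -
  define h where "h s = (LBINT r:{0..s}. exp (- c * (s - r)) * \<bar>g r\<bar>)" for s
  have ag: "(\<lambda>r. \<bar>g r\<bar>) \<in> borel_measurable borel" using g by measurable
  have agb: "\<And>r. r \<in> {0..t} \<Longrightarrow> \<bar>\<bar>g r\<bar>\<bar> \<le> B" using gb by auto
  have wh: "\<bar>w s\<bar> \<le> h s" if s: "s \<in> {0..t}" for s
  proof -
    have "w s = exp (- c * s) * (exp (c * s) * w s)"
      by (simp add: mult_exp_exp flip: mult.assoc)
    also have "\<dots> = (LBINT r:{0..s}. exp (- c * (s - r)) * g r)"
      by (simp add: eq[OF s] right_diff_distrib mult_exp_exp
          flip: set_integral_mult_right mult.assoc)
    finally have "\<bar>w s\<bar> = norm (LBINT r:{0..s}. exp (- c * (s - r)) * g r)" by simp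
    also have "\<dots> \<le> (LBINT r:{0..s}. norm (exp (- c * (s - r)) * g r))"
      using s gb c by (intro set_integral_norm_bound set_integrable_exp_mult[OF g, where B = B]) auto
    also have "\<dots> = h s" by (simp add: h_def abs_mult)
    finally show ?thesis .
  qed
  \<comment> \<open>A crude bound, for the integrability of \<open>h\<close>.\<close>
  have hb: "\<bar>h s\<bar> \<le> t * B" if s: "s \<in> {0..t}" for s
  proof -
    have B0: "0 \<le> B" using gb[of s] s by auto
    have "h s \<le> (LBINT r:{0..s}. B)"
      unfolding h_def
    proof (rule set_integral_mono)
      show "set_integrable lborel {0..s} (\<lambda>r. exp (- c * (s - r)) * \<bar>g r\<bar>)"
        using s agb c by (intro set_integrable_exp_mult[OF ag, where B = B]) auto
      show "set_integrable lborel {0..s} (\<lambda>r. B)" by (rule set_integrable_bounded_Icc[where B = "\<bar>B\<bar>"]) auto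
      fix r assume r: "r \<in> {0..s}"
      have "exp (- c * (s - r)) * \<bar>g r\<bar> \<le> 1 * B"
        using r c s gb[of r] by (intro mult_mono) auto
      then show "exp (- c * (s - r)) * \<bar>g r\<bar> \<le> B" by simp
    qed
    also have "\<dots> = s * B" using s by (simp add: set_lebesgue_integral_def)
    also have "\<dots> \<le> t * B" using s B0 by (intro mult_right_mono) auto
    finally show ?thesis using wh[OF s] by linarith
  qed
  have hm: "h \<in> borel_measurable borel"
  proof -
    have "{x::real \<times> real. 0 \<le> snd x \<and> snd x \<le> fst x} \<in> sets borel"
      by (intro borel_closed closed_Collect_conj closed_Collect_le continuous_intros)
    then have ms: "{x::real \<times> real. 0 \<le> snd x \<and> snd x \<le> fst x} \<in> sets (borel \<Otimes>\<^sub>M borel)"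
      unfolding borel_prod .
    have ind: "indicator {0..s} r = (indicator {x. 0 \<le> snd x \<and> snd x \<le> fst x} (s, r) :: real)"
      for r s :: real by (auto simp: indicator_def)
    have "(\<lambda>s. (\<integral>r. indicator {0..s} r * (exp (- c * (s - r)) * \<bar>g r\<bar>) \<partial>lborel)) \<in> borel_measurable borel"
      unfolding ind using g ms by measurable
    then show ?thesis by (simp add: h_def[abs_def] set_lebesgue_integral_def)
  qed
  have hi: "set_integrable lborel {0..t} (\<lambda>s. c * h s)"
    using set_integrable_bounded_Icc[OF hm hb] by simp
  have "c * (LBINT s:{0..t}. \<bar>w s\<bar>) = (LBINT s:{0..t}. c * \<bar>w s\<bar>)" by simp
  also have "\<dots> \<le> (LBINT s:{0..t}. c * h s)"
  proof (rule set_integral_mono[OF _ hi])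
    show "set_integrable lborel {0..t} (\<lambda>s. c * \<bar>w s\<bar>)"
      using wb w by (intro set_integrable_mult_right impI set_integrable_bounded_Icc[where B = W]) auto
  qed (use wh c in \<open>auto intro: mult_left_mono\<close>)
  also have "\<dots> = (LBINT r:{0..t}. (1 - exp (- c * (t - r))) * \<bar>g r\<bar>)"
    unfolding h_def by (rule exp_convolution_integral[OF ag agb c])
  also have "\<dots> = (LBINT r:{0..t}. \<bar>g r\<bar>) - h t"
    unfolding h_def left_diff_distrib mult_1
    using agb c by (intro set_integral_diff(2) set_integrable_exp_mult[OF ag, where B = B]
        set_integrable_bounded_Icc[OF ag, where B = B]) auto
  finally show ?thesis using wh[of t] t by simp
qed

text \<open>Each use of \<open>le\<close> improves the bound by one power, up to
  \<open>t ^ n / fact n\<close>, which vanishes in the limit. The inequality is iterated rather than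
  differentiated because the function to which it is applied involves the law, so far only known to
  be measurable.\<close>

lemma gronwall_zero:
  fixes \<psi> :: "real \<Rightarrow> real"
  assumes m: "\<psi> \<in> borel_measurable borel" and bd: "\<And>t. t \<ge> 0 \<Longrightarrow> \<psi> t \<in> {0..1}"
    and le: "\<And>t. t \<ge> 0 \<Longrightarrow> \<psi> t \<le> (LBINT s:{0..t}. \<psi> s)" and t: "t \<ge> 0"
  shows "\<psi> t = 0"
proof -
  have *: "\<psi> t \<le> t ^ n / fact n" if "t \<ge> 0" for t n
    using that
  proof (induction n arbitrary: t)
    case 0
    then show ?case using bd by simp
  next
    case (Suc n)
    have int: "(\<integral>s. s ^ n / fact n * indicator {0..t} s \<partial>lborel)
        = t ^ Suc n / fact (Suc n) - 0 ^ Suc n / fact (Suc n)"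
    proof (rule integral_FTC_Icc_real[OF Suc.prems])
      show "((\<lambda>s. s ^ Suc n / fact (Suc n)) has_real_derivative s ^ n / fact n) (at s)" for s :: real
        using DERIV_cdivide[OF DERIV_pow[of "Suc n" s], of "fact (Suc n)"]
        by (simp add: fact_Suc del: of_nat_Suc power_Suc)
    qed (auto intro!: continuous_intros)
    have "\<psi> t \<le> (LBINT s:{0..t}. \<psi> s)" using le Suc.prems by simp
    also have "\<dots> \<le> (LBINT s:{0..t}. s ^ n / fact n)"
    proof (rule set_integral_mono)
      show "set_integrable lborel {0..t} \<psi>"
        using bd by (intro set_integrable_bounded_Icc[OF m, where B = 1]) auto
      show "set_integrable lborel {0..t} (\<lambda>s. s ^ n / fact n)"
        by (rule borel_integrable_atLeastAtMost') (auto intro!: continuous_intros)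
    qed (use Suc.IH in auto)
    also have "\<dots> = t ^ Suc n / fact (Suc n)"
      using int by (simp add: set_lebesgue_integral_def mult.commute)
    finally show ?case .
  qed
  have "(\<lambda>n. t ^ n / fact n) \<longlonglongrightarrow> 0"
    using summable_LIMSEQ_zero[OF summable_exp[of t]] by (simp add: field_simps)
  then have "\<psi> t \<le> 0" using *[OF t] by (intro LIMSEQ_le_const) auto
  then show ?thesis using bd[OF t] by simp
qed

lemma has_sum_from_1_imp_LIMSEQ:
  fixes f :: "nat \<Rightarrow> real"
  assumes "(f has_sum S) {1..}"
  shows "(\<lambda>K. \<Sum>k=1..K. f k) \<longlonglongrightarrow> S"
proof -
  have "((\<lambda>n. f (Suc n)) has_sum S) UNIV"
    by (subst has_sum_reindex_bij_betw[of Suc UNIV "{1..}"])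
       (use assms in \<open>auto simp: bij_betw_def Suc_le_eq image_iff gr0_conv_Suc\<close>)
  then have "(\<lambda>n. f (Suc n)) sums S" by (rule has_sum_imp_sums)
  then show ?thesis
    by (simp add: sums_def sum.atLeast1_atMost_eq lessThan_Suc_atMost)
qed

text \<open>
  Summing the damped integral bounds for \<open>2 \<le> k \<le> K\<close>, the weighted sums
  \<open>\<Sum>j. j \<integral> \<bar>p j - v j\<bar>\<close> on both sides cancel, except for the term with \<open>j = 1\<close>.
\<close>

lemma forward_equation_unique:
  fixes p v :: "nat \<Rightarrow> real \<Rightarrow> real"
  assumes pm: "\<And>k. k \<ge> 1 \<Longrightarrow> p k \<in> borel_measurable borel"
    and vm: "\<And>k. k \<ge> 1 \<Longrightarrow> v k \<in> borel_measurable borel"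
    and p01: "\<And>k t. k \<ge> 1 \<Longrightarrow> t \<ge> 0 \<Longrightarrow> p k t \<in> {0..1}"
    and v01: "\<And>k t. k \<ge> 1 \<Longrightarrow> t \<ge> 0 \<Longrightarrow> v k t \<in> {0..1}"
    and psum: "\<And>t. t \<ge> 0 \<Longrightarrow> ((\<lambda>k. p k t) has_sum 1) {1..}"
    and vsum: "\<And>t. t \<ge> 0 \<Longrightarrow> ((\<lambda>k. v k t) has_sum 1) {1..}"
    and init: "\<And>k. k \<ge> 1 \<Longrightarrow> p k 0 = v k 0"
    and peq: "\<And>k t. k \<ge> 2 \<Longrightarrow> t \<ge> 0 \<Longrightarrow> exp (real k * t) * p k t - p k 0
      = (LBINT r:{0..t}. exp (real k * r) * (\<Sum>j=1..k-1. real j * p j r * v (k - j) r))"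
    and veq: "\<And>k t. k \<ge> 2 \<Longrightarrow> t \<ge> 0 \<Longrightarrow> exp (real k * t) * v k t - v k 0
      = (LBINT r:{0..t}. exp (real k * r) * (\<Sum>j=1..k-1. real j * v j r * v (k - j) r))"
    and k: "k \<ge> 1" and t: "t \<ge> 0"
  shows "p k t = v k t"
proof -
  define w where "w k t = p k t - v k t" for k t
  define g where "g k r = (\<Sum>j=1..k-1. real j * w j r * v (k - j) r)" for k r
  have wm: "w k \<in> borel_measurable borel" if "k \<ge> 1" for k
    unfolding w_def using pm[OF that] vm[OF that] by measurable
  have w1: "\<bar>w k t\<bar> \<le> 1" if "k \<ge> 1" "t \<ge> 0" for k t
    using p01[OF that] v01[OF that] by (auto simp: w_def)
  have gm: "g k \<in> borel_measurable borel" for k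
    unfolding g_def using wm vm by (intro borel_measurable_sum borel_measurable_times) auto
  have wv: "\<bar>a * b\<bar> \<le> c" if "\<bar>a\<bar> \<le> c" "b \<in> {0..1}" for a b c :: real
  proof -
    have "\<bar>a\<bar> * b \<le> c * 1" using that by (intro mult_mono) auto
    then show ?thesis using that by (simp add: abs_mult)
  qed
  have termb: "\<bar>real j * u j r * v (k - j) r\<bar> \<le> real j"
    if "r \<ge> 0" "j \<in> {1..k-1}" "\<bar>u j r\<bar> \<le> 1" for j k r and u :: "nat \<Rightarrow> real \<Rightarrow> real"
    proof -
    have "\<bar>real j * u j r\<bar> \<le> real j"
      using mult_left_mono[OF that(3), of "real j"] by (simp add: abs_mult)
    moreover have "v (k - j) r \<in> {0..1}" using that by (intro v01) auto
    ultimately show ?thesis by (rule wv)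
  qed
  have sumb: "\<bar>\<Sum>j=1..k-1. real j * u j r * v (k - j) r\<bar> \<le> (\<Sum>j=1..k-1. real j)"
    if "r \<ge> 0" "\<And>j. j \<ge> 1 \<Longrightarrow> \<bar>u j r\<bar> \<le> 1" for k r and u :: "nat \<Rightarrow> real \<Rightarrow> real"
    using that by (intro order.trans[OF sum_abs] sum_mono termb) auto
  have gb: "\<bar>g k r\<bar> \<le> (\<Sum>j=1..k-1. real j)" if "r \<ge> 0" for k r
    unfolding g_def using that w1 by (intro sumb) auto
  have expi: "set_integrable lborel {0..t}
      (\<lambda>r. exp (real k * r) * (\<Sum>j=1..k-1. real j * u j r * v (k - j) r))"
    if um: "\<And>k. k \<ge> 1 \<Longrightarrow> u k \<in> borel_measurable borel"
      and ub: "\<And>k r. k \<ge> 1 \<Longrightarrow> r \<ge> 0 \<Longrightarrow> \<bar>u k r\<bar> \<le> 1" for k t and u :: "nat \<Rightarrow> real \<Rightarrow> real"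
  proof (rule set_integrable_bounded_Icc[where B = "exp (real k * t) * (\<Sum>j=1..k-1. real j)"])
    show "(\<lambda>r. exp (real k * r) * (\<Sum>j=1..k-1. real j * u j r * v (k - j) r)) \<in> borel_measurable borel"
      using um vm by (intro borel_measurable_sum borel_measurable_times) auto
    fix r assume r: "r \<in> {0..t}"
    then show "\<bar>exp (real k * r) * (\<Sum>j=1..k-1. real j * u j r * v (k - j) r)\<bar>
        \<le> exp (real k * t) * (\<Sum>j=1..k-1. real j)"
      unfolding abs_mult using ub by (intro mult_mono sumb) (auto intro: mult_left_mono)
  qed
  have weq: "exp (real k * t) * w k t = (LBINT r:{0..t}. exp (real k * r) * g k r)"
    if "k \<ge> 2" "t \<ge> 0" for k t
  proof -
    have "exp (real k * t) * w k t = (exp (real k * t) * p k t - p k 0) - (exp (real k * t) * v k t - v k 0)"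
      using init[of k] that by (simp add: w_def right_diff_distrib)
    also have "\<dots> = (LBINT r:{0..t}. exp (real k * r) * (\<Sum>j=1..k-1. real j * p j r * v (k - j) r)
        - exp (real k * r) * (\<Sum>j=1..k-1. real j * v j r * v (k - j) r))"
      unfolding peq[OF that] veq[OF that]
    proof (subst set_integral_diff(2))
      show "set_integrable lborel {0..t} (\<lambda>r. exp (real k * r) * (\<Sum>j=1..k-1. real j * p j r * v (k - j) r))"
        using p01 by (intro expi pm) fastforce+
      show "set_integrable lborel {0..t} (\<lambda>r. exp (real k * r) * (\<Sum>j=1..k-1. real j * v j r * v (k - j) r))"
        using v01 by (intro expi vm) fastforce+
    qed simp
    also have "\<dots> = (LBINT r:{0..t}. exp (real k * r) * g k r)"
      by (simp add: g_def w_def sum_subtractf algebra_simps sum_distrib_left flip: sum_subtractf)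
    finally show ?thesis .
  qed
  have awi: "set_integrable lborel {0..t} (\<lambda>r. \<bar>w k r\<bar>)" if "k \<ge> 1" for k t
    using wm[OF that] w1[OF that] by (intro set_integrable_bounded_Icc[where B = 1]) auto
  have agi: "set_integrable lborel {0..t} (\<lambda>r. \<bar>g k r\<bar>)" for k t
    using gm gb by (intro set_integrable_bounded_Icc[where B = "\<Sum>j=1..k-1. real j"]) auto
  have bound: "\<bar>w k t\<bar> + real k * (LBINT s:{0..t}. \<bar>w k s\<bar>) \<le> (LBINT r:{0..t}. \<bar>g k r\<bar>)"
    if "k \<ge> 2" "t \<ge> 0" for k t
    using that w1 gb weq
    by (intro damped_integral_bound[where W = 1 and B = "\<Sum>j=1..k-1. real j"] wm gm) auto
  \<comment> \<open>Reindexing by the increment \<open>l = k - j\<close> leaves for each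
    \<open>j\<close> a partial sum of \<open>v\<close>, which is at most 1.\<close>
  have gsum: "(\<Sum>k=2..K. \<bar>g k r\<bar>) \<le> (\<Sum>j=1..K. real j * \<bar>w j r\<bar>)" if r: "r \<ge> 0" for K r
  proof -
    have "(\<Sum>k=2..K. \<bar>g k r\<bar>) \<le> (\<Sum>k=2..K. \<Sum>j=1..k-1. real j * \<bar>w j r\<bar> * v (k - j) r)"
      unfolding g_def using v01 r
      by (intro sum_mono order.trans[OF sum_abs]) (auto simp: abs_mult)
    also have "\<dots> = (\<Sum>(k,j)\<in>Sigma {2..K} (\<lambda>k. {1..k-1}). real j * \<bar>w j r\<bar> * v (k - j) r)"
      by (simp add: sum.Sigma)
    also have "\<dots> = (\<Sum>(j,l)\<in>Sigma {1..K} (\<lambda>j. {1..K-j}). real j * \<bar>w j r\<bar> * v l r)"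
      by (rule sum.reindex_bij_witness[where i = "\<lambda>(j,l). (j + l, j)" and j = "\<lambda>(k,j). (j, k - j)"]) auto
    also have "\<dots> = (\<Sum>j=1..K. real j * \<bar>w j r\<bar> * (\<Sum>l=1..K-j. v l r))"
      by (simp add: sum.Sigma sum_distrib_left)
    also have "\<dots> \<le> (\<Sum>j=1..K. real j * \<bar>w j r\<bar> * 1)"
    proof (intro sum_mono mult_left_mono)
      fix j
      show "(\<Sum>l=1..K-j. v l r) \<le> 1"
        using vsum[OF r] v01 r by (intro has_sum_mono_neutral[OF has_sum_finite vsum[OF r]]) auto
    qed auto
    finally show ?thesis by simp
  qed
  have key: "(\<Sum>k=2..K. \<bar>w k t\<bar>) \<le> (LBINT s:{0..t}. \<bar>w 1 s\<bar>)" if t: "t \<ge> 0" for K t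
  proof (cases "K \<ge> 1")
    case True
    have "(\<Sum>k=2..K. \<bar>w k t\<bar>) + (\<Sum>k=2..K. real k * (LBINT s:{0..t}. \<bar>w k s\<bar>))
        \<le> (\<Sum>k=2..K. (LBINT r:{0..t}. \<bar>g k r\<bar>))"
      unfolding sum.distrib[symmetric] using bound t by (intro sum_mono) auto
    also have "\<dots> = (LBINT r:{0..t}. (\<Sum>k=2..K. \<bar>g k r\<bar>))"
      using agi by (subst set_lebesgue_sum(2)) auto
    also have "\<dots> \<le> (LBINT r:{0..t}. (\<Sum>j=1..K. real j * \<bar>w j r\<bar>))"
    proof (rule set_integral_mono)
      show "set_integrable lborel {0..t} (\<lambda>r. \<Sum>k=2..K. \<bar>g k r\<bar>)" using agi by (intro set_lebesgue_sum(1))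
      show "set_integrable lborel {0..t} (\<lambda>r. \<Sum>j=1..K. real j * \<bar>w j r\<bar>)" using awi by (intro set_lebesgue_sum(1)) auto
    qed (use gsum in auto)
    also have "\<dots> = (\<Sum>j=1..K. real j * (LBINT r:{0..t}. \<bar>w j r\<bar>))"
      using awi by (subst set_lebesgue_sum(2)) auto
    also have "\<dots> = (LBINT s:{0..t}. \<bar>w 1 s\<bar>) + (\<Sum>k=2..K. real k * (LBINT s:{0..t}. \<bar>w k s\<bar>))"
      using True by (subst sum.atLeast_Suc_atMost) (auto simp: numeral_2_eq_2)
    finally show ?thesis by simp
  next
    case False
    then have "{2..K} = {}" by auto
    then show ?thesis by (simp add: set_lebesgue_integral_def)
  qed
  \<comment> \<open>There is no forward equation for \<open>k = 1\<close>. Since both families have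
    mass 1, \<open>w 1 t\<close> is minus the sum of the other \<open>w k t\<close> up to a tail
    that vanishes with \<open>K\<close>, and \<open>key\<close> bounds that sum uniformly in
    \<open>K\<close>.\<close>
  have w1le: "\<bar>w 1 t\<bar> \<le> (LBINT s:{0..t}. \<bar>w 1 s\<bar>)" if t: "t \<ge> 0" for t
  proof -
    have "((\<lambda>k. p k t + - v k t) has_sum (1 + - 1)) {1..}"
      by (intro has_sum_add psum has_sum_uminusI vsum t)
    then have "((\<lambda>k. w k t) has_sum 0) {1..}" by (simp add: w_def)
    from tendsto_rabs[OF has_sum_from_1_imp_LIMSEQ[OF this]]
    have lim: "(\<lambda>K. \<bar>\<Sum>k=1..K. w k t\<bar> + (LBINT s:{0..t}. \<bar>w 1 s\<bar>)) \<longlonglongrightarrow> (LBINT s:{0..t}. \<bar>w 1 s\<bar>)"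
      using tendsto_add[OF _ tendsto_const] by fastforce
    show ?thesis
    proof (rule LIMSEQ_le_const[OF lim], intro exI allI impI)
      fix K :: nat assume K: "1 \<le> K"
      have "(\<Sum>k=1..K. w k t) = w 1 t + (\<Sum>k=2..K. w k t)"
        using K by (subst sum.atLeast_Suc_atMost) (auto simp: numeral_2_eq_2)
      then have "\<bar>w 1 t\<bar> \<le> \<bar>\<Sum>k=1..K. w k t\<bar> + \<bar>\<Sum>k=2..K. w k t\<bar>" by linarith
      also have "\<bar>\<Sum>k=2..K. w k t\<bar> \<le> (LBINT s:{0..t}. \<bar>w 1 s\<bar>)"
        by (rule order.trans[OF sum_abs key[OF t]])
      finally show "\<bar>w 1 t\<bar> \<le> \<bar>\<Sum>k=1..K. w k t\<bar> + (LBINT s:{0..t}. \<bar>w 1 s\<bar>)" by simp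
    qed
  qed
  have w10: "\<bar>w 1 t\<bar> = 0" if "t \<ge> 0" for t
    using wm[of 1] w1 w1le that by (intro gronwall_zero[where \<psi> = "\<lambda>t. \<bar>w 1 t\<bar>"]) auto
  show ?thesis
  proof (cases "k = 1")
    case False
    have "\<bar>w k t\<bar> \<le> (\<Sum>k=2..k. \<bar>w k t\<bar>)" using k False by (intro member_le_sum) auto
    also have "\<dots> \<le> (LBINT s:{0..t}. \<bar>w 1 s\<bar>)" by (rule key[OF t])
    also have "\<dots> = 0" unfolding set_lebesgue_integral_def
      by (rule integral_eq_zero_AE) (use w10 in \<open>auto simp: indicator_def\<close>)
    finally show ?thesis by (simp add: w_def)
  qed (use w10[OF t] in \<open>simp add: w_def\<close>)
qed

section \<open>Paths in the state space\<close>

definition stays :: "(real \<Rightarrow> nat) \<Rightarrow> real \<Rightarrow> real \<Rightarrow> bool" where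
  "stays c a b \<longleftrightarrow> (\<forall>s\<in>{a..b}. c s = c a)"

text \<open>Only the first jump after \<open>a\<close> counts, because \<open>leaves_at\<close>
  demands constancy up to the jump. This is the kind of event whose conditional probability
  \<open>jump_mechanism\<close> prescribes.\<close>

definition leaves_to :: "(real \<Rightarrow> nat) \<Rightarrow> real \<Rightarrow> real \<Rightarrow> nat \<Rightarrow> bool" where
  "leaves_to c a b k \<longleftrightarrow> (\<exists>r\<in>{a<..b}. leaves_at c a r \<and> c r = k)"

lemma staysI: "(\<And>s. a \<le> s \<Longrightarrow> s \<le> b \<Longrightarrow> c s = c a) \<Longrightarrow> stays c a b"
  unfolding stays_def by (metis atLeastAtMost_iff)

lemma staysD: "stays c a b \<Longrightarrow> a \<le> s \<Longrightarrow> s \<le> b \<Longrightarrow> c s = c a"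
  unfolding stays_def by (erule bspec) simp

section \<open>Convergence in the state space\<close>

lemma limitin_E_iff:
  "limitin E.mtopology c x F \<longleftrightarrow> x \<ge> 1 \<and> (\<forall>e>0. \<forall>\<^sub>F t in F. c t \<ge> 1 \<and> d_E (c t) x < e)"
  unfolding E.limitin_metric by auto

text \<open>The radius \<open>1 / (x * (x + 1))\<close> is the distance from \<open>x\<close> to its
  nearest neighbour \<open>x + 1\<close>; the accumulation point 1 lies at distance
  \<open>1 / x\<close>, and smaller states are farther away than \<open>x + 1\<close>.\<close>

lemma d_E_isolated:
  assumes "x \<ge> 2" "j \<ge> 1" "d_E j x < 1 / (real x * (real x + 1))"
  shows "j = x"
proof (rule ccontr)
  assume "j \<noteq> x"
  then consider "j = 1" | "2 \<le> j" "j + 1 \<le> x" | "x + 1 \<le> j" using assms by linarith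
  then have "d_E j x \<ge> 1 / real x - 1 / (real x + 1)"
  proof cases
    case 2
    then have "1 / real j \<ge> 1 / (real x - 1)"
      using assms(1) by (intro divide_left_mono) auto
    moreover have "1 / (real x - 1) - 1 / real x \<ge> 1 / real x - 1 / (real x + 1)"
    proof -
      have "1 / (real x - 1) - 1 / real x = 1 / (real x * (real x - 1))"
        using assms(1) by (simp add: divide_simps)
      moreover have "1 / real x - 1 / (real x + 1) = 1 / (real x * (real x + 1))"
        using assms(1) by (simp add: divide_simps)
      moreover have "1 / (real x * (real x + 1)) \<le> 1 / (real x * (real x - 1))"
        using assms(1) by (intro divide_left_mono mult_left_mono mult_pos_pos) auto
      ultimately show ?thesis by simp
    qed
    ultimately show ?thesis using 2 assms(1) by (simp add: d_E_def f_E_def)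
  next
    case 3
    then have "1 / real j \<le> 1 / (real x + 1)"
      using assms(1) by (intro divide_left_mono) auto
    then show ?thesis using 3 assms(1) by (simp add: d_E_def f_E_def)
  qed (use assms in \<open>auto simp: d_E_def f_E_def\<close>)
  moreover have "1 / real x - 1 / (real x + 1) = 1 / (real x * (real x + 1))"
    using assms(1) by (simp add: field_simps)
  ultimately show False using assms(3) by linarith
qed

lemma limitin_E_isolated:
  assumes "limitin E.mtopology c x F" "x \<ge> 2"
  shows "\<forall>\<^sub>F t in F. c t = x"
proof -
  have "0 < 1 / (real x * (real x + 1))" using assms(2) by simp
  then have "\<forall>\<^sub>F t in F. c t \<ge> 1 \<and> d_E (c t) x < 1 / (real x * (real x + 1))"
    using assms(1) unfolding limitin_E_iff by blast
  then show ?thesis by eventually_elim (use d_E_isolated assms(2) in blast)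
qed

text \<open>For \<open>k \<ge> 2\<close> the set \<open>{k}\<close> is open and closed in
  \<open>E\<close>, so membership and non-membership both pass between a path and its limit. This is
  why path arguments test for a fixed \<open>k \<ge> 2\<close> and not for state 1.\<close>

lemma limitin_E_eq_iff:
  assumes "limitin E.mtopology c x F" "k \<ge> 2"
  shows "\<forall>\<^sub>F t in F. c t = k \<longleftrightarrow> x = k"
proof (cases "x \<ge> 2")
  case True
  show ?thesis using limitin_E_isolated[OF assms(1) True] by eventually_elim auto
next
  case False
  then have x: "x = 1" using assms(1) unfolding limitin_E_iff by linarith
  have "0 < 1 / real k" using assms(2) by simp
  then have "\<forall>\<^sub>F t in F. c t \<ge> 1 \<and> d_E (c t) x < 1 / real k"
    using assms(1) unfolding limitin_E_iff by blast
  then show ?thesis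
    by eventually_elim (use x assms(2) in \<open>auto simp: d_E_def f_E_def\<close>)
qed

lemma f_E_inj_on: "inj_on f_E {1..}"
  by (auto simp: inj_on_def f_E_def split: if_splits)

lemma limitin_E_tendsto:
  assumes "limitin E.mtopology c x F"
  shows "((\<lambda>t. f_E (c t)) \<longlongrightarrow> f_E x) F"
  unfolding tendsto_iff dist_real_def
proof (intro allI impI)
  fix e :: real assume "e > 0"
  then have "\<forall>\<^sub>F t in F. c t \<ge> 1 \<and> d_E (c t) x < e"
    using assms unfolding limitin_E_iff by blast
  then show "\<forall>\<^sub>F t in F. \<bar>f_E (c t) - f_E x\<bar> < e"
    by eventually_elim (simp add: d_E_def)
qed

section \<open>Cadlag paths: exits, jumps and grids\<close>

locale E_path =
  fixes c :: "real \<Rightarrow> nat"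
  assumes cadlag: "cadlag_E c" and pos: "\<And>t. t \<ge> 0 \<Longrightarrow> c t \<ge> 1"
begin

lemma right_limit: "t \<ge> 0 \<Longrightarrow> limitin E.mtopology c (c t) (at_right t)"
  using cadlag by (simp add: cadlag_E_def)

lemma right_eq_iff:
  assumes "t \<ge> 0" "k \<ge> 2"
  obtains d where "d > 0" "\<And>x. t \<le> x \<Longrightarrow> x < t + d \<Longrightarrow> c x = k \<longleftrightarrow> c t = k"
proof -
  obtain b where b: "b > t" "\<And>x. t < x \<Longrightarrow> x < b \<Longrightarrow> c x = k \<longleftrightarrow> c t = k"
    using limitin_E_eq_iff[OF right_limit[OF assms(1)] assms(2)]
    unfolding eventually_at_right_field by blast
  show ?thesis
  proof (rule that[of "b - t"])
    fix x assume "t \<le> x" "x < t + (b - t)"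
    then show "c x = k \<longleftrightarrow> c t = k" by (cases "x = t") (auto simp: b(2))
  qed (use b in simp)
qed

text \<open>Two distinct positive states are told apart by an isolated point
  \<open>k \<ge> 2\<close> equal to exactly one of them, even if the other is the accumulation point
  1; \<open>limitin_E_eq_iff\<close> then applies to that \<open>k\<close>.\<close>

lemma right_limit_frequently:
  assumes t: "t \<ge> 0" and j: "\<exists>\<^sub>F x in at_right t. c x = j"
  shows "c t = j"
proof (rule ccontr)
  assume ne: "c t \<noteq> j"
  have "\<exists>k\<ge>2. (k = c t) \<noteq> (k = j)"
  proof (cases "c t \<ge> 2")
    case False
    then have "j = 0 \<or> j \<ge> 2" using pos[OF t] ne by linarith
    moreover have "j \<noteq> 0"
    proof
      assume "j = 0"
      moreover have "\<forall>\<^sub>F x in at_right t. c x \<noteq> 0"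
        unfolding eventually_at_right_field
      proof (intro exI[of _ "t + 1"] conjI allI impI)
        fix x assume "t < x"
        then show "c x \<noteq> 0" using pos[of x] t by linarith
      qed simp
      ultimately show False using j by (simp add: frequently_def)
    qed
    ultimately show ?thesis using ne by (intro exI[of _ j]) auto
  qed (use ne in auto)
  then obtain k where k: "k \<ge> 2" "(k = c t) \<noteq> (k = j)" by blast
  have "\<forall>\<^sub>F x in at_right t. c x \<noteq> j"
    using limitin_E_eq_iff[OF right_limit[OF t] k(1)] by eventually_elim (use k in auto)
  then show False using j by (simp add: frequently_def)
qed

text \<open>Reduces the event to countably many times, for the sake of measurability. The end point
  \<open>b\<close> is tested separately: it may be irrational, and right continuity gives no access
  to it from inside the interval.\<close>

lemma stays_iff_rational:
  assumes "0 \<le> a" "a \<le> b"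
  shows "stays c a b \<longleftrightarrow> c b = c a \<and> (\<forall>q\<in>\<rat> \<inter> {a..b}. c q = c a)"
proof
  assume R: "c b = c a \<and> (\<forall>q\<in>\<rat> \<inter> {a..b}. c q = c a)"
  show "stays c a b"
    unfolding stays_def
  proof
    fix s assume s: "s \<in> {a..b}"
    show "c s = c a"
    proof (cases "s = b")
      case False
      then have sb: "s < b" using s by simp
      have "\<exists>\<^sub>F x in at_right s. c x = c a"
        unfolding frequently_def eventually_at_right_field
      proof
        assume "\<exists>y>s. \<forall>x>s. x < y \<longrightarrow> c x \<noteq> c a"
        then obtain y where y: "y > s" "\<And>x. s < x \<Longrightarrow> x < y \<Longrightarrow> c x \<noteq> c a" by blast
        then obtain q where q: "q \<in> \<rat>" "s < q" "q < min y b"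
          using Rats_dense_in_real[of s "min y b"] sb by auto
        then have "q \<in> \<rat> \<inter> {a..b}" using s by auto
        then show False using y(2)[of q] q R by auto
      qed
      then show ?thesis using right_limit_frequently s assms(1) by auto
    qed (use R in simp)
  qed
next
  assume "stays c a b"
  then show "c b = c a \<and> (\<forall>q\<in>\<rat> \<inter> {a..b}. c q = c a)"
    using assms(2) staysD[of c a b] by (metis IntD2 atLeastAtMost_iff order_refl)
qed

text \<open>Without jumps \<open>f_E \<circ> c\<close> is continuous, so its image of an interval is
  connected; being also countable, it is a single point.\<close>

lemma constant_without_jumps:
  assumes "0 \<le> a" and nj: "jump_times c \<inter> {a<..<b} = {}" and xy: "x \<in> {a<..<b}" "y \<in> {a<..<b}"
  shows "c x = c y"
proof -
  have "continuous_on {a<..<b} (\<lambda>t. f_E (c t))"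
  proof (rule continuous_at_imp_continuous_on, rule ballI)
    fix t assume t: "t \<in> {a<..<b}"
    then have "t \<notin> jump_times c" and t0: "t > 0" using nj assms(1) by auto
    then have "limitin E.mtopology c (c t) (at_left t)" by (simp add: jump_times_def)
    then show "isCont (\<lambda>t. f_E (c t)) t"
      using limitin_E_tendsto right_limit[of t] t0
      unfolding isCont_def filterlim_at_split by auto
  qed
  then have "connected ((\<lambda>t. f_E (c t)) ` {a<..<b})"
    by (rule connected_continuous_image) simp
  moreover have "countable ((\<lambda>t. f_E (c t)) ` {a<..<b})"
    by (rule countable_subset[of _ "range f_E"]) auto
  ultimately have "f_E (c x) = f_E (c y)"
    using connected_uncountable xy by (metis imageI)
  then show ?thesis
    by (rule inj_onD[OF f_E_inj_on]) (use xy assms(1) pos in auto)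
qed

text \<open>The exit time is an infimum that need not be attained: from the accumulation point 1 a
  right continuous path may depart without a jump. Hence the last conclusion promises only exits
  arbitrarily soon after \<open>r\<close>.\<close>

lemma exit_time:
  assumes "\<not> stays c a b" "a \<le> b"
  obtains r where "r \<in> {a..b}" "\<And>x. a \<le> x \<Longrightarrow> x < r \<Longrightarrow> c x = c a"
    "\<And>d. d > 0 \<Longrightarrow> \<exists>x\<in>{r..b}. x < r + d \<and> c x \<noteq> c a"
proof -
  define S where "S = {x\<in>{a..b}. c x \<noteq> c a}"
  have ne: "S \<noteq> {}" using assms by (auto simp: stays_def S_def)
  have bd: "bdd_below S" by (auto simp: S_def intro: bdd_belowI[of _ a])
  obtain x0 where x0: "x0 \<in> S" using ne by blast
  have lb: "Inf S \<ge> a" using ne by (intro cInf_greatest) (auto simp: S_def)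
  have ub: "Inf S \<le> b" using cInf_lower[OF x0 bd] x0 by (auto simp: S_def)
  show ?thesis
  proof (rule that[of "Inf S"])
    show "Inf S \<in> {a..b}" using lb ub by simp
    show "c x = c a" if "a \<le> x" "x < Inf S" for x
    proof (rule ccontr)
      assume "c x \<noteq> c a"
      then have "x \<in> S" using that ub by (auto simp: S_def)
      then show False using cInf_lower[OF _ bd] that by fastforce
    qed
    show "\<exists>x\<in>{Inf S..b}. x < Inf S + d \<and> c x \<noteq> c a" if "d > 0" for d
    proof -
      have "Inf S < Inf S + d" using that by simp
      then obtain x where "x \<in> S" "x < Inf S + d" using cInf_lessD[OF ne] by blast
      then show ?thesis using cInf_lower[OF _ bd, of x] by (auto simp: S_def)
    qed
  qed
qed

text \<open>The grid cell in which \<open>stays\<close> first fails contains the exit time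
  \<open>r\<close>. On a fine grid its right end is so close to \<open>r\<close> that right
  continuity already decides whether the state there is \<open>k\<close>. The lemma serves both the
  measurability of \<open>leaves_to\<close> and limits of its probability.\<close>

lemma leaves_to_approx:
  assumes s: "0 \<le> s" and u: "u > 0" and k: "k \<ge> 2"
  shows "\<forall>\<^sub>F n in sequentially.
    (\<exists>i<n. stays c s (s + real i * (u / real n)) \<and> \<not> stays c s (s + real (Suc i) * (u / real n))
       \<and> c (s + real (Suc i) * (u / real n)) = k)
    \<longleftrightarrow> leaves_to c s (s + u) k"
proof (cases "stays c s (s + u)")
  case True
  have "\<not> leaves_to c s (s + u) k"
  proof
    assume "leaves_to c s (s + u) k"
    then obtain r where r: "s < r" "r \<le> s + u" "c r \<noteq> c s"
      unfolding leaves_to_def leaves_at_def by (metis greaterThanAtMost_iff)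
    have "c r = c s" by (rule staysD[OF True]) (use r in auto)
    then show False using r(3) by simp
  qed
  moreover have "stays c s (s + real (Suc i) * (u / real n))" if "i < n" for i n
  proof -
    have "real (Suc i) / real n \<le> 1" using that by simp
    then have "real (Suc i) / real n * u \<le> 1 * u" using u by (intro mult_right_mono) auto
    then have "real (Suc i) * (u / real n) \<le> u" by simp
    then show ?thesis by (intro staysI staysD[OF True]) auto
  qed
  ultimately show ?thesis by auto
next
  case False
  obtain r where r: "r \<in> {s..s + u}" "\<And>x. s \<le> x \<Longrightarrow> x < r \<Longrightarrow> c x = c s"
    "\<And>d. d > 0 \<Longrightarrow> \<exists>x\<in>{r..s + u}. x < r + d \<and> c x \<noteq> c s"
  proof -
    have "s \<le> s + u" using u by simp
    then show thesis by (rule exit_time[OF False]) (rule that)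
  qed
  have r0: "0 \<le> r" using r(1) s by simp
  obtain d where d: "d > 0" "\<And>x. r \<le> x \<Longrightarrow> x < r + d \<Longrightarrow> c x = k \<longleftrightarrow> c r = k"
    using right_eq_iff[OF r0 k] by blast
  have r_le: "y \<le> r" if "s \<le> y" "stays c s y" for y
  proof (rule ccontr)
    assume "\<not> y \<le> r"
    then obtain x where "x \<in> {r..s + u}" "x < r + (y - r)" "c x \<noteq> c s"
      using r(3)[of "y - r"] by auto
    moreover from this have "c x = c s" using r(1) by (intro staysD[OF that(2)]) auto
    ultimately show False by simp
  qed
  have le_r: "r \<le> y" if nst: "\<not> stays c s y" for y
  proof (rule ccontr)
    assume "\<not> r \<le> y"
    then have "stays c s y" by (intro staysI r(2)) auto
    then show False using nst by simp
  qed
  have D: "leaves_to c s (s + u) k \<longleftrightarrow> c r = k"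
  proof
    assume "leaves_to c s (s + u) k"
    then obtain r' where r': "s < r'" "\<And>x. s \<le> x \<Longrightarrow> x < r' \<Longrightarrow> c x = c s" "c r' \<noteq> c s" "c r' = k"
      unfolding leaves_to_def leaves_at_def by (metis atLeastLessThan_iff)
    have "r' \<le> r"
    proof (rule ccontr)
      assume "\<not> r' \<le> r"
      then obtain x where "x \<in> {r..s + u}" "x < r + (r' - r)" "c x \<noteq> c s"
        using r(3)[of "r' - r"] by auto
      then show False using r'(2)[of x] r(1) by auto
    qed
    moreover have "r \<le> r'"
    proof (rule ccontr)
      assume "\<not> r \<le> r'"
      then have "c r' = c s" using r'(1) by (intro r(2)) auto
      then show False using r'(3) by simp
    qed
    ultimately show "c r = k" using r'(4) by simp
  next
    assume ck: "c r = k"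
    \<comment> \<open>If the path were still in its old state at \<open>r\<close>, that state would
      be \<open>k\<close>, and right continuity at an isolated point would forbid exits just after
      \<open>r\<close>.\<close>
    have "c r \<noteq> c s"
    proof
      assume e: "c r = c s"
      obtain x where x: "x \<in> {r..s + u}" "x < r + d" "c x \<noteq> c s" using r(3)[OF d(1)] by blast
      then have "c x = k" using d(2)[of x] ck by auto
      then show False using x(3) e ck by simp
    qed
    moreover from this have "s < r" using r(1) by (cases "r = s") auto
    moreover have "\<forall>x\<in>{s..<r}. c x = c s" by (intro ballI r(2)) auto
    ultimately have "leaves_at c s r" unfolding leaves_at_def by blast
    then show "leaves_to c s (s + u) k"
      using r(1) ck \<open>s < r\<close> by (auto simp: leaves_to_def)
  qed
  obtain N :: nat where N: "u / d < real N" using reals_Archimedean2 by blast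
  show ?thesis
    unfolding D eventually_sequentially
  proof (intro exI[of _ "Suc N"] allI impI)
    fix n assume n: "Suc N \<le> n"
    then have "u / d < real n" using N by linarith
    then have h: "u / real n < d" using d(1) n by (simp add: field_simps)
    define \<sigma> where "\<sigma> i = s + real i * (u / real n)" for i
    have \<sigma>_Suc: "\<sigma> (Suc i) = \<sigma> i + u / real n" for i by (simp add: \<sigma>_def algebra_simps add_divide_distrib)
    have \<sigma>_ge: "s \<le> \<sigma> i" for i using u by (simp add: \<sigma>_def)
    have cell: "c (\<sigma> (Suc i)) = k \<longleftrightarrow> c r = k"
      if "stays c s (\<sigma> i)" "\<not> stays c s (\<sigma> (Suc i))" for i
    proof -
      have "\<sigma> i \<le> r" by (rule r_le[OF \<sigma>_ge that(1)])
      moreover have "r \<le> \<sigma> (Suc i)" by (rule le_r[OF that(2)])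
      ultimately show ?thesis using h by (intro d(2)) (auto simp: \<sigma>_Suc)
    qed
    have "\<exists>i<n. stays c s (\<sigma> i) \<and> \<not> stays c s (\<sigma> (Suc i))"
    proof -
      have "\<sigma> n = s + u" using n by (simp add: \<sigma>_def)
      then have nn: "\<not> stays c s (\<sigma> n)" using False by simp
      have "stays c s (\<sigma> 0)" by (rule staysI) (simp add: \<sigma>_def)
      then show ?thesis
        using nn ex_least_nat_less[of "\<lambda>i. \<not> stays c s (\<sigma> i)" n] by auto
    qed
    then show "(\<exists>i<n. stays c s (s + real i * (u / real n)) \<and> \<not> stays c s (s + real (Suc i) * (u / real n))
       \<and> c (s + real (Suc i) * (u / real n)) = k) \<longleftrightarrow> c r = k"
      using cell unfolding \<sigma>_def[symmetric] by blast
  qed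
qed

lemma eventually_const_left:
  assumes r: "r > 0" and k: "c r = k" "k \<ge> 2" and ex: "explodes_at c r \<Longrightarrow> c r = 1"
  obtains x d where "d > 0" "d \<le> r" "\<And>y. r - d < y \<Longrightarrow> y < r \<Longrightarrow> c y = x"
proof -
  have "\<not> explodes_at c r" using ex k by auto
  then obtain s where s: "s < r" "finite (jump_times c \<inter> {s<..<r})"
    using r by (auto simp: explodes_at_def)
  \<comment> \<open>The extra point \<open>max 0 s\<close> keeps the set nonempty and the interval
    after its maximum within positive times.\<close>
  define J where "J = insert (max 0 s) (jump_times c \<inter> {s<..<r})"
  have fin: "finite J" using s by (simp add: J_def)
  define m where "m = Max J"
  have mJ: "m \<in> J" unfolding m_def by (rule Max_in[OF fin]) (simp add: J_def)
  have mr: "m < r" using mJ r s by (auto simp: J_def)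
  have ms: "max 0 s \<le> m" unfolding m_def by (rule Max_ge[OF fin]) (simp add: J_def)
  have nj: "jump_times c \<inter> {m<..<r} = {}"
  proof (rule ccontr)
    assume "\<not> ?thesis"
    then obtain z where z: "z \<in> jump_times c" "m < z" "z < r" by auto
    then have "z \<in> J" using ms by (auto simp: J_def)
    then show False using Max_ge[OF fin, of z] z(2) by (simp add: m_def)
  qed
  show ?thesis
  proof (rule that[of "r - m" "c ((m + r) / 2)"])
    fix y assume "r - (r - m) < y" "y < r"
    then show "c y = c ((m + r) / 2)"
      using mr ms by (intro constant_without_jumps[OF _ nj]) auto
  qed (use mr ms in auto)
qed

lemma leaves_at_unique: "leaves_at c a r \<Longrightarrow> leaves_at c a r' \<Longrightarrow> r = r'"
  unfolding leaves_at_def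
  by (metis atLeastLessThan_iff less_eq_real_def linorder_neqE_linordered_idom)

text \<open>
  A path in \<open>k \<ge> 2\<close> at time \<open>r\<close> is constant just before \<open>r\<close>: otherwise its left limit at \<open>r\<close> would be
  the accumulation point \<open>1\<close> and jumps would accumulate, so that it would be in state \<open>1\<close> at \<open>r\<close>.
\<close>

lemma arrival_local:
  assumes r: "r \<ge> 0" and k: "k \<ge> 2" and ex: "\<And>t. explodes_at c t \<Longrightarrow> c t = 1"
  obtains d where "d > 0" "\<And>a b. 0 \<le> a \<Longrightarrow> a \<le> b \<Longrightarrow> r - d < a \<Longrightarrow> b < r + d \<Longrightarrow> c b = k \<Longrightarrow>
    (\<not> stays c a b \<Longrightarrow> \<exists>l>c a. leaves_to c a b l) \<Longrightarrow>
    stays c a b \<or> (c a < k \<and> leaves_to c a b k)"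
proof -
  obtain d1 where d1: "d1 > 0" "\<And>x. r \<le> x \<Longrightarrow> x < r + d1 \<Longrightarrow> c x = k \<longleftrightarrow> c r = k"
    using right_eq_iff[OF r k] by blast
  \<comment> \<open>For intervals that end before \<open>r\<close> the state at \<open>r\<close>
    gives no information; there the left limit decides membership in \<open>{k}\<close>.\<close>
  obtain d2 where d2: "d2 > 0" "\<And>x y. 0 \<le> x \<Longrightarrow> r - d2 < x \<Longrightarrow> x \<le> y \<Longrightarrow> y < r \<Longrightarrow> c y = k \<Longrightarrow> c x = k"
  proof (cases "r = 0")
    case False
    then have "r > 0" using r by simp
    then obtain x where "limitin E.mtopology c x (at_left r)" using cadlag unfolding cadlag_E_def by blast
    from limitin_E_eq_iff[OF this k] obtain b where
      "b < r" "\<And>y. b < y \<Longrightarrow> y < r \<Longrightarrow> c y = k \<longleftrightarrow> x = k"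
      unfolding eventually_at_left_field by blast
    then show ?thesis by (intro that[of "r - b"]) auto
  qed (auto intro!: that[of 1])
  obtain d3 x where d3: "d3 > 0" "\<And>y. 0 \<le> y \<Longrightarrow> r - d3 < y \<Longrightarrow> y < r \<Longrightarrow> c r = k \<Longrightarrow> c y = x"
  proof (cases "r > 0 \<and> c r = k")
    case True
    then show ?thesis using eventually_const_left[of r k] k ex[of r] that by metis
  next
    case False
    then show ?thesis using r by (intro that[of 1]) auto
  qed
  show ?thesis
  proof (rule that[of "min d1 (min d2 d3)"])
    fix a b assume ab: "0 \<le> a" "a \<le> b" "r - min d1 (min d2 d3) < a" "b < r + min d1 (min d2 d3)"
      and cb: "c b = k" and good: "\<not> stays c a b \<Longrightarrow> \<exists>l>c a. leaves_to c a b l"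
    show "stays c a b \<or> (c a < k \<and> leaves_to c a b k)"
    proof (cases "b < r")
      case True
      have "c y = k" if "a \<le> y" "y \<le> b" for y
        using that ab True cb by (intro d2(2)[of y b]) auto
      then have "stays c a b" using ab by (intro staysI) simp
      then show ?thesis ..
    next
      case False
      then have crk: "c r = k" using d1(2)[of b] ab cb by auto
      have right: "c y = k" if "r \<le> y" "y \<le> b" for y
        using d1(2)[of y] that ab crk by auto
      show ?thesis
      proof (cases "r \<le> a")
        case True
        then have "stays c a b" using ab right by (intro staysI) simp
        then show ?thesis ..
      next
        case ra: False
        have left: "c y = x" if "a \<le> y" "y < r" for y
          using d3(2)[of y] that ab crk by auto
        have ca: "c a = x" using left[of a] ra by simp
        show ?thesis
        proof (cases "x = k")
          case True
          have "c y = k" if "a \<le> y" "y \<le> b" for y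
            using left[of y] right[of y] that True by (cases "y < r") auto
          then have "stays c a b" using ab by (intro staysI) simp
          then show ?thesis ..
        next
          case xk: False
          have "\<forall>y\<in>{a..<r}. c y = c a" unfolding ca by (intro ballI left) auto
          then have la: "leaves_at c a r" unfolding leaves_at_def ca crk using ra xk by auto
          then have lt: "leaves_to c a b k" using ra False crk by (auto simp: leaves_to_def)
          have "\<not> stays c a b"
          proof
            assume "stays c a b"
            then have "c r = c a" by (rule staysD) (use ra False in auto)
            then show False using crk ca xk by simp
          qed
          \<comment> \<open>The exit upwards provided by \<open>good\<close> is a first jump too, so
            it is the jump at \<open>r\<close>; this yields \<open>c a < k\<close>.\<close>
          then obtain l r' where l: "c a < l" "leaves_at c a r'" "c r' = l"
            using good by (auto simp: leaves_to_def)
          have "r' = r" by (rule leaves_at_unique[OF l(2) la])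
          then show ?thesis using l crk lt by auto
        qed
      qed
    qed
  qed (use d1(1) d2(1) d3(1) in simp)
qed

text \<open>The neighbourhoods from \<open>arrival_local\<close> cover \<open>[0, t]\<close>. Once
  the mesh is below a Lebesgue number of this cover, every cell lies within a single
  neighbourhood.\<close>

lemma no_bad_arrivals:
  assumes t: "t \<ge> 0" and k: "k \<ge> 2" and ex: "\<And>t. explodes_at c t \<Longrightarrow> c t = 1"
    and good: "\<And>n i. i < n \<Longrightarrow> \<not> stays c (real i * (t / real n)) (real (Suc i) * (t / real n))
      \<Longrightarrow> \<exists>l>c (real i * (t / real n)). leaves_to c (real i * (t / real n)) (real (Suc i) * (t / real n)) l"
  shows "\<forall>\<^sub>F n in sequentially. \<forall>i<n. c (real (Suc i) * (t / real n)) = k \<longrightarrow>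
    stays c (real i * (t / real n)) (real (Suc i) * (t / real n)) \<or>
    (c (real i * (t / real n)) < k \<and> leaves_to c (real i * (t / real n)) (real (Suc i) * (t / real n)) k)"
proof -
  have "\<exists>d>0. \<forall>a b. 0 \<le> a \<longrightarrow> a \<le> b \<longrightarrow> r - d < a \<longrightarrow> b < r + d \<longrightarrow> c b = k \<longrightarrow>
    (\<not> stays c a b \<longrightarrow> (\<exists>l>c a. leaves_to c a b l)) \<longrightarrow>
    stays c a b \<or> (c a < k \<and> leaves_to c a b k)" if "r \<ge> 0" for r
    using arrival_local[OF that k ex] by metis
  then obtain \<delta> where \<delta>: "\<And>r. r \<ge> 0 \<Longrightarrow> \<delta> r > 0"
    "\<And>r a b. r \<ge> 0 \<Longrightarrow> 0 \<le> a \<Longrightarrow> a \<le> b \<Longrightarrow> r - \<delta> r < a \<Longrightarrow> b < r + \<delta> r \<Longrightarrow> c b = k \<Longrightarrow>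
    (\<not> stays c a b \<longrightarrow> (\<exists>l>c a. leaves_to c a b l)) \<Longrightarrow>
    stays c a b \<or> (c a < k \<and> leaves_to c a b k)" by metis
  have "\<exists>e>0. \<forall>x\<in>{0..t}. \<exists>B\<in>(\<lambda>r. ball r (\<delta> r)) ` {0..t}. ball x e \<subseteq> B"
  proof (rule Heine_Borel_lemma)
    show "{0..t} \<subseteq> \<Union> ((\<lambda>r. ball r (\<delta> r)) ` {0..t})"
      using \<delta>(1) by force
  qed auto
  then obtain e where e: "e > 0" "\<And>x. x \<in> {0..t} \<Longrightarrow> \<exists>r\<in>{0..t}. ball x e \<subseteq> ball r (\<delta> r)" by force
  obtain N :: nat where N: "t / e < real N" using reals_Archimedean2 by blast
  show ?thesis
    unfolding eventually_sequentially
  proof (intro exI[of _ "Suc N"] allI impI)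
    fix n i assume n: "Suc N \<le> n" and i: "i < n" and ck: "c (real (Suc i) * (t / real n)) = k"
    define a b where "a = real i * (t / real n)" and "b = real (Suc i) * (t / real n)"
    have "t / e < real n" using N n by linarith
    then have h: "t / real n < e" using e(1) n by (simp add: field_simps)
    have ba: "b = a + t / real n" by (simp add: a_def b_def algebra_simps add_divide_distrib)
    have h0: "0 \<le> t / real n" using t by simp
    have a0: "0 \<le> a" unfolding a_def using h0 by (intro mult_nonneg_nonneg) auto
    have "real (Suc i) / real n \<le> 1" using i by simp
    then have "real (Suc i) / real n * t \<le> 1 * t" using t by (intro mult_right_mono) auto
    then have bt: "b \<le> t" by (simp add: b_def)
    then have "a \<in> {0..t}" using a0 ba h0 by simp
    then obtain r where r: "r \<in> {0..t}" "ball a e \<subseteq> ball r (\<delta> r)" using e(2) by blast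
    have "a \<in> ball a e" "b \<in> ball a e" using e(1) h h0 ba by (auto simp: dist_real_def)
    then have "a \<in> ball r (\<delta> r)" "b \<in> ball r (\<delta> r)" using r(2) by blast+
    then have "r - \<delta> r < a" "b < r + \<delta> r" by (auto simp: dist_real_def)
    then have "stays c a b \<or> (c a < k \<and> leaves_to c a b k)"
      using a0 ba h0 ck r(1) good[OF i] unfolding a_def[symmetric] b_def[symmetric]
      by (intro \<delta>(2)[of r]) auto
    then show "stays c (real i * (t / real n)) (real (Suc i) * (t / real n)) \<or>
      (c (real i * (t / real n)) < k \<and> leaves_to c (real i * (t / real n)) (real (Suc i) * (t / real n)) k)"
      by (simp only: a_def b_def)
  qed
qed

end

section \<open>The process at deterministic times\<close>

locale tagged_cluster =
  fixes v0 :: "nat \<Rightarrow> real" and v :: "nat \<Rightarrow> real \<Rightarrow> real"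
    and M :: "'a measure" and C :: "real \<Rightarrow> 'a \<Rightarrow> nat"
  assumes forest: "critical_forest_fire v0 v"
    and process: "tagged_cluster_process M v C"

sublocale tagged_cluster \<subseteq> prob_space M
  using process by (simp add: tagged_cluster_process_def)

context tagged_cluster
begin

abbreviation path :: "'a \<Rightarrow> real \<Rightarrow> nat" where "path \<omega> \<equiv> (\<lambda>t. C t \<omega>)"

abbreviation \<F> :: "real \<Rightarrow> 'a measure" where "\<F> \<equiv> natural_filtration M C"

lemma E_path: "\<omega> \<in> space M \<Longrightarrow> E_path (path \<omega>)"
  using process by (simp add: tagged_cluster_process_def E_path_def)

lemma measurable_C [measurable]: "t \<ge> 0 \<Longrightarrow> C t \<in> measurable M (count_space UNIV)"
  using process by (simp add: tagged_cluster_process_def)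

lemma C_ge_1: "t \<ge> 0 \<Longrightarrow> \<omega> \<in> space M \<Longrightarrow> C t \<omega> \<ge> 1"
  using process by (simp add: tagged_cluster_process_def)

lemma space_\<F> [simp]: "space (\<F> t) = space M"
  using filtration_natural_filtration[of M C] by (rule filtration.space_F)

lemma sets_\<F>_mono: "s \<le> t \<Longrightarrow> sets (\<F> s) \<subseteq> sets (\<F> t)"
  using filtration_natural_filtration[of M C] by (rule filtration.sets_F_mono)

lemma sets_\<F>_subset: "sets (\<F> t) \<subseteq> events"
proof -
  have "{C s -` A \<inter> space M |s A. 0 \<le> s \<and> s \<le> t} \<subseteq> events"
    using measurable_sets[OF measurable_C] by auto
  then show ?thesis
    unfolding natural_filtration_def
    by (subst sets_measure_of) (auto intro!: sets.sigma_sets_subset)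
qed

lemma measurable_C_\<F>: "0 \<le> s \<Longrightarrow> s \<le> t \<Longrightarrow> C s \<in> measurable (\<F> t) (count_space UNIV)"
proof (rule measurableI)
  fix A assume "0 \<le> s" "s \<le> t"
  then have "C s -` A \<inter> space M \<in> sets (\<F> t)"
    unfolding natural_filtration_def by (subst sets_measure_of) (auto intro!: sigma_sets.Basic)
  then show "C s -` A \<inter> space (\<F> t) \<in> sets (\<F> t)" by simp
qed auto

lemma pred_\<F>_imp_pred: "Measurable.pred (\<F> t) P \<Longrightarrow> Measurable.pred M P"
  using sets_\<F>_subset[of t] by (auto simp: pred_def)

lemma pred_\<F>_mono: "Measurable.pred (\<F> s) P \<Longrightarrow> s \<le> t \<Longrightarrow> Measurable.pred (\<F> t) P"
  using sets_\<F>_mono[of s t] by (auto simp: pred_def)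

lemma pred_C_\<F>: "0 \<le> s \<Longrightarrow> s \<le> t \<Longrightarrow> Measurable.pred (\<F> t) (\<lambda>\<omega>. P (C s \<omega>))"
  by (rule measurable_compose[OF measurable_C_\<F>]) auto

section \<open>Measurability of holding and jump events, and their probabilities given the
  past\<close>

lemma pred_stays:
  assumes "0 \<le> a" "a \<le> b"
  shows "Measurable.pred (\<F> b) (\<lambda>\<omega>. stays (path \<omega>) a b)"
proof -
  have *: "Measurable.pred (\<F> b) (\<lambda>\<omega>. C q \<omega> = C a \<omega>)" if "q \<in> {a..b}" for q
  proof -
    have "Measurable.pred (\<F> b) (\<lambda>\<omega>. \<exists>j. C q \<omega> = j \<and> C a \<omega> = j)"
      using that assms by (intro pred_intros_countable pred_intros_logic pred_C_\<F>) auto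
    moreover have "(\<lambda>\<omega>. C q \<omega> = C a \<omega>) = (\<lambda>\<omega>. \<exists>j. C q \<omega> = j \<and> C a \<omega> = j)" by auto
    ultimately show ?thesis by (simp only:)
  qed
  have "Measurable.pred (\<F> b) (\<lambda>\<omega>. C b \<omega> = C a \<omega> \<and>
      (\<forall>q::rat. of_rat q \<in> {a..b} \<longrightarrow> C (of_rat q) \<omega> = C a \<omega>))"
    using assms by (intro pred_intros_logic(3) pred_intros_countable pred_intros_imp' *) auto
  moreover have "stays (path \<omega>) a b \<longleftrightarrow> C b \<omega> = C a \<omega> \<and>
      (\<forall>q::rat. of_rat q \<in> {a..b} \<longrightarrow> C (of_rat q) \<omega> = C a \<omega>)"
    if "\<omega> \<in> space (\<F> b)" for \<omega>
    using E_path.stays_iff_rational[OF E_path assms] that by (force simp: Rats_def)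
  ultimately show ?thesis by (subst measurable_cong) auto
qed

text \<open>The event is a union over uncountably many jump times; \<open>leaves_to_approx\<close>
  exhibits it as the limit inferior of grid events. Membership in \<open>\<F> (s + u)\<close>, and
  not just in \<open>M\<close>, is what allows conditioning at the end of a cell.\<close>

lemma pred_leaves_to:
  assumes "0 \<le> s" "u > 0" "k \<ge> 2"
  shows "Measurable.pred (\<F> (s + u)) (\<lambda>\<omega>. leaves_to (path \<omega>) s (s + u) k)"
proof -
  define J where "J n \<omega> \<longleftrightarrow> (\<exists>i\<in>{..<n}. stays (path \<omega>) s (s + real i * (u / real n))
      \<and> \<not> stays (path \<omega>) s (s + real (Suc i) * (u / real n))
      \<and> C (s + real (Suc i) * (u / real n)) \<omega> = k)" for n \<omega>
  have grid: "0 \<le> real i * (u / real n)" "real i * (u / real n) \<le> u" if "i \<le> n" for i n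
  proof -
    have "real i / real n \<le> 1" using that by (cases "n = 0") auto
    then have "real i / real n * u \<le> 1 * u" using assms(2) by (intro mult_right_mono) auto
    then show "real i * (u / real n) \<le> u" by simp
  qed (use assms in simp)
  have J: "Measurable.pred (\<F> (s + u)) (J n)" for n
    unfolding J_def
  proof (intro pred_intros_countable_bounded(4) pred_intros_logic(2,3))
    fix i assume i: "i \<in> {..<n}"
    then show "Measurable.pred (\<F> (s + u)) (\<lambda>\<omega>. stays (path \<omega>) s (s + real i * (u / real n)))"
      using grid[of i n] assms by (intro pred_\<F>_mono[OF pred_stays]) auto
    show "Measurable.pred (\<F> (s + u)) (\<lambda>\<omega>. stays (path \<omega>) s (s + real (Suc i) * (u / real n)))"
      using grid[of "Suc i" n] assms i by (intro pred_\<F>_mono[OF pred_stays]) auto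
    show "Measurable.pred (\<F> (s + u)) (\<lambda>\<omega>. C (s + real (Suc i) * (u / real n)) \<omega> = k)"
      using grid[of "Suc i" n] assms i by (intro pred_C_\<F>) auto
  qed
  have "Measurable.pred (\<F> (s + u)) (\<lambda>\<omega>. \<exists>N. \<forall>n\<in>{N..}. J n \<omega>)"
    by (intro pred_intros_countable(2) pred_intros_countable_bounded(3) J)
  moreover have "leaves_to (path \<omega>) s (s + u) k \<longleftrightarrow> (\<exists>N. \<forall>n\<in>{N..}. J n \<omega>)"
    if "\<omega> \<in> space M" for \<omega>
  proof -
    have "\<forall>\<^sub>F n in sequentially. J n \<omega> \<longleftrightarrow> leaves_to (path \<omega>) s (s + u) k"
      using E_path.leaves_to_approx[OF E_path[OF that] assms] by (simp add: J_def Bex_def)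
    then obtain N where N: "\<And>n. n \<ge> N \<Longrightarrow> J n \<omega> \<longleftrightarrow> leaves_to (path \<omega>) s (s + u) k"
      by (auto simp: eventually_sequentially)
    show ?thesis
    proof
      assume "\<exists>N. \<forall>n\<in>{N..}. J n \<omega>"
      then obtain N' where "\<forall>n\<in>{N'..}. J n \<omega>" by blast
      then have "J (max N N') \<omega>" by simp
      then show "leaves_to (path \<omega>) s (s + u) k" using N[of "max N N'"] by simp
    qed (use N in auto)
  qed
  ultimately show ?thesis by (subst measurable_cong) auto
qed

text \<open>Integrates an almost sure statement about a conditional probability over a past event on
  which that probability is constant. The stopped algebra of the constant time \<open>s\<close>
  contains \<open>\<F> s\<close>, so \<open>D\<close> is admissible.\<close>

lemma prob_Int_of_real_cond_exp:
  assumes T: "finite_stopping_time M C (\<lambda>_. s)" and B: "B \<in> events"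
    and D: "D \<in> sets (\<F> s)"
    and ae: "AE \<omega> in M. real_cond_exp M (stopped_algebra M C (\<lambda>_. s)) (indicator B) \<omega> = h \<omega>"
    and h: "\<And>\<omega>. \<omega> \<in> D \<Longrightarrow> h \<omega> = a"
  shows "prob (D \<inter> B) = a * prob D"
proof -
  interpret F: filtration "space M" \<F> by (rule filtration_natural_filtration)
  let ?G = "stopped_algebra M C (\<lambda>_. s)"
  have st: "stopping_time \<F> (\<lambda>_. s)" by (rule stopping_time_const)
  have subs: "sets ?G \<subseteq> events"
  proof
    fix A assume "A \<in> sets ?G"
    from F.sets_pre_sigmaD[OF st this, of s] have "A \<in> sets (\<F> s)" by simp
    then show "A \<in> events" using sets_\<F>_subset by auto
  qed
  then have "subalgebra M ?G" by (auto simp: subalgebra_def F.space_pre_sigma)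
  then interpret G: sigma_finite_subalgebra M ?G
    by (intro finite_measure_subalgebra_is_sigma_finite)
       (auto simp: finite_measure_subalgebra_def finite_measure_subalgebra_axioms_def finite_measure_axioms)
  have DG: "D \<in> sets ?G"
  proof (rule F.sets_pre_sigmaI[OF st])
    fix t show "{\<omega> \<in> D. s \<le> t} \<in> sets (\<F> t)"
      using D sets_\<F>_mono[of s t] by (cases "s \<le> t") auto
  qed
  then have DM: "D \<in> events" using subs by auto
  have "(\<integral>\<omega>\<in>D. indicator B \<omega> \<partial>M) = (\<integral>\<omega>\<in>D. real_cond_exp M ?G (indicator B) \<omega> \<partial>M)"
    using B by (intro G.real_cond_exp_intA DG) (auto simp: emeasure_eq_measure)
  also have "\<dots> = (\<integral>\<omega>\<in>D. a \<partial>M)"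
    unfolding set_lebesgue_integral_def
  proof (rule integral_cong_AE)
    show "AE \<omega> in M. indicator D \<omega> *\<^sub>R real_cond_exp M ?G (indicator B) \<omega> = indicator D \<omega> *\<^sub>R a"
      using ae by eventually_elim (use h in \<open>auto simp: indicator_def\<close>)
  qed (use DM in \<open>auto intro!: borel_measurable_scaleR\<close>)
  also have "\<dots> = a * prob D" using DM by (simp add: set_lebesgue_integral_def)
  also have "(\<integral>\<omega>\<in>D. indicator B \<omega> \<partial>M) = prob (D \<inter> B)"
    using DM B by (simp add: set_lebesgue_integral_def indicator_inter_arith[symmetric])
  finally show ?thesis .
qed

lemma finite_stopping_time_const: "s \<ge> 0 \<Longrightarrow> finite_stopping_time M C (\<lambda>_. s)"
  by (simp add: finite_stopping_time_def stopping_time_const)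

lemma jump_mechanism: "jump_mechanism M v C"
  using process by (simp add: tagged_cluster_process_def)

text \<open>The event \<open>P\<close> may be anything decided by time \<open>s\<close>. Later it is
  a bad arrival in the preceding cell, or an exit into \<open>k\<close> there, so this acts as the
  Markov property at grid times.\<close>

lemma prob_stays:
  assumes s: "s \<ge> 0" and u: "u \<ge> 0" and P: "Measurable.pred (\<F> s) P"
  shows "\<P>(\<omega> in M. P \<omega> \<and> C s \<omega> = k \<and> stays (path \<omega>) s (s + u))
    = exp (- real k * u) * \<P>(\<omega> in M. P \<omega> \<and> C s \<omega> = k)"
proof -
  let ?D = "{\<omega> \<in> space M. P \<omega> \<and> C s \<omega> = k}" and ?B = "{\<omega> \<in> space M. stays (path \<omega>) s (s + u)}"
  have "Measurable.pred (\<F> s) (\<lambda>\<omega>. P \<omega> \<and> C s \<omega> = k)"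
    using s by (intro pred_intros_logic P pred_C_\<F>) auto
  then have D: "?D \<in> sets (\<F> s)" by (simp add: pred_def)
  have "Measurable.pred M (\<lambda>\<omega>. stays (path \<omega>) s (s + u))"
    using s u by (intro pred_\<F>_imp_pred[OF pred_stays]) auto
  then have B: "?B \<in> events" by (simp add: pred_def)
  have "AE \<omega> in M. real_cond_exp M (stopped_algebra M C (\<lambda>_. s)) (indicator ?B) \<omega>
      = exp (- real (C s \<omega>) * u)"
    using jump_mechanism finite_stopping_time_const[OF s] u
    unfolding jump_mechanism_def stays_def by blast
  from prob_Int_of_real_cond_exp[OF finite_stopping_time_const[OF s] B D this, of "exp (- real k * u)"]
  have "prob (?D \<inter> ?B) = exp (- real k * u) * prob ?D" by auto
  moreover have "?D \<inter> ?B = {\<omega> \<in> space M. P \<omega> \<and> C s \<omega> = k \<and> stays (path \<omega>) s (s + u)}" by blast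
  ultimately show ?thesis by simp
qed

lemma prob_leaves_to:
  assumes s: "s \<ge> 0" and u: "u > 0" and j: "1 \<le> j" "j < k"
  shows "\<P>(\<omega> in M. C s \<omega> = j \<and> leaves_to (path \<omega>) s (s + u) k)
    = (LBINT r:{0..u}. real j * exp (- real j * r) * v (k - j) (s + r)) * \<P>(\<omega> in M. C s \<omega> = j)"
proof -
  let ?D = "{\<omega> \<in> space M. C s \<omega> = j}"
  let ?B = "{\<omega> \<in> space M. \<exists>r\<in>{s<..s + u}. leaves_at (path \<omega>) s r \<and> C r \<omega> = C s \<omega> + (k - j)}"
  have D: "?D \<in> sets (\<F> s)" using pred_C_\<F>[of s s "\<lambda>c. c = j"] s by (simp add: pred_def)
  \<comment> \<open>The target of the jump depends on the random state at time \<open>s\<close>;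
    splitting by its value \<open>i\<close> leaves jumps into a fixed state, to which
    \<open>pred_leaves_to\<close> applies.\<close>
  have "Measurable.pred (\<F> (s + u)) (\<lambda>\<omega>. \<exists>i\<in>{1..}. C s \<omega> = i \<and> leaves_to (path \<omega>) s (s + u) (i + (k - j)))"
    using s u j by (intro pred_intros_countable_bounded pred_intros_logic pred_C_\<F> pred_leaves_to) auto
  from pred_\<F>_imp_pred[OF this]
  have "{\<omega> \<in> space M. \<exists>i\<in>{1..}. C s \<omega> = i \<and> leaves_to (path \<omega>) s (s + u) (i + (k - j))} \<in> events"
    by (simp only: pred_def)
  moreover have "{\<omega> \<in> space M. \<exists>i\<in>{1..}. C s \<omega> = i \<and> leaves_to (path \<omega>) s (s + u) (i + (k - j))} = ?B"
    unfolding leaves_to_def using C_ge_1[OF s] by auto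
  ultimately have B: "?B \<in> events" by simp
  have "k - j \<ge> 1" using j by simp
  then have "AE \<omega> in M. real_cond_exp M (stopped_algebra M C (\<lambda>_. s)) (indicator ?B) \<omega>
      = (LBINT r:{0..u}. real (C s \<omega>) * exp (- real (C s \<omega>) * r) * v (k - j) (s + r))"
    using jump_mechanism finite_stopping_time_const[OF s] u
    unfolding jump_mechanism_def by (meson less_eq_real_def)
  from prob_Int_of_real_cond_exp[OF finite_stopping_time_const[OF s] B D this,
      of "LBINT r:{0..u}. real j * exp (- real j * r) * v (k - j) (s + r)"]
  have "prob (?D \<inter> ?B)
    = (LBINT r:{0..u}. real j * exp (- real j * r) * v (k - j) (s + r)) * prob ?D" by auto
  moreover have "?D \<inter> ?B = {\<omega> \<in> space M. C s \<omega> = j \<and> leaves_to (path \<omega>) s (s + u) k}"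
    unfolding leaves_to_def using j by auto
  ultimately show ?thesis by simp
qed

lemma tendsto_prob:
  assumes E: "\<And>n. Measurable.pred M (E n)" and D: "Measurable.pred M D"
    and ev: "AE \<omega> in M. \<forall>\<^sub>F n in sequentially. E n \<omega> \<longleftrightarrow> D \<omega>"
  shows "(\<lambda>n. \<P>(\<omega> in M. E n \<omega>)) \<longlonglongrightarrow> \<P>(\<omega> in M. D \<omega>)"
proof -
  have Ee: "{\<omega> \<in> space M. E n \<omega>} \<in> events" for n using E by (simp add: pred_def)
  have De: "{\<omega> \<in> space M. D \<omega>} \<in> events" using D by (simp add: pred_def)
  have "(\<lambda>n. \<integral>\<omega>. indicator {\<omega> \<in> space M. E n \<omega>} \<omega> \<partial>M) \<longlonglongrightarrow> (\<integral>\<omega>. (indicator {\<omega> \<in> space M. D \<omega>} \<omega> :: real) \<partial>M)"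
  proof (rule integral_dominated_convergence[where w = "\<lambda>_. 1"])
    show "AE \<omega> in M. (\<lambda>n. indicator {\<omega> \<in> space M. E n \<omega>} \<omega> :: real)
      \<longlonglongrightarrow> indicator {\<omega> \<in> space M. D \<omega>} \<omega>"
      using ev
    proof eventually_elim
      case (elim \<omega>)
      then have "\<forall>\<^sub>F n in sequentially. (indicator {\<omega> \<in> space M. E n \<omega>} \<omega> :: real)
          = indicator {\<omega> \<in> space M. D \<omega>} \<omega>"
        by eventually_elim (auto simp: indicator_def)
      then show ?case by (rule tendsto_eventually)
    qed
  qed (use Ee De in \<open>auto simp: indicator_def\<close>)
  then show ?thesis using Ee De by (simp add: Int_absorb2 sets.sets_into_space)
qed


text \<open>The constant extension to negative times makes \<open>v k\<close> Borel on the whole line.\<close>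

definition vp :: "nat \<Rightarrow> real \<Rightarrow> real" where "vp k t = v k (max 0 t)"

lemma vp_eq: "t \<ge> 0 \<Longrightarrow> vp k t = v k t"
  by (simp add: vp_def)

lemma vp_continuous: "k \<ge> 1 \<Longrightarrow> continuous_on UNIV (vp k)"
  using forest unfolding vp_def critical_forest_fire_def
  by (auto intro!: continuous_on_compose2[of "{0..}" "v k" UNIV "\<lambda>t. max 0 t"] continuous_intros)

lemma vp_measurable: "k \<ge> 1 \<Longrightarrow> vp k \<in> borel_measurable borel"
  by (rule borel_measurable_continuous_onI[OF vp_continuous])

lemma vp_bounds: "k \<ge> 1 \<Longrightarrow> 0 \<le> vp k t" "k \<ge> 1 \<Longrightarrow> vp k t \<le> 1"
  using forest by (auto simp: vp_def critical_forest_fire_def)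

lemma vp_has_sum: "((\<lambda>l. vp l t) has_sum 1) {1..}"
  using forest by (auto simp: vp_def critical_forest_fire_def)

text \<open>At every time the increments have total mass 1, so the densities of the first jumps by
  all \<open>l \<ge> 1\<close> add up to the exponential density of the holding time. The limit is
  the probability of leaving \<open>j\<close> within time \<open>u\<close>.\<close>

lemma sum_jump_integral_tendsto:
  assumes s: "s \<ge> 0" and u: "u > 0"
  shows "(\<lambda>L. \<Sum>l=1..L. (LBINT r:{0..u}. real j * exp (- real j * r) * v l (s + r)))
    \<longlonglongrightarrow> 1 - exp (- real j * u)"
proof -
  have eq: "(LBINT r:{0..u}. real j * exp (- real j * r) * v l (s + r))
      = (LBINT r:{0..u}. real j * exp (- real j * r) * vp l (s + r))" for l
    using s by (intro set_lebesgue_integral_cong) (auto simp: vp_eq)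
  have b: "\<bar>exp (- real j * r)\<bar> \<le> 1" if "r \<ge> 0" for r using that by simp
  have int: "set_integrable lborel {0..u} (\<lambda>r. real j * exp (- real j * r) * vp l (s + r))" if "l \<ge> 1" for l
  proof (rule set_integrable_bounded_Icc[where B = "real j * 1 * 1"])
    fix r assume "r \<in> {0..u}"
    then show "\<bar>real j * exp (- real j * r) * vp l (s + r)\<bar> \<le> real j * 1 * 1"
      unfolding abs_mult using vp_bounds[OF that] b by (intro mult_mono) auto
  qed (use vp_measurable[OF that] in measurable)
  have "(\<lambda>L. LBINT r:{0..u}. (\<Sum>l=1..L. real j * exp (- real j * r) * vp l (s + r)))
      \<longlonglongrightarrow> (LBINT r:{0..u}. real j * exp (- real j * r))"
    unfolding set_lebesgue_integral_def
  proof (rule integral_dominated_convergence[where w = "\<lambda>r. indicator {0..u} r * real j"])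
    have m: "(\<lambda>r. \<Sum>l=1..L. real j * exp (- real j * r) * vp l (s + r)) \<in> borel_measurable borel" for L
      by (intro borel_measurable_sum borel_measurable_times measurable_compose[OF _ vp_measurable]) auto
    show "(\<lambda>r. indicator {0..u} r *\<^sub>R (\<Sum>l=1..L. real j * exp (- real j * r) * vp l (s + r)))
        \<in> borel_measurable lborel" for L
      using m[of L] by measurable
    show "AE r in lborel. (\<lambda>L. indicator {0..u} r *\<^sub>R (\<Sum>l=1..L. real j * exp (- real j * r) * vp l (s + r)))
        \<longlonglongrightarrow> indicator {0..u} r *\<^sub>R (real j * exp (- real j * r))"
    proof (rule AE_I2)
      fix r
      have "(\<lambda>L. indicator {0..u} r *\<^sub>R (real j * exp (- real j * r) * (\<Sum>l=1..L. vp l (s + r))))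
        \<longlonglongrightarrow> indicator {0..u} r *\<^sub>R (real j * exp (- real j * r) * 1)"
        by (intro tendsto_intros has_sum_from_1_imp_LIMSEQ vp_has_sum)
      then show "(\<lambda>L. indicator {0..u} r *\<^sub>R (\<Sum>l=1..L. real j * exp (- real j * r) * vp l (s + r)))
        \<longlonglongrightarrow> indicator {0..u} r *\<^sub>R (real j * exp (- real j * r))"
        by (simp add: sum_distrib_left)
    qed
    show "AE r in lborel. norm (indicator {0..u} r *\<^sub>R (\<Sum>l=1..L. real j * exp (- real j * r) * vp l (s + r)))
        \<le> indicator {0..u} r * real j" for L
    proof (rule AE_I2)
      fix r
      show "norm (indicator {0..u} r *\<^sub>R (\<Sum>l=1..L. real j * exp (- real j * r) * vp l (s + r)))
        \<le> indicator {0..u} r * real j"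
      proof (cases "r \<in> {0..u}")
        case True
        have "(\<Sum>l=1..L. vp l (s + r)) \<le> 1"
          using vp_bounds by (intro has_sum_mono_neutral[OF has_sum_finite vp_has_sum[of "s + r"]]) auto
        moreover have "0 \<le> (\<Sum>l=1..L. vp l (s + r))" using vp_bounds by (intro sum_nonneg) auto
        ultimately have "\<bar>real j * exp (- real j * r) * (\<Sum>l=1..L. vp l (s + r))\<bar> \<le> real j * 1 * 1"
          unfolding abs_mult using b[of r] True by (intro mult_mono) auto
        then show ?thesis using True by (simp add: sum_distrib_left)
      qed simp
    qed
  qed (use u in auto)
  also have "(LBINT r:{0..u}. real j * exp (- real j * r)) = 1 - exp (- real j * u)"
    using LBINT_exp_kernel[OF less_imp_le[OF u], of "real j"]
    by (simp only: set_lebesgue_integral_def diff_zero real_scaleR_def)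
  also have "(\<lambda>L. LBINT r:{0..u}. (\<Sum>l=1..L. real j * exp (- real j * r) * vp l (s + r)))
    = (\<lambda>L. \<Sum>l=1..L. (LBINT r:{0..u}. real j * exp (- real j * r) * v l (s + r)))"
    unfolding eq by (intro ext set_lebesgue_sum(2) int) auto
  finally show ?thesis .
qed

lemma sum_prob_disjoint:
  assumes "finite I" "\<And>i. i \<in> I \<Longrightarrow> Measurable.pred M (A i)"
    and "\<And>\<omega> i j. \<omega> \<in> space M \<Longrightarrow> i \<in> I \<Longrightarrow> j \<in> I \<Longrightarrow> A i \<omega> \<Longrightarrow> A j \<omega> \<Longrightarrow> i = j"
  shows "(\<Sum>i\<in>I. \<P>(\<omega> in M. A i \<omega>)) = \<P>(\<omega> in M. \<exists>i\<in>I. A i \<omega>)"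
proof -
  have "prob (\<Union>i\<in>I. {\<omega> \<in> space M. A i \<omega>}) = (\<Sum>i\<in>I. \<P>(\<omega> in M. A i \<omega>))"
    using assms by (intro finite_measure_finite_Union) (auto simp: pred_def disjoint_family_on_def)
  moreover have "(\<Union>i\<in>I. {\<omega> \<in> space M. A i \<omega>}) = {\<omega> \<in> space M. \<exists>i\<in>I. A i \<omega>}" by auto
  ultimately show ?thesis by simp
qed

lemma prob_mono:
  assumes "Measurable.pred M B" "\<And>\<omega>. \<omega> \<in> space M \<Longrightarrow> A \<omega> \<Longrightarrow> B \<omega>"
  shows "\<P>(\<omega> in M. A \<omega>) \<le> \<P>(\<omega> in M. B \<omega>)"
  using assms by (intro finite_measure_mono) (auto simp: pred_def)

lemma prob_disj_le:
  assumes "Measurable.pred M A" "Measurable.pred M B"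
  shows "\<P>(\<omega> in M. A \<omega> \<or> B \<omega>) \<le> \<P>(\<omega> in M. A \<omega>) + \<P>(\<omega> in M. B \<omega>)"
proof -
  have "prob ({\<omega> \<in> space M. A \<omega>} \<union> {\<omega> \<in> space M. B \<omega>}) \<le> \<P>(\<omega> in M. A \<omega>) + \<P>(\<omega> in M. B \<omega>)"
    using assms by (intro measure_Un_le) (auto simp: pred_def)
  moreover have "{\<omega> \<in> space M. A \<omega>} \<union> {\<omega> \<in> space M. B \<omega>} = {\<omega> \<in> space M. A \<omega> \<or> B \<omega>}" by auto
  ultimately show ?thesis by simp
qed

lemma pred_C: "s \<ge> 0 \<Longrightarrow> Measurable.pred M (\<lambda>\<omega>. P (C s \<omega>))"
  using pred_\<F>_imp_pred[OF pred_C_\<F>[of s s P]] by simp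

lemma pred_stays_M: "0 \<le> a \<Longrightarrow> a \<le> b \<Longrightarrow> Measurable.pred M (\<lambda>\<omega>. stays (path \<omega>) a b)"
  by (rule pred_\<F>_imp_pred[OF pred_stays])

lemma pred_leaves_to_M:
  "0 \<le> s \<Longrightarrow> u > 0 \<Longrightarrow> k \<ge> 2 \<Longrightarrow> Measurable.pred M (\<lambda>\<omega>. leaves_to (path \<omega>) s (s + u) k)"
  by (rule pred_\<F>_imp_pred[OF pred_leaves_to])

lemma leaves_to_unique:
  assumes "\<omega> \<in> space M" "leaves_to (path \<omega>) a b k" "leaves_to (path \<omega>) a b l"
  shows "k = l"
  using assms(2,3) E_path.leaves_at_unique[OF E_path[OF assms(1)]] unfolding leaves_to_def by metis

lemma leaves_to_not_stays:
  assumes "leaves_to c a b k"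
  shows "\<not> stays c a b"
proof
  assume st: "stays c a b"
  obtain r where r: "a < r" "r \<le> b" "c r \<noteq> c a"
    using assms unfolding leaves_to_def leaves_at_def by (metis greaterThanAtMost_iff)
  have "c r = c a" by (rule staysD[OF st]) (use r in auto)
  then show False using r(3) by simp
qed

text \<open>From state \<open>j\<close> an exit within time \<open>u\<close> has probability
  \<open>1 - exp (- j * u)\<close>, and first jumps upwards already account for all of it. Hence
  downward jumps, and departures from state 1 without a first jump, are null events.\<close>

lemma AE_exit_by_upward_jump:
  assumes s: "s \<ge> 0" and u: "u > 0"
  shows "AE \<omega> in M. \<not> stays (path \<omega>) s (s + u) \<longrightarrow> (\<exists>l>C s \<omega>. leaves_to (path \<omega>) s (s + u) l)"
proof -
  define bad where "bad j \<omega> \<longleftrightarrow> C s \<omega> = j \<and> \<not> stays (path \<omega>) s (s + u)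
      \<and> \<not> (\<exists>l\<in>{1..}. leaves_to (path \<omega>) s (s + u) (j + l))" for j \<omega>
  have pbad: "Measurable.pred M (bad j)" if "j \<ge> 1" for j
    unfolding bad_def using s u that
    by (intro pred_intros_logic pred_intros_countable_bounded pred_C pred_stays_M pred_leaves_to_M) auto
  have "\<P>(\<omega> in M. bad j \<omega>) = 0" if j: "j \<ge> 1" for j
  proof -
    define p where "p = \<P>(\<omega> in M. C s \<omega> = j)"
    define S where "S L = (\<Sum>l=1..L. (LBINT r:{0..u}. real j * exp (- real j * r) * v l (s + r)))" for L :: nat
    have le: "\<P>(\<omega> in M. bad j \<omega>) \<le> (1 - exp (- real j * u)) * p - S L * p" for L
    proof -
      \<comment> \<open>Disjoint parts of the event \<open>C s \<omega> = j\<close>: index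
        \<open>0\<close> is the exceptional event, \<open>1..L\<close> are first jumps by that
        increment, and \<open>Suc L\<close> is staying.\<close>
      define A where "A i \<omega> \<longleftrightarrow> (if i = 0 then bad j \<omega> else if i = Suc L
          then C s \<omega> = j \<and> stays (path \<omega>) s (s + u)
          else C s \<omega> = j \<and> leaves_to (path \<omega>) s (s + u) (j + i))" for i \<omega>
      have pA: "Measurable.pred M (A i)" for i
      proof -
        consider "i = 0" | "i = Suc L" | "i \<noteq> 0" "i \<noteq> Suc L" by blast
        then show ?thesis
        proof cases
          case 1
          then show ?thesis using pbad[OF j] by (simp add: A_def[abs_def])
        next
          case 2
          then have "A i = (\<lambda>\<omega>. C s \<omega> = j \<and> stays (path \<omega>) s (s + u))" by (auto simp: A_def)
          then show ?thesis using s u by (auto intro!: pred_intros_logic pred_C pred_stays_M)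
        next
          case 3
          then have "A i = (\<lambda>\<omega>. C s \<omega> = j \<and> leaves_to (path \<omega>) s (s + u) (j + i))" by (auto simp: A_def)
          then show ?thesis using s u 3 j by (auto intro!: pred_intros_logic pred_C pred_leaves_to_M)
        qed
      qed
      have "(\<Sum>i\<in>{0..Suc L}. \<P>(\<omega> in M. A i \<omega>)) = \<P>(\<omega> in M. \<exists>i\<in>{0..Suc L}. A i \<omega>)"
      proof (rule sum_prob_disjoint)
        fix \<omega> i i' assume \<omega>: "\<omega> \<in> space M" and i: "i \<in> {0..Suc L}" "i' \<in> {0..Suc L}" "A i \<omega>" "A i' \<omega>"
        show "i = i'"
        proof (cases "stays (path \<omega>) s (s + u)")
          case True
          have "x = Suc L" if "A x \<omega>" for x
            using that True leaves_to_not_stays[of "path \<omega>"] by (auto simp: A_def bad_def split: if_splits)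
          then show ?thesis using i by metis
        next
          case False
          then have ne: "i \<noteq> Suc L" "i' \<noteq> Suc L" using i by (auto simp: A_def split: if_splits)
          show ?thesis
          proof (cases "bad j \<omega>")
            case True
            have "x = 0" if "A x \<omega>" "x \<noteq> Suc L" for x
              using that True by (auto simp: A_def bad_def split: if_splits)
            then show ?thesis using i ne by metis
          next
            case False
            then have "j + i = j + i'"
              using i ne by (intro leaves_to_unique[OF \<omega>]) (auto simp: A_def split: if_splits)
            then show ?thesis by simp
          qed
        qed
      qed (use pA in auto)
      also have "\<dots> \<le> p"
        unfolding p_def using s by (intro prob_mono pred_C) (auto simp: A_def bad_def split: if_splits)
      finally have "\<P>(\<omega> in M. bad j \<omega>) + (\<Sum>i=1..L. \<P>(\<omega> in M. A i \<omega>)) + \<P>(\<omega> in M. A (Suc L) \<omega>) \<le> p"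
        by (simp add: sum.atLeast_Suc_atMost[of 0] A_def[of 0])
      moreover have "\<P>(\<omega> in M. A (Suc L) \<omega>) = exp (- real j * u) * p"
        using prob_stays[OF s less_imp_le[OF u], of "\<lambda>_. True" j] by (simp add: A_def p_def)
      moreover have "(\<Sum>i=1..L. \<P>(\<omega> in M. A i \<omega>)) = S L * p"
        unfolding S_def sum_distrib_right
      proof (rule sum.cong)
        fix l assume l: "l \<in> {1..L}"
        then have "A l = (\<lambda>\<omega>. C s \<omega> = j \<and> leaves_to (path \<omega>) s (s + u) (j + l))"
          by (auto simp: A_def)
        then show "\<P>(\<omega> in M. A l \<omega>) = (LBINT r:{0..u}. real j * exp (- real j * r) * v l (s + r)) * p"
          using prob_leaves_to[OF s u j, of "j + l"] l by (simp add: p_def)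
      qed simp
      ultimately show ?thesis by (simp add: algebra_simps)
    qed
    have "(\<lambda>L. (1 - exp (- real j * u)) * p - S L * p) \<longlonglongrightarrow> (1 - exp (- real j * u)) * p - (1 - exp (- real j * u)) * p"
      unfolding S_def by (intro tendsto_intros sum_jump_integral_tendsto[OF s u])
    then have "\<P>(\<omega> in M. bad j \<omega>) \<le> (1 - exp (- real j * u)) * p - (1 - exp (- real j * u)) * p"
      by (rule LIMSEQ_le_const) (use le in auto)
    then show ?thesis using measure_nonneg[of M] by (simp add: order_antisym)
  qed
  then have "AE \<omega> in M. \<forall>j\<in>{1..}. \<not> bad j \<omega>"
    using pbad by (subst AE_ball_countable) (auto simp: prob_Collect_eq_0 pred_def)
  moreover have "AE \<omega> in M. \<omega> \<in> space M" by (rule AE_space)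
  ultimately show ?thesis
  proof eventually_elim
    case (elim \<omega>)
    then have "\<not> bad (C s \<omega>) \<omega>" using C_ge_1[OF s] by simp
    then have "\<not> stays (path \<omega>) s (s + u) \<longrightarrow> (\<exists>l\<in>{1..}. leaves_to (path \<omega>) s (s + u) (C s \<omega> + l))"
      unfolding bad_def by blast
    then show ?case by (metis less_add_same_cancel1 atLeast_iff less_le_trans zero_less_one)
  qed
qed

text \<open>Phrased as the complement of the two ways that the forward equation accounts for. It
  thereby covers intermediate states and explosions within a cell without any count of
  jumps.\<close>

definition bad_arrival :: "nat \<Rightarrow> real \<Rightarrow> real \<Rightarrow> 'a \<Rightarrow> bool" where
  "bad_arrival k a b \<omega> \<longleftrightarrow> C b \<omega> = k \<and> \<not> stays (path \<omega>) a b
     \<and> \<not> (C a \<omega> < k \<and> leaves_to (path \<omega>) a b k)"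

lemma pred_bad_arrival:
  assumes "0 \<le> a" "a < b" "k \<ge> 2"
  shows "Measurable.pred (\<F> b) (bad_arrival k a b)"
proof -
  have "Measurable.pred (\<F> b) (\<lambda>\<omega>. leaves_to (path \<omega>) a b k)"
    using pred_leaves_to[of a "b - a" k] assms by simp
  then show ?thesis
    unfolding bad_arrival_def using assms
    by (intro pred_intros_logic pred_C_\<F> pred_stays) auto
qed

text \<open>That bad cells disappear almost surely gives only that the probability of having one
  tends to 0; the number of bad cells comes with no evident integrable bound. The estimate
  \<open>le\<close> passes from that probability to the sum at the price of the factor
  \<open>exp (k * t)\<close>.\<close>

lemma sum_bad_arrivals_tendsto:
  assumes t: "t > 0" and k: "k \<ge> 2"
  shows "(\<lambda>n. \<Sum>i<n. \<P>(\<omega> in M. bad_arrival k (real i * (t / real n)) (real (Suc i) * (t / real n)) \<omega>)) \<longlonglongrightarrow> 0"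
proof -
  define g where "g n i = real i * (t / real n)" for n i
  have g: "0 \<le> g n i" "i < n \<Longrightarrow> g n (Suc i) = g n i + t / real n" "i < n \<Longrightarrow> g n i < g n (Suc i)"
    "i \<le> n \<Longrightarrow> g n i \<le> t" "i \<le> j \<Longrightarrow> g n i \<le> g n j" for n i j
  proof -
    show "0 \<le> g n i" using t by (simp add: g_def)
    show e: "g n (Suc i) = g n i + t / real n" by (simp add: g_def algebra_simps add_divide_distrib)
    show "g n i < g n (Suc i)" if "i < n" using e t that by simp
    show "g n i \<le> g n j" if "i \<le> j" unfolding g_def using that t by (intro mult_right_mono) auto
    show "g n i \<le> t" if "i \<le> n"
    proof -
      have "real i / real n \<le> 1" using that by (cases "n = 0") auto
      then have "real i / real n * t \<le> 1 * t" using t by (intro mult_right_mono) auto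
      then show ?thesis by (simp add: g_def)
    qed
  qed
  define bad where "bad n i = bad_arrival k (g n i) (g n (Suc i))" for n i
  have badF: "Measurable.pred (\<F> (g n (Suc i))) (bad n i)" if "i < n" for n i
    unfolding bad_def using that k g by (intro pred_bad_arrival) auto
  have badM: "Measurable.pred M (bad n i)" if "i < n" for n i
    by (rule pred_\<F>_imp_pred[OF badF[OF that]])
  have exM: "Measurable.pred M (\<lambda>\<omega>. \<exists>i\<in>{..<n}. bad n i \<omega>)" for n
    using badM by (intro pred_intros_countable_bounded) auto
  have lim: "(\<lambda>n. \<P>(\<omega> in M. \<exists>i\<in>{..<n}. bad n i \<omega>)) \<longlonglongrightarrow> \<P>(\<omega> in M. False)"
  proof (rule tendsto_prob[OF exM])
    \<comment> \<open>A countable union over all cells of all grids, so that one null set serves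
      every \<open>n\<close>.\<close>
    have good: "AE \<omega> in M. \<forall>n. \<forall>i\<in>{..<n}. \<not> stays (path \<omega>) (g n i) (g n (Suc i))
        \<longrightarrow> (\<exists>l>C (g n i) \<omega>. leaves_to (path \<omega>) (g n i) (g n (Suc i)) l)"
      unfolding AE_all_countable
    proof (rule allI, subst AE_ball_countable, simp, rule ballI)
      fix n i :: nat assume "i \<in> {..<n}"
      then have "AE \<omega> in M. \<not> stays (path \<omega>) (g n i) (g n i + t / real n)
        \<longrightarrow> (\<exists>l>C (g n i) \<omega>. leaves_to (path \<omega>) (g n i) (g n i + t / real n) l)"
        using t g by (intro AE_exit_by_upward_jump) auto
      then show "AE \<omega> in M. \<not> stays (path \<omega>) (g n i) (g n (Suc i))
        \<longrightarrow> (\<exists>l>C (g n i) \<omega>. leaves_to (path \<omega>) (g n i) (g n (Suc i)) l)"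
        using g(2)[of i n] \<open>i \<in> {..<n}\<close> by simp
    qed
    have expl: "AE \<omega> in M. \<forall>t. explodes_at (path \<omega>) t \<longrightarrow> C t \<omega> = 1"
      using process by (simp add: tagged_cluster_process_def)
    have sp: "AE \<omega> in M. \<omega> \<in> space M" by (rule AE_space)
    show "AE \<omega> in M. \<forall>\<^sub>F n in sequentially. (\<exists>i\<in>{..<n}. bad n i \<omega>) \<longleftrightarrow> False"
      using good expl sp
    proof eventually_elim
      case (elim \<omega>)
      have "\<forall>\<^sub>F n in sequentially. \<forall>i<n. C (g n (Suc i)) \<omega> = k \<longrightarrow>
        stays (path \<omega>) (g n i) (g n (Suc i)) \<or>
        (C (g n i) \<omega> < k \<and> leaves_to (path \<omega>) (g n i) (g n (Suc i)) k)"
        unfolding g_def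
        by (rule E_path.no_bad_arrivals[OF E_path])
           (use t k elim in \<open>auto simp: g_def\<close>)
      then show ?case by eventually_elim (auto simp: bad_def bad_arrival_def)
    qed
  qed simp
  have le: "(\<Sum>i<n. \<P>(\<omega> in M. bad n i \<omega>)) \<le> exp (real k * t) * \<P>(\<omega> in M. \<exists>i\<in>{..<n}. bad n i \<omega>)" for n
  proof -
    \<comment> \<open>Staying for a further time \<open>t\<close> reaches beyond the end of the grid
      from any cell, and the common duration gives the same factor for all \<open>i\<close>.\<close>
    define B where "B i \<omega> \<longleftrightarrow> bad n i \<omega> \<and> stays (path \<omega>) (g n (Suc i)) (g n (Suc i) + t)" for i \<omega>
    have pB: "\<P>(\<omega> in M. bad n i \<omega>) = exp (real k * t) * \<P>(\<omega> in M. B i \<omega>)" if i: "i < n" for i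
    proof -
      have "\<P>(\<omega> in M. bad n i \<omega> \<and> C (g n (Suc i)) \<omega> = k \<and> stays (path \<omega>) (g n (Suc i)) (g n (Suc i) + t))
        = exp (- real k * t) * \<P>(\<omega> in M. bad n i \<omega> \<and> C (g n (Suc i)) \<omega> = k)"
        using t g by (intro prob_stays badF[OF i]) auto
      moreover have "(bad n i \<omega> \<and> C (g n (Suc i)) \<omega> = k \<and> stays (path \<omega>) (g n (Suc i)) (g n (Suc i) + t)) = B i \<omega>"
        "(bad n i \<omega> \<and> C (g n (Suc i)) \<omega> = k) = bad n i \<omega>" for \<omega>
        by (auto simp: B_def bad_def bad_arrival_def)
      ultimately show ?thesis by (simp add: exp_minus field_simps)
    qed
    have BM: "Measurable.pred M (B i)" if "i < n" for i
      unfolding B_def using that t g by (intro pred_intros_logic badM pred_stays_M) auto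
    \<comment> \<open>After \<open>B i\<close> the path rests in \<open>k\<close> to the end of the
      grid, so it stays throughout every later cell, which is therefore not bad.\<close>
    have no: "\<not> (i < i' \<and> B i \<omega> \<and> bad n i' \<omega>)" if i': "i' < n" for i i' \<omega>
    proof
      assume a: "i < i' \<and> B i \<omega> \<and> bad n i' \<omega>"
      then have st: "stays (path \<omega>) (g n (Suc i)) (g n (Suc i) + t)" by (simp add: B_def)
      have lo: "g n (Suc i) \<le> g n i'" using a g(5)[of "Suc i" i' n] by simp
      have hi: "g n (Suc i') \<le> g n (Suc i) + t" using g(4)[of "Suc i'" n] g(1)[of n "Suc i"] i' by simp
      have "stays (path \<omega>) (g n i') (g n (Suc i'))"
      proof (rule staysI)
        fix x assume x: "g n i' \<le> x" "x \<le> g n (Suc i')"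
        have "path \<omega> x = path \<omega> (g n (Suc i))"
          by (rule staysD[OF st]) (use x lo hi in auto)
        moreover have "path \<omega> (g n i') = path \<omega> (g n (Suc i))"
          by (rule staysD[OF st]) (use x lo hi in auto)
        ultimately show "path \<omega> x = path \<omega> (g n i')" by (simp only:)
      qed
      then show False using a by (simp add: bad_def bad_arrival_def)
    qed
    have "(\<Sum>i<n. \<P>(\<omega> in M. bad n i \<omega>)) = exp (real k * t) * (\<Sum>i<n. \<P>(\<omega> in M. B i \<omega>))"
      by (simp add: sum_distrib_left pB)
    also have "(\<Sum>i<n. \<P>(\<omega> in M. B i \<omega>)) = \<P>(\<omega> in M. \<exists>i\<in>{..<n}. B i \<omega>)"
    proof (rule sum_prob_disjoint)
      fix \<omega> i j assume "i \<in> {..<n}" "j \<in> {..<n}" "B i \<omega>" "B j \<omega>"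
      then show "i = j" using no[of j i \<omega>] no[of i j \<omega>] by (auto simp: B_def linorder_neq_iff)
    qed (use BM in auto)
    also have "\<dots> \<le> \<P>(\<omega> in M. \<exists>i\<in>{..<n}. bad n i \<omega>)"
      by (intro prob_mono exM) (auto simp: B_def)
    finally show ?thesis by simp
  qed
  have "(\<lambda>n. exp (real k * t) * \<P>(\<omega> in M. \<exists>i\<in>{..<n}. bad n i \<omega>)) \<longlonglongrightarrow> exp (real k * t) * 0"
    using lim by (intro tendsto_intros) simp
  then have up: "(\<lambda>n. exp (real k * t) * \<P>(\<omega> in M. \<exists>i\<in>{..<n}. bad n i \<omega>)) \<longlonglongrightarrow> 0" by simp
  have "(\<lambda>n. \<Sum>i<n. \<P>(\<omega> in M. bad n i \<omega>)) \<longlonglongrightarrow> 0"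
    by (rule tendsto_sandwich[OF _ _ tendsto_const up]) (use le in \<open>auto intro!: always_eventually sum_nonneg\<close>)
  then show ?thesis by (simp only: bad_def g_def)
qed

section \<open>Two-sided bounds for arrival in one cell\<close>

lemma arrival_prob_upper:
  assumes s: "s \<ge> 0" and u: "u > 0" and k: "k \<ge> 2"
  shows "\<P>(\<omega> in M. C (s + u) \<omega> = k) \<le> exp (- real k * u) * \<P>(\<omega> in M. C s \<omega> = k)
    + \<P>(\<omega> in M. bad_arrival k s (s + u) \<omega>)
    + (\<Sum>j=1..k-1. \<P>(\<omega> in M. C s \<omega> = j \<and> leaves_to (path \<omega>) s (s + u) k))"
proof -
  let ?S = "\<lambda>\<omega>. True \<and> C s \<omega> = k \<and> stays (path \<omega>) s (s + u)"
  let ?J = "\<lambda>\<omega>. \<exists>j\<in>{1..k-1}. C s \<omega> = j \<and> leaves_to (path \<omega>) s (s + u) k"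
  have pS: "Measurable.pred M ?S" using s u by (intro pred_intros_logic pred_C pred_stays_M) auto
  have pB: "Measurable.pred M (bad_arrival k s (s + u))"
    using s u k by (intro pred_\<F>_imp_pred[OF pred_bad_arrival]) auto
  have pJ: "Measurable.pred M (\<lambda>\<omega>. C s \<omega> = j \<and> leaves_to (path \<omega>) s (s + u) k)" for j
    using s u k by (intro pred_intros_logic pred_C pred_leaves_to_M) auto
  have pJJ: "Measurable.pred M ?J" by (intro pred_intros_countable_bounded pJ)
  have pSB: "Measurable.pred M (\<lambda>\<omega>. ?S \<omega> \<or> bad_arrival k s (s + u) \<omega>)"
    by (intro pred_intros_logic pS pB)
  have "\<P>(\<omega> in M. C (s + u) \<omega> = k) \<le> \<P>(\<omega> in M. (?S \<omega> \<or> bad_arrival k s (s + u) \<omega>) \<or> ?J \<omega>)"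
  proof (rule prob_mono)
    fix \<omega> assume \<omega>: "\<omega> \<in> space M" and e: "C (s + u) \<omega> = k"
    show "(?S \<omega> \<or> bad_arrival k s (s + u) \<omega>) \<or> ?J \<omega>"
    proof (cases "stays (path \<omega>) s (s + u)")
      case True
      have "C (s + u) \<omega> = C s \<omega>" by (rule staysD[OF True]) (use u in auto)
      then show ?thesis using True e by simp
    next
      case False
      then show ?thesis using e C_ge_1[OF s \<omega>] by (auto simp: bad_arrival_def)
    qed
  qed (intro pred_intros_logic pS pB pJJ)
  also have "\<dots> \<le> \<P>(\<omega> in M. ?S \<omega>) + \<P>(\<omega> in M. bad_arrival k s (s + u) \<omega>) + \<P>(\<omega> in M. ?J \<omega>)"
    using prob_disj_le[OF pS pB] prob_disj_le[OF pSB pJJ] by linarith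
  also have "\<P>(\<omega> in M. ?S \<omega>) = exp (- real k * u) * \<P>(\<omega> in M. C s \<omega> = k)"
    using prob_stays[of s u "\<lambda>_. True" k] s u by simp
  also have "\<P>(\<omega> in M. ?J \<omega>) = (\<Sum>j=1..k-1. \<P>(\<omega> in M. C s \<omega> = j \<and> leaves_to (path \<omega>) s (s + u) k))"
    by (rule sum_prob_disjoint[symmetric]) (use pJ in auto)
  finally show ?thesis .
qed

text \<open>A path that jumps to \<open>k\<close> within the cell must still be there at its end.
  Since the jump time is random, the holding estimate is applied at the next point of a finer grid
  inside the cell, and the grid is then refined. The time left is at most \<open>u\<close>, so
  \<open>exp (- k * u)\<close> is a common lower factor for all subcells.\<close>

lemma arrival_prob_lower:
  assumes s: "s \<ge> 0" and u: "u > 0" and k: "k \<ge> 2"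
  shows "\<P>(\<omega> in M. C (s + u) \<omega> = k) \<ge> exp (- real k * u) * (\<P>(\<omega> in M. C s \<omega> = k)
    + (\<Sum>j=1..k-1. \<P>(\<omega> in M. C s \<omega> = j \<and> leaves_to (path \<omega>) s (s + u) k)))"
proof -
  define g where "g n i = s + real i * (u / real n)" for n i
  have g: "s \<le> g n i" "i < n \<Longrightarrow> g n i < g n (Suc i)" "i \<le> n \<Longrightarrow> g n i \<le> s + u"
    "i \<le> j \<Longrightarrow> g n i \<le> g n j" for n i j
  proof -
    show "s \<le> g n i" using u by (simp add: g_def)
    show "g n i \<le> g n j" if "i \<le> j" unfolding g_def using that u by (intro add_left_mono mult_right_mono) auto
    show "g n i < g n (Suc i)" if "i < n"
      unfolding g_def using that u by (intro add_strict_left_mono mult_strict_right_mono) auto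
    show "g n i \<le> s + u" if "i \<le> n"
    proof -
      have "real i / real n \<le> 1" using that by (cases "n = 0") auto
      then have "real i / real n * u \<le> 1 * u" using u by (intro mult_right_mono) auto
      then show ?thesis by (simp add: g_def)
    qed
  qed
  define J where "J n i \<omega> \<longleftrightarrow> C s \<omega> < k \<and> stays (path \<omega>) s (g n i) \<and> \<not> stays (path \<omega>) s (g n (Suc i))
      \<and> C (g n (Suc i)) \<omega> = k" for n i \<omega>
  define D where "D \<omega> \<longleftrightarrow> C s \<omega> < k \<and> leaves_to (path \<omega>) s (s + u) k" for \<omega>
  have JF: "Measurable.pred (\<F> (g n (Suc i))) (J n i)" if "i < n" for n i
    unfolding J_def using s g(1)[of n i] g(1)[of n "Suc i"] g(2)[OF that]
    by (intro pred_intros_logic pred_C_\<F> pred_stays pred_\<F>_mono[OF pred_stays[of s "g n i"]]) auto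
  have JM: "Measurable.pred M (J n i)" if "i < n" for n i by (rule pred_\<F>_imp_pred[OF JF[OF that]])
  have DM: "Measurable.pred M D"
    unfolding D_def using s u k by (intro pred_intros_logic pred_C pred_leaves_to_M) auto
  have exM: "Measurable.pred M (\<lambda>\<omega>. \<exists>i\<in>{..<n}. J n i \<omega>)" for n
    using JM by (intro pred_intros_countable_bounded) auto
  have lim: "(\<lambda>n. \<P>(\<omega> in M. \<exists>i\<in>{..<n}. J n i \<omega>)) \<longlonglongrightarrow> \<P>(\<omega> in M. D \<omega>)"
  proof (rule tendsto_prob[OF exM DM], rule AE_I2)
    fix \<omega> assume "\<omega> \<in> space M"
    from E_path.leaves_to_approx[OF E_path[OF this] s u k]
    show "\<forall>\<^sub>F n in sequentially. (\<exists>i\<in>{..<n}. J n i \<omega>) \<longleftrightarrow> D \<omega>"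
      unfolding g_def[symmetric] by eventually_elim (auto simp: J_def D_def)
  qed
  have J_uniq: "i = i'" if "J n i \<omega>" "J n i' \<omega>" for n i i' \<omega>
  proof -
    have no: "\<not> (i < i' \<and> J n i \<omega> \<and> J n i' \<omega>)" for i i'
    proof
      assume a: "i < i' \<and> J n i \<omega> \<and> J n i' \<omega>"
      then have le: "g n (Suc i) \<le> g n i'" by (intro g(4)) auto
      have st: "stays (path \<omega>) s (g n i')" using a by (simp add: J_def)
      have "stays (path \<omega>) s (g n (Suc i))"
      proof (rule staysI)
        fix x assume "s \<le> x" "x \<le> g n (Suc i)"
        then show "path \<omega> x = path \<omega> s" using le by (intro staysD[OF st]) auto
      qed
      then show False using a by (simp add: J_def)
    qed
    then show ?thesis using that by (metis linorder_neqE_nat)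
  qed
  have le: "exp (- real k * u) * (\<P>(\<omega> in M. C s \<omega> = k) + \<P>(\<omega> in M. \<exists>i\<in>{..<n}. J n i \<omega>))
      \<le> \<P>(\<omega> in M. C (s + u) \<omega> = k)" for n
  proof -
    \<comment> \<open>Index \<open>n\<close>, which labels no subcell, stands for the paths that
      occupy \<open>k\<close> throughout; the condition \<open>C s \<omega> < k\<close> in
      \<open>J\<close> keeps them apart from the others.\<close>
    define A where "A i \<omega> \<longleftrightarrow> (if i = n then C s \<omega> = k \<and> stays (path \<omega>) s (s + u)
      else J n i \<omega> \<and> stays (path \<omega>) (g n (Suc i)) (s + u))" for i \<omega>
    have An: "A n = (\<lambda>\<omega>. True \<and> C s \<omega> = k \<and> stays (path \<omega>) s (s + u))" by (auto simp: A_def)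
    have Ai: "A i = (\<lambda>\<omega>. J n i \<omega> \<and> stays (path \<omega>) (g n (Suc i)) (s + u))" if "i < n" for i
      using that by (auto simp: A_def)
    have AM: "Measurable.pred M (A i)" if "i \<in> {..n}" for i
    proof (cases "i = n")
      case True
      then show ?thesis unfolding True An using s u by (intro pred_intros_logic pred_C pred_stays_M) auto
    next
      case False
      then have i: "i < n" using that by simp
      then show ?thesis
        unfolding Ai[OF i] using s g(1)[of n "Suc i"] g(3)[of "Suc i" n]
        by (intro pred_intros_logic JM pred_stays_M) auto
    qed
    have ge: "exp (- real k * u) * \<P>(\<omega> in M. J n i \<omega>) \<le> \<P>(\<omega> in M. A i \<omega>)" if i: "i < n" for i
    proof -
      have g1: "0 \<le> g n (Suc i)" "g n (Suc i) \<le> s + u" "s \<le> g n (Suc i)"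
        using s g(1)[of n "Suc i"] g(3)[of "Suc i" n] i by auto
      have "\<P>(\<omega> in M. J n i \<omega> \<and> C (g n (Suc i)) \<omega> = k \<and> stays (path \<omega>) (g n (Suc i)) (g n (Suc i) + (s + u - g n (Suc i))))
        = exp (- real k * (s + u - g n (Suc i))) * \<P>(\<omega> in M. J n i \<omega> \<and> C (g n (Suc i)) \<omega> = k)"
        using g1 by (intro prob_stays JF[OF i]) auto
      moreover have "(J n i \<omega> \<and> C (g n (Suc i)) \<omega> = k) = J n i \<omega>" for \<omega> by (auto simp: J_def)
      moreover have "(J n i \<omega> \<and> C (g n (Suc i)) \<omega> = k \<and> stays (path \<omega>) (g n (Suc i)) (g n (Suc i) + (s + u - g n (Suc i))))
        = A i \<omega>" for \<omega> using Ai[OF i] by (auto simp: J_def)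
      ultimately have "\<P>(\<omega> in M. A i \<omega>) = exp (- real k * (s + u - g n (Suc i))) * \<P>(\<omega> in M. J n i \<omega>)" by simp
      moreover have "exp (- real k * u) \<le> exp (- real k * (s + u - g n (Suc i)))"
        using g1(3) by (simp add: mult_left_mono)
      ultimately show ?thesis by (simp add: mult_right_mono)
    qed
    have "exp (- real k * u) * (\<P>(\<omega> in M. C s \<omega> = k) + \<P>(\<omega> in M. \<exists>i\<in>{..<n}. J n i \<omega>))
      = exp (- real k * u) * \<P>(\<omega> in M. C s \<omega> = k) + (\<Sum>i<n. exp (- real k * u) * \<P>(\<omega> in M. J n i \<omega>))"
      using JM J_uniq
      by (subst sum_prob_disjoint[symmetric]) (auto simp: distrib_left sum_distrib_left)
    also have "\<dots> \<le> \<P>(\<omega> in M. A n \<omega>) + (\<Sum>i<n. \<P>(\<omega> in M. A i \<omega>))"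
    proof (intro add_mono sum_mono ge)
      show "exp (- real k * u) * \<P>(\<omega> in M. C s \<omega> = k) \<le> \<P>(\<omega> in M. A n \<omega>)"
        unfolding An using prob_stays[of s u "\<lambda>_. True" k] s u by simp
    qed auto
    also have "\<dots> = (\<Sum>i\<in>{..n}. \<P>(\<omega> in M. A i \<omega>))"
      by (simp add: lessThan_Suc_atMost[symmetric])
    also have "\<dots> = \<P>(\<omega> in M. \<exists>i\<in>{..n}. A i \<omega>)"
    proof (rule sum_prob_disjoint)
      fix \<omega> i j assume ij: "i \<in> {..n}" "j \<in> {..n}" "A i \<omega>" "A j \<omega>"
      have n_iff: "x = n \<longleftrightarrow> C s \<omega> = k" if "A x \<omega>" for x
        using that by (auto simp: A_def J_def split: if_splits)
      show "i = j"
      proof (cases "C s \<omega> = k")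
        case True
        then show ?thesis using n_iff[OF ij(3)] n_iff[OF ij(4)] by blast
      next
        case False
        then have "i \<noteq> n" "j \<noteq> n" using n_iff[OF ij(3)] n_iff[OF ij(4)] by blast+
        then have "J n i \<omega>" "J n j \<omega>" using ij(3,4) unfolding A_def by presburger+
        then show ?thesis by (rule J_uniq)
      qed
    qed (use AM in auto)
    also have "\<dots> \<le> \<P>(\<omega> in M. C (s + u) \<omega> = k)"
    proof (intro prob_mono pred_C)
      fix \<omega> assume "\<exists>i\<in>{..n}. A i \<omega>"
      then obtain i where i: "i \<le> n" "A i \<omega>" by auto
      show "C (s + u) \<omega> = k"
      proof (cases "i = n")
        case True
        then have st: "stays (path \<omega>) s (s + u)" and e: "C s \<omega> = k" using i An by auto
        have "C (s + u) \<omega> = C s \<omega>" by (rule staysD[OF st]) (use u in auto)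
        then show ?thesis using e by simp
      next
        case False
        then have st: "stays (path \<omega>) (g n (Suc i)) (s + u)" and e: "C (g n (Suc i)) \<omega> = k"
          using i by (auto simp: A_def J_def)
        have "C (s + u) \<omega> = C (g n (Suc i)) \<omega>"
          by (rule staysD[OF st]) (use g(3)[of "Suc i" n] i False in auto)
        then show ?thesis using e by simp
      qed
    qed (use s u in auto)
    finally show ?thesis .
  qed
  have "(\<lambda>n. exp (- real k * u) * (\<P>(\<omega> in M. C s \<omega> = k) + \<P>(\<omega> in M. \<exists>i\<in>{..<n}. J n i \<omega>)))
    \<longlonglongrightarrow> exp (- real k * u) * (\<P>(\<omega> in M. C s \<omega> = k) + \<P>(\<omega> in M. D \<omega>))"
    by (intro tendsto_intros lim)
  then have "exp (- real k * u) * (\<P>(\<omega> in M. C s \<omega> = k) + \<P>(\<omega> in M. D \<omega>)) \<le> \<P>(\<omega> in M. C (s + u) \<omega> = k)"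
    by (rule LIMSEQ_le_const2) (use le in auto)
  moreover have "\<P>(\<omega> in M. D \<omega>) = (\<Sum>j=1..k-1. \<P>(\<omega> in M. C s \<omega> = j \<and> leaves_to (path \<omega>) s (s + u) k))"
  proof (subst sum_prob_disjoint)
    show "Measurable.pred M (\<lambda>\<omega>. C s \<omega> = j \<and> leaves_to (path \<omega>) s (s + u) k)" for j
      using s u k by (intro pred_intros_logic pred_C pred_leaves_to_M) auto
    have "D \<omega> \<longleftrightarrow> (\<exists>j\<in>{1..k-1}. C s \<omega> = j \<and> leaves_to (path \<omega>) s (s + u) k)" if "\<omega> \<in> space M" for \<omega>
      using C_ge_1[OF s that] by (auto simp: D_def)
    then show "\<P>(\<omega> in M. D \<omega>) = \<P>(\<omega> in M. \<exists>j\<in>{1..k-1}. C s \<omega> = j \<and> leaves_to (path \<omega>) s (s + u) k)"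
      by (intro arg_cong[where f = prob]) auto
  qed auto
  ultimately show ?thesis by simp
qed

end

section \<open>The forward equation for the law\<close>

lemma LBINT_Icc_split:
  fixes f :: "real \<Rightarrow> real"
  assumes "set_integrable lborel {a..c} f" "a \<le> b" "b \<le> c"
  shows "(LBINT r:{a..c}. f r) = (LBINT r:{a..b}. f r) + (LBINT r:{b..c}. f r)"
proof -
  have "set_integrable lborel {a..b} f" "set_integrable lborel {b..c} f"
    using assms by (auto intro: set_integrable_subset)
  moreover have "AE x in lborel. \<not> (x \<in> {a..b} \<and> x \<in> {b..c})"
    using AE_lborel_singleton[of b] by eventually_elim auto
  ultimately have "(LBINT r:{a..b} \<union> {b..c}. f r) = (LBINT r:{a..b}. f r) + (LBINT r:{b..c}. f r)"
    by (intro set_integral_Un_AE) auto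
  moreover have "{a..b} \<union> {b..c} = {a..c}" using assms by auto
  ultimately show ?thesis by simp
qed

context tagged_cluster
begin

definition law :: "nat \<Rightarrow> real \<Rightarrow> real" where
  "law k t = \<P>(\<omega> in M. C (max 0 t) \<omega> = k)"

text \<open>The factor removes the loss term of the forward equation. Clamping time at 0 makes the
  function monotone on the whole line, hence Borel, and this is where measurability of the law comes
  from.\<close>

definition scaled_law :: "nat \<Rightarrow> real \<Rightarrow> real" where
  "scaled_law k t = exp (real k * max 0 t) * law k t"

lemma law_eq: "t \<ge> 0 \<Longrightarrow> law k t = \<P>(\<omega> in M. C t \<omega> = k)"
  by (simp add: law_def)

lemma law_bounds: "0 \<le> law k t" "law k t \<le> 1"
  by (auto simp: law_def)

text \<open>Staying put is one way of being in \<open>k\<close> later, and it costs exactly the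
  factor that the scaling restores.\<close>

lemma scaled_law_mono: "mono (scaled_law k)"
proof (rule monoI)
  fix x y :: real assume "x \<le> y"
  show "scaled_law k x \<le> scaled_law k y"
  proof (cases "max 0 x = max 0 y")
    case True
    then show ?thesis by (simp add: scaled_law_def law_def)
  next
    case False
    define s u where "s = max 0 x" and "u = max 0 y - max 0 x"
    have su: "s \<ge> 0" "u > 0" "max 0 y = s + u" using False \<open>x \<le> y\<close> by (auto simp: s_def u_def)
    have "exp (- real k * u) * \<P>(\<omega> in M. C s \<omega> = k) = \<P>(\<omega> in M. True \<and> C s \<omega> = k \<and> stays (path \<omega>) s (s + u))"
      using su prob_stays[of s u "\<lambda>_. True" k] by simp
    also have "\<dots> \<le> \<P>(\<omega> in M. C (s + u) \<omega> = k)"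
    proof (intro prob_mono pred_C)
      fix \<omega> assume a: "True \<and> C s \<omega> = k \<and> stays (path \<omega>) s (s + u)"
      then have st: "stays (path \<omega>) s (s + u)" by simp
      have "C (s + u) \<omega> = C s \<omega>" by (rule staysD[OF st]) (use su in auto)
      then show "C (s + u) \<omega> = k" using a by simp
    qed (use su in auto)
    finally have "exp (real k * (s + u)) * (exp (- real k * u) * \<P>(\<omega> in M. C s \<omega> = k))
        \<le> exp (real k * (s + u)) * \<P>(\<omega> in M. C (s + u) \<omega> = k)"
      by (intro mult_left_mono) auto
    also have "exp (real k * (s + u)) * (exp (- real k * u) * \<P>(\<omega> in M. C s \<omega> = k))
        = exp (real k * s) * \<P>(\<omega> in M. C s \<omega> = k)"
      by (simp add: mult_exp_exp algebra_simps flip: mult.assoc)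
    finally show ?thesis unfolding scaled_law_def law_def su(3) s_def[symmetric] .
  qed
qed

lemma law_measurable: "law k \<in> borel_measurable borel"
proof -
  have "law k = (\<lambda>t. exp (- real k * max 0 t) * scaled_law k t)"
    by (auto simp: scaled_law_def mult_exp_exp simp flip: mult.assoc)
  moreover have "scaled_law k \<in> borel_measurable borel"
    by (rule borel_measurable_mono[OF scaled_law_mono])
  ultimately show ?thesis by simp
qed

lemma law_decay:
  assumes "0 \<le> s" "s \<le> r"
  shows "exp (- real j * (r - s)) * law j s \<le> law j r"
proof -
  have "exp (real j * s) * law j s \<le> exp (real j * r) * law j r"
    using monoD[OF scaled_law_mono, of s r j] assms by (simp add: scaled_law_def)
  then have "exp (- real j * r) * (exp (real j * s) * law j s) \<le> exp (- real j * r) * (exp (real j * r) * law j r)"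
    by (intro mult_left_mono) auto
  then show ?thesis by (simp add: mult_exp_exp algebra_simps flip: mult.assoc)
qed

text \<open>Mass that has newly entered \<open>j\<close> since time \<open>s\<close> is measured by
  the increment of \<open>scaled_law j\<close>. Such errors telescope over a grid, which replaces a
  modulus of continuity of the law.\<close>

lemma law_decay_upper:
  assumes "0 \<le> s" "s \<le> r" "r \<le> s'"
  shows "law j r \<le> exp (- real j * (r - s)) * law j s + exp (- real j * r) * (scaled_law j s' - scaled_law j s)"
proof -
  have "exp (real j * r) * law j r \<le> scaled_law j s'"
    using monoD[OF scaled_law_mono, of r s' j] assms by (simp add: scaled_law_def)
  then have "exp (- real j * r) * (exp (real j * r) * law j r)
      \<le> exp (- real j * r) * (scaled_law j s + (scaled_law j s' - scaled_law j s))"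
    by (intro mult_left_mono) auto
  also have "exp (- real j * r) * (exp (real j * r) * law j r) = law j r"
    by (simp add: mult_exp_exp flip: mult.assoc)
  finally have "law j r \<le> exp (- real j * r) * (scaled_law j s + (scaled_law j s' - scaled_law j s))" .
  moreover have "exp (- real j * r) * scaled_law j s = exp (- real j * (r - s)) * law j s"
    using assms by (simp add: scaled_law_def mult_exp_exp algebra_simps flip: mult.assoc)
  ultimately show ?thesis by (simp only: distrib_left)
qed

lemma law_has_sum: "((\<lambda>k. law k t) has_sum 1) {1..}"
proof -
  let ?A = "\<lambda>i. {\<omega> \<in> space M. C (max 0 t) \<omega> = Suc i}"
  have "(\<lambda>i. prob (?A i)) sums prob (\<Union>i. ?A i)"
    using pred_C[of "max 0 t"]
    by (intro finite_measure_UNION) (auto simp: disjoint_family_on_def pred_def)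
  moreover have "(\<Union>i. ?A i) = space M"
    using C_ge_1[of "max 0 t"] by (auto simp: Suc_le_eq gr0_conv_Suc)
  ultimately have "(\<lambda>i. law (Suc i) t) sums 1" by (simp add: law_def prob_space)
  then have "((\<lambda>i. law (Suc i) t) has_sum 1) UNIV"
    using law_bounds by (intro sums_nonneg_imp_has_sum) auto
  then show ?thesis
    by (subst (asm) has_sum_reindex_bij_betw[of Suc UNIV "{1..}" "\<lambda>k. law k t"])
       (auto simp: bij_betw_def Suc_le_eq image_iff gr0_conv_Suc)
qed

text \<open>In absolute time the integrand shows \<open>exp (- j * (r - s)) * law j s\<close>, the
  mass that has occupied \<open>j\<close> ever since \<open>s\<close>. By \<open>law_decay\<close>
  it approximates \<open>law j r\<close> from below.\<close>

lemma prob_leaves_to_shifted: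
  assumes s: "s \<ge> 0" and u: "u > 0" and j: "1 \<le> j" "j < k"
  shows "\<P>(\<omega> in M. C s \<omega> = j \<and> leaves_to (path \<omega>) s (s + u) k)
    = (LBINT r:{s..s + u}. real j * (exp (- real j * (r - s)) * law j s) * vp (k - j) r)"
proof -
  let ?f = "\<lambda>r. indicator {s..s + u} r *\<^sub>R (real j * exp (- real j * (r - s)) * vp (k - j) r)"
  have "(LBINT r:{0..u}. real j * exp (- real j * r) * v (k - j) (s + r)) = integral\<^sup>L lborel (\<lambda>r. ?f (s + 1 * r))"
    unfolding set_lebesgue_integral_def using s
    by (intro Bochner_Integration.integral_cong) (auto simp: indicator_def vp_eq)
  also have "\<dots> = integral\<^sup>L lborel ?f"
    using lborel_integral_real_affine[of 1 ?f s] by simp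
  finally have *: "(LBINT r:{0..u}. real j * exp (- real j * r) * v (k - j) (s + r)) = integral\<^sup>L lborel ?f" .
  have "(LBINT r:{s..s + u}. real j * (exp (- real j * (r - s)) * law j s) * vp (k - j) r)
      = integral\<^sup>L lborel (\<lambda>r. ?f r * law j s)"
    unfolding set_lebesgue_integral_def by (intro Bochner_Integration.integral_cong) auto
  then show ?thesis
    unfolding prob_leaves_to[OF s u j] law_eq[OF s, symmetric] * by simp
qed

text \<open>The gain term of the forward equation with its integrating factor: the expected
  derivative of \<open>scaled_law k\<close>.\<close>

definition gain :: "nat \<Rightarrow> real \<Rightarrow> real" where
  "gain k r = exp (real k * r) * (\<Sum>j=1..k-1. real j * law j r * vp (k - j) r)"

lemma sum_weighted_bound:
  assumes "\<And>j. j \<in> {1..k-1} \<Longrightarrow> \<bar>x j\<bar> \<le> 1"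
  shows "\<bar>\<Sum>j=1..k-1. real j * x j * vp (k - j) r\<bar> \<le> (\<Sum>j=1..k-1. real j)"
proof (rule order.trans[OF sum_abs sum_mono])
  fix j assume j: "j \<in> {1..k-1}"
  then have "\<bar>real j * x j * vp (k - j) r\<bar> \<le> real j * 1 * 1"
    unfolding abs_mult using assms[OF j] vp_bounds[of "k - j" r] by (intro mult_mono) auto
  then show "\<bar>real j * x j * vp (k - j) r\<bar> \<le> real j" by simp
qed

lemma gain_measurable: "gain k \<in> borel_measurable borel"
  unfolding gain_def
  using law_measurable vp_measurable
  by (intro borel_measurable_times borel_measurable_sum) auto

lemma gain_integrable: "set_integrable lborel {a..b} (gain k)"
proof (rule set_integrable_bounded_Icc[OF gain_measurable])
  fix r assume r: "r \<in> {a..b}"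
  have "\<bar>\<Sum>j=1..k-1. real j * law j r * vp (k - j) r\<bar> \<le> (\<Sum>j=1..k-1. real j)"
    using law_bounds by (intro sum_weighted_bound) auto
  then show "\<bar>gain k r\<bar> \<le> exp (real k * b) * (\<Sum>j=1..k-1. real j)"
    unfolding gain_def abs_mult using r by (intro mult_mono) (auto intro: mult_left_mono)
qed

text \<open>Both bounds compare the probability \<open>P\<close> of a direct jump to
  \<open>k\<close> with the integral of \<open>gain k\<close> over the cell. From above, the mass
  remaining from time \<open>s\<close> is replaced by the whole law; from below, the newcomers are
  paid for by \<open>law_decay_upper\<close>. The horizon \<open>T\<close> makes the exponential
  constants the same for all cells.\<close>

lemma cell_bounds:
  assumes s: "s \<ge> 0" and u: "u > 0" and k: "k \<ge> 2" and T: "s + u \<le> T"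
  shows cell_upper: "scaled_law k (s + u) - scaled_law k s
      \<le> exp (real k * T) * \<P>(\<omega> in M. bad_arrival k s (s + u) \<omega>) + exp (real k * u) * (LBINT r:{s..s + u}. gain k r)"
    and cell_lower: "(LBINT r:{s..s + u}. gain k r) \<le> exp (real k * u) * (scaled_law k (s + u) - scaled_law k s)
      + u * (exp (real k * T) * (\<Sum>j=1..k-1. real j * (scaled_law j (s + u) - scaled_law j s)))"
proof -
  \<comment> \<open>The sum in \<open>gain k r\<close> with each \<open>law j r\<close> replaced by
    the mass that has not left \<open>j\<close> since \<open>s\<close>.\<close>
  define H where "H r = (\<Sum>j=1..k-1. real j * (exp (- real j * (r - s)) * law j s) * vp (k - j) r)" for r
  define P where "P = (\<Sum>j=1..k-1. \<P>(\<omega> in M. C s \<omega> = j \<and> leaves_to (path \<omega>) s (s + u) k))"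
  have eb: "\<bar>exp (- real j * (r - s)) * law j s\<bar> \<le> 1" if "r \<in> {s..s + u}" for r j
  proof -
    have "exp (- real j * (r - s)) * law j s \<le> 1 * 1"
      using that law_bounds by (intro mult_mono) auto
    then show ?thesis using law_bounds by simp
  qed
  have termm: "(\<lambda>r. real j * (exp (- real j * (r - s)) * law j s) * vp (k - j) r) \<in> borel_measurable borel"
    if "j \<in> {1..k-1}" for j
    using that by (intro borel_measurable_times vp_measurable) auto
  have Hi: "set_integrable lborel {s..s + u} H"
  proof (rule set_integrable_bounded_Icc)
    show "H \<in> borel_measurable borel" unfolding H_def by (intro borel_measurable_sum termm)
    show "\<bar>H r\<bar> \<le> (\<Sum>j=1..k-1. real j)" if "r \<in> {s..s + u}" for r
      unfolding H_def using eb[OF that] by (intro sum_weighted_bound) auto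
  qed
  have PH: "P = (LBINT r:{s..s + u}. H r)"
  proof -
    have "P = (\<Sum>j=1..k-1. (LBINT r:{s..s + u}. real j * (exp (- real j * (r - s)) * law j s) * vp (k - j) r))"
      unfolding P_def using prob_leaves_to_shifted[OF s u] k by (intro sum.cong) auto
    also have "\<dots> = (LBINT r:{s..s + u}. H r)"
      unfolding H_def
    proof (rule set_lebesgue_sum(2)[symmetric])
      fix j assume j: "j \<in> {1..k-1}"
      show "set_integrable lborel {s..s + u} (\<lambda>r. real j * (exp (- real j * (r - s)) * law j s) * vp (k - j) r)"
      proof (rule set_integrable_bounded_Icc[OF termm[OF j]])
        fix r assume "r \<in> {s..s + u}"
        then show "\<bar>real j * (exp (- real j * (r - s)) * law j s) * vp (k - j) r\<bar> \<le> real j * 1 * 1"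
          unfolding abs_mult[of "_ * _" "vp _ _"] abs_mult[of "real j"]
          using eb[of r j] vp_bounds[of "k - j" r] j by (intro mult_mono) auto
      qed
    qed
    finally show ?thesis .
  qed
  have Hpos: "0 \<le> H r" for r
    unfolding H_def using law_bounds vp_bounds by (intro sum_nonneg mult_nonneg_nonneg) auto
  have Ppos: "0 \<le> P" unfolding P_def by (intro sum_nonneg) auto
  have bpos: "0 \<le> \<P>(\<omega> in M. bad_arrival k s (s + u) \<omega>)" by simp
  have scaled: "scaled_law k s = exp (real k * s) * law k s"
    "scaled_law k (s + u) = exp (real k * (s + u)) * law k (s + u)"
    using s u by (simp_all add: scaled_law_def)
  have su: "s + u \<ge> 0" using s u by simp
  have e1: "exp (real k * (s + u)) * (exp (- real k * u) * x) = exp (real k * s) * x" for x :: real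
    by (simp add: mult_exp_exp algebra_simps flip: mult.assoc)
  have e2: "exp (real k * (s + u)) = exp (real k * u) * exp (real k * s)"
    by (simp add: mult_exp_exp algebra_simps)
  have "exp (real k * (s + u)) * law k (s + u) \<le> exp (real k * (s + u)) *
      (exp (- real k * u) * law k s + \<P>(\<omega> in M. bad_arrival k s (s + u) \<omega>) + P)"
    using arrival_prob_upper[OF s u k] s su unfolding P_def law_eq[OF s] law_eq[OF su]
    by (intro mult_left_mono) auto
  then have "scaled_law k (s + u) \<le> scaled_law k s
      + exp (real k * (s + u)) * \<P>(\<omega> in M. bad_arrival k s (s + u) \<omega>) + exp (real k * (s + u)) * P"
    by (simp only: scaled distrib_left[of "exp (real k * (s + u))"] e1)
  moreover have "exp (real k * (s + u)) * \<P>(\<omega> in M. bad_arrival k s (s + u) \<omega>)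
      \<le> exp (real k * T) * \<P>(\<omega> in M. bad_arrival k s (s + u) \<omega>)"
    using T by (intro mult_right_mono) (auto intro: mult_left_mono)
  moreover have "exp (real k * (s + u)) * P \<le> exp (real k * u) * (LBINT r:{s..s + u}. gain k r)"
  proof -
    have "exp (real k * s) * P = (LBINT r:{s..s + u}. exp (real k * s) * H r)" by (simp add: PH)
    also have "\<dots> \<le> (LBINT r:{s..s + u}. gain k r)"
    proof (rule set_integral_mono[OF _ gain_integrable])
      show "set_integrable lborel {s..s + u} (\<lambda>r. exp (real k * s) * H r)" using Hi by simp
      fix r assume r: "r \<in> {s..s + u}"
      have "H r \<le> (\<Sum>j=1..k-1. real j * law j r * vp (k - j) r)"
        unfolding H_def using law_decay[of s r] s r vp_bounds
        by (intro sum_mono mult_right_mono mult_left_mono) auto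
      then show "exp (real k * s) * H r \<le> gain k r"
        unfolding gain_def using r Hpos by (intro mult_mono) (auto intro: mult_left_mono)
    qed
    finally show ?thesis unfolding e2 mult.assoc by (intro mult_left_mono) auto
  qed
  ultimately show "scaled_law k (s + u) - scaled_law k s
      \<le> exp (real k * T) * \<P>(\<omega> in M. bad_arrival k s (s + u) \<omega>) + exp (real k * u) * (LBINT r:{s..s + u}. gain k r)"
    by linarith
  define E where "E = exp (real k * T) * (\<Sum>j=1..k-1. real j * (scaled_law j (s + u) - scaled_law j s))"
  have "exp (real k * (s + u)) * (exp (- real k * u) * (law k s + P)) \<le> exp (real k * (s + u)) * law k (s + u)"
    using arrival_prob_lower[OF s u k] s su unfolding P_def law_eq[OF s] law_eq[OF su]
    by (intro mult_left_mono) auto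
  then have low: "exp (real k * s) * P \<le> scaled_law k (s + u) - scaled_law k s"
    unfolding scaled e1 by (simp add: distrib_left)
  have Ei: "set_integrable lborel {s..s + u} (\<lambda>r. E)"
    by (rule set_integrable_bounded_Icc[where B = "\<bar>E\<bar>"]) auto
  have "(LBINT r:{s..s + u}. gain k r) \<le> (LBINT r:{s..s + u}. exp (real k * u) * exp (real k * s) * H r + E)"
  proof (rule set_integral_mono[OF gain_integrable])
    show "set_integrable lborel {s..s + u} (\<lambda>r. exp (real k * u) * exp (real k * s) * H r + E)"
      by (intro set_integral_add(1) set_integrable_mult_right impI Hi Ei)
    fix r assume r: "r \<in> {s..s + u}"
    have d0: "0 \<le> scaled_law j (s + u) - scaled_law j s" for j
      using monoD[OF scaled_law_mono[of j], of s "s + u"] u by simp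
    have "(\<Sum>j=1..k-1. real j * law j r * vp (k - j) r)
      \<le> (\<Sum>j=1..k-1. real j * (exp (- real j * (r - s)) * law j s) * vp (k - j) r
          + real j * (scaled_law j (s + u) - scaled_law j s))"
    proof (rule sum_mono)
      fix j assume j: "j \<in> {1..k-1}"
      have vb: "0 \<le> vp (k - j) r" "vp (k - j) r \<le> 1" using vp_bounds[of "k - j" r] j by auto
      have "exp (- real j * r) * (scaled_law j (s + u) - scaled_law j s) \<le> 1 * (scaled_law j (s + u) - scaled_law j s)"
        using d0[of j] s r by (intro mult_right_mono) auto
      then have "law j r \<le> exp (- real j * (r - s)) * law j s + (scaled_law j (s + u) - scaled_law j s)"
        using law_decay_upper[of s r "s + u" j] s r by auto
      then have "real j * law j r * vp (k - j) r \<le>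
          real j * (exp (- real j * (r - s)) * law j s + (scaled_law j (s + u) - scaled_law j s)) * vp (k - j) r"
        using vb by (intro mult_right_mono mult_left_mono) auto
      also have "\<dots> = real j * (exp (- real j * (r - s)) * law j s) * vp (k - j) r
          + real j * (scaled_law j (s + u) - scaled_law j s) * vp (k - j) r"
        by (simp add: distrib_left distrib_right)
      also have "real j * (scaled_law j (s + u) - scaled_law j s) * vp (k - j) r
          \<le> real j * (scaled_law j (s + u) - scaled_law j s) * 1"
        using vb d0[of j] by (intro mult_left_mono) auto
      finally show "real j * law j r * vp (k - j) r \<le> real j * (exp (- real j * (r - s)) * law j s) * vp (k - j) r
          + real j * (scaled_law j (s + u) - scaled_law j s)" by simp
    qed
    also have "\<dots> = H r + (\<Sum>j=1..k-1. real j * (scaled_law j (s + u) - scaled_law j s))"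
      by (simp add: H_def sum.distrib)
    finally have "gain k r \<le> exp (real k * r) * (H r + (\<Sum>j=1..k-1. real j * (scaled_law j (s + u) - scaled_law j s)))"
      unfolding gain_def by (intro mult_left_mono) auto
    also have "\<dots> = exp (real k * r) * H r + exp (real k * r) * (\<Sum>j=1..k-1. real j * (scaled_law j (s + u) - scaled_law j s))"
      by (simp add: distrib_left)
    also have "\<dots> \<le> exp (real k * (s + u)) * H r + E"
      unfolding E_def
    proof (intro add_mono mult_right_mono Hpos sum_nonneg mult_nonneg_nonneg d0)
      show "exp (real k * r) \<le> exp (real k * (s + u))" "exp (real k * r) \<le> exp (real k * T)"
        using r T by (auto intro: mult_left_mono)
    qed auto
    finally show "gain k r \<le> exp (real k * u) * exp (real k * s) * H r + E" unfolding e2 .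
  qed
  also have "\<dots> = exp (real k * u) * (exp (real k * s) * P) + u * E"
  proof -
    have "(LBINT r:{s..s + u}. exp (real k * u) * exp (real k * s) * H r + E)
      = (LBINT r:{s..s + u}. exp (real k * u) * exp (real k * s) * H r) + (LBINT r:{s..s + u}. E)"
      by (intro set_integral_add(2) set_integrable_mult_right impI Hi Ei)
    moreover have "(LBINT r:{s..s + u}. E) = u * E" using u by (simp add: set_lebesgue_integral_def)
    ultimately show ?thesis by (simp add: PH)
  qed
  also have "\<dots> \<le> exp (real k * u) * (scaled_law k (s + u) - scaled_law k s) + u * E"
    using low by (intro add_right_mono mult_left_mono) auto
  finally show "(LBINT r:{s..s + u}. gain k r) \<le> exp (real k * u) * (scaled_law k (s + u) - scaled_law k s)
      + u * (exp (real k * T) * (\<Sum>j=1..k-1. real j * (scaled_law j (s + u) - scaled_law j s)))"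
    by (simp only: E_def)
qed

lemma LBINT_gain_grid:
  assumes "t \<ge> 0" "m \<le> n"
  shows "(LBINT r:{0..real m * (t / real n)}. gain k r)
    = (\<Sum>i<m. (LBINT r:{real i * (t / real n)..real (Suc i) * (t / real n)}. gain k r))"
  using assms(2)
proof (induction m)
  case 0
  have "AE r in lborel. indicator {0..0} r *\<^sub>R gain k r = 0"
    using AE_lborel_singleton[of "0 :: real"] by eventually_elim (auto simp: indicator_def)
  then show ?case by (simp add: set_lebesgue_integral_def integral_eq_zero_AE)
next
  case (Suc m)
  have h: "0 \<le> t / real n" using assms by simp
  have "real m * (t / real n) \<le> real (Suc m) * (t / real n)" by (intro mult_right_mono h) auto
  moreover have "0 \<le> real m * (t / real n)" by (intro mult_nonneg_nonneg h) auto
  ultimately have "(LBINT r:{0..real (Suc m) * (t / real n)}. gain k r) =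
     (LBINT r:{0..real m * (t / real n)}. gain k r)
     + (LBINT r:{real m * (t / real n)..real (Suc m) * (t / real n)}. gain k r)"
    by (intro LBINT_Icc_split gain_integrable)
  then show ?case using Suc by simp
qed

text \<open>Summed over \<open>n\<close> cells, the bounds of \<open>cell_bounds\<close> leave three
  errors: the bad arrivals, a factor \<open>exp (k * t / n)\<close> in place of 1, and
  \<open>t / n\<close> times the constant \<open>S\<close> into which the increments
  telescope.\<close>

lemma scaled_law_forward:
  assumes t: "t > 0" and k: "k \<ge> 2"
  shows "scaled_law k t - scaled_law k 0 = (LBINT r:{0..t}. gain k r)"
proof -
  define I where "I = (LBINT r:{0..t}. gain k r)"
  define S where "S = exp (real k * t) * (\<Sum>j=1..k-1. real j * (scaled_law j t - scaled_law j 0))"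
  define bad where "bad n = (\<Sum>i<n. \<P>(\<omega> in M. bad_arrival k (real i * (t / real n)) (real (Suc i) * (t / real n)) \<omega>))"
    for n :: nat
  have grid: "real (Suc i) * (t / real n) = real i * (t / real n) + t / real n" for i n
    by (simp add: algebra_simps add_divide_distrib)
  have grid_le: "real i * (t / real n) + t / real n \<le> t" if "i < n" for i n
  proof -
    have "real (Suc i) / real n * t \<le> 1 * t" using t that by (intro mult_right_mono) auto
    then show ?thesis unfolding grid[symmetric] by (simp del: of_nat_Suc)
  qed
  have tel: "(\<Sum>i<n. scaled_law j (real (Suc i) * (t / real n)) - scaled_law j (real i * (t / real n)))
      = scaled_law j t - scaled_law j 0" if "n \<ge> 1" for j n
    using sum_lessThan_telescope[of "\<lambda>i. scaled_law j (real i * (t / real n))" n] that by simp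
  have Isum: "I = (\<Sum>i<n. (LBINT r:{real i * (t / real n)..real (Suc i) * (t / real n)}. gain k r))"
    if "n \<ge> 1" for n
    using LBINT_gain_grid[of t n n k] t that by (simp add: I_def)
  have up: "scaled_law k t - scaled_law k 0 \<le> exp (real k * t) * bad n + exp (real k * (t / real n)) * I"
    if n: "n \<ge> 1" for n
  proof -
    have "scaled_law k t - scaled_law k 0
      \<le> (\<Sum>i<n. exp (real k * t) * \<P>(\<omega> in M. bad_arrival k (real i * (t / real n)) (real (Suc i) * (t / real n)) \<omega>)
         + exp (real k * (t / real n)) * (LBINT r:{real i * (t / real n)..real (Suc i) * (t / real n)}. gain k r))"
      unfolding tel[OF n, of k, symmetric] grid
      using grid_le t n k by (intro sum_mono cell_upper) auto
    then show ?thesis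
      unfolding Isum[OF n] bad_def by (simp add: sum.distrib sum_distrib_left)
  qed
  have lo: "I \<le> exp (real k * (t / real n)) * (scaled_law k t - scaled_law k 0) + t / real n * S"
    if n: "n \<ge> 1" for n
  proof -
    have "I \<le> (\<Sum>i<n. exp (real k * (t / real n)) *
          (scaled_law k (real (Suc i) * (t / real n)) - scaled_law k (real i * (t / real n)))
         + t / real n * (exp (real k * t) * (\<Sum>j=1..k-1. real j *
             (scaled_law j (real (Suc i) * (t / real n)) - scaled_law j (real i * (t / real n))))))"
      unfolding Isum[OF n] grid
      using grid_le t n k by (intro sum_mono cell_lower) auto
    also have "\<dots> = exp (real k * (t / real n)) *
          (\<Sum>i<n. scaled_law k (real (Suc i) * (t / real n)) - scaled_law k (real i * (t / real n)))
         + t / real n * (exp (real k * t) * (\<Sum>j=1..k-1. real j *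
             (\<Sum>i<n. scaled_law j (real (Suc i) * (t / real n)) - scaled_law j (real i * (t / real n)))))"
      unfolding sum.distrib sum_distrib_left
      by (rule arg_cong2[where f = "(+)", OF refl], rule sum.swap)
    finally show ?thesis unfolding tel[OF n] S_def .
  qed
  have h0: "(\<lambda>n. t / real n) \<longlonglongrightarrow> 0" by (rule lim_const_over_n)
  have "(\<lambda>n. exp (real k * t) * bad n + exp (real k * (t / real n)) * I)
      \<longlonglongrightarrow> exp (real k * t) * 0 + exp (real k * 0) * I"
    unfolding bad_def by (intro tendsto_intros h0 sum_bad_arrivals_tendsto t k)
  then have "scaled_law k t - scaled_law k 0 \<le> exp (real k * t) * 0 + exp (real k * 0) * I"
    by (rule LIMSEQ_le_const) (use up in blast)
  moreover have "(\<lambda>n. exp (real k * (t / real n)) * (scaled_law k t - scaled_law k 0) + t / real n * S)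
      \<longlonglongrightarrow> exp (real k * 0) * (scaled_law k t - scaled_law k 0) + 0 * S"
    by (intro tendsto_intros h0)
  then have "I \<le> exp (real k * 0) * (scaled_law k t - scaled_law k 0) + 0 * S"
    by (rule LIMSEQ_le_const) (use lo in blast)
  ultimately show ?thesis by (simp add: I_def)
qed

end

section \<open>Evolution of the expectation\<close>

text \<open>The finite exceptional set is for \<open>v 1\<close>, whose derivative is prescribed
  only away from \<open>T_gel v0\<close>.\<close>

lemma LBINT_FTC:
  fixes F f :: "real \<Rightarrow> real"
  assumes ab: "a \<le> b" and fin: "finite S" and int: "set_integrable lborel {a..b} f"
    and deriv: "\<And>x. x \<in> {a..b} - S \<Longrightarrow> (F has_real_derivative f x) (at x within {a..b})"
    and cont: "continuous_on {a..b} F"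
  shows "(LBINT x:{a..b}. f x) = F b - F a"
proof -
  have "(f has_integral (F b - F a)) {a..b}"
  proof (rule fundamental_theorem_of_calculus_interior_strong[OF fin ab _ cont])
    show "(F has_vector_derivative f x) (at x)" if "x \<in> {a<..<b} - S" for x
      using deriv[of x] that at_within_Icc_at[of a x b]
      by (simp add: has_real_derivative_iff_has_vector_derivative)
  qed
  then show ?thesis
    using set_borel_integral_eq_integral(2)[OF int] by (simp add: integral_unique)
qed

lemma set_integrable_continuous_Icc:
  fixes f :: "real \<Rightarrow> real"
  assumes "continuous_on {a..b} f"
  shows "set_integrable lborel {a..b} f"
  by (rule borel_integrable_atLeastAtMost'[OF assms])

text \<open>Averaging the sum with its reflection \<open>j \<mapsto> k - j\<close> replaces the
  weight \<open>j\<close> by \<open>k / 2\<close>. This identifies the gain of the tagged cluster,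
  in which \<open>j\<close> is a jump rate, with the coagulation term of the equations.\<close>

lemma sum_weighted_convolution:
  fixes a :: "nat \<Rightarrow> real"
  shows "(\<Sum>j=1..k-1. real j * a j * a (k - j)) = real k / 2 * (\<Sum>l=1..k-1. a l * a (k - l))"
proof -
  have "(\<Sum>j=1..k-1. real j * a j * a (k - j)) = (\<Sum>j=1..k-1. real (k - j) * a (k - j) * a j)"
    by (rule sum.reindex_bij_witness[where i = "\<lambda>j. k - j" and j = "\<lambda>j. k - j"]) auto
  then have "2 * (\<Sum>j=1..k-1. real j * a j * a (k - j))
      = (\<Sum>j=1..k-1. real j * a j * a (k - j) + real (k - j) * a (k - j) * a j)"
    by (simp add: sum.distrib)
  also have "\<dots> = (\<Sum>j=1..k-1. real k * (a j * a (k - j)))"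
    by (intro sum.cong) (auto simp: of_nat_diff algebra_simps)
  also have "\<dots> = real k * (\<Sum>l=1..k-1. a l * a (k - l))" by (simp only: sum_distrib_left)
  finally show ?thesis by linarith
qed

text \<open>The Cauchy product of a series of mass 1 with itself has mass \<open>1 * 1\<close>, and
  its terms are nonnegative.\<close>

lemma sum_convolution_tendsto:
  fixes a :: "nat \<Rightarrow> real"
  assumes pos: "\<And>l. l \<ge> 1 \<Longrightarrow> 0 \<le> a l" and sum: "(a has_sum 1) {1..}"
  shows "(\<lambda>K. \<Sum>k=2..K. \<Sum>l=1..k-1. a l * a (k - l)) \<longlonglongrightarrow> 1"
    and "(\<Sum>k=2..K. \<Sum>l=1..k-1. a l * a (k - l)) \<in> {0..1}"
proof -
  \<comment> \<open>The value 0 at index 0 turns the sum over \<open>1..k-1\<close> into the full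
    convolution over \<open>i \<le> k\<close>.\<close>
  define b where "b l = (if l = 0 then 0 else a l)" for l
  have bpos: "0 \<le> b l" for l using pos[of l] by (auto simp: b_def)
  have "(b has_sum 1) UNIV"
    using sum by (rule has_sum_cong_neutral[THEN iffD1, rotated 3]) (auto simp: b_def)
  then have bs: "b sums 1" by (rule has_sum_imp_sums)
  have "(\<lambda>k. \<Sum>i\<le>k. b i * b (k - i)) sums ((\<Sum>k. b k) * (\<Sum>k. b k))"
    using bs bpos by (intro Cauchy_product_sums) (auto simp: sums_iff)
  then have cs: "(\<lambda>k. \<Sum>i\<le>k. b i * b (k - i)) sums 1" using bs by (simp add: sums_iff)
  have conv: "(\<Sum>i\<le>k. b i * b (k - i)) = (\<Sum>l=1..k-1. a l * a (k - l))" for k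
  proof (rule sum.mono_neutral_cong_right)
    show "\<forall>i\<in>{..k} - {1..k-1}. b i * b (k - i) = 0"
    proof
      fix i assume "i \<in> {..k} - {1..k-1}"
      then have "i = 0 \<or> k - i = 0" by auto
      then show "b i * b (k - i) = 0" by (auto simp: b_def)
    qed
  qed (auto simp: b_def)
  have eq: "(\<Sum>k=2..K. \<Sum>l=1..k-1. a l * a (k - l)) = (\<Sum>k\<le>K. \<Sum>i\<le>k. b i * b (k - i))" for K
    unfolding conv by (rule sum.mono_neutral_left) auto
  show "(\<lambda>K. \<Sum>k=2..K. \<Sum>l=1..k-1. a l * a (k - l)) \<longlonglongrightarrow> 1"
    unfolding eq using cs by (simp add: sums_def_le)
  have cpos: "0 \<le> (\<Sum>i\<le>k. b i * b (k - i))" for k using bpos by (intro sum_nonneg) auto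
  have "(\<Sum>k\<le>K. \<Sum>i\<le>k. b i * b (k - i)) \<le> 1"
    using sum_le_suminf[of "\<lambda>k. \<Sum>i\<le>k. b i * b (k - i)" "{..K}"] cs cpos by (auto simp: sums_iff)
  then show "(\<Sum>k=2..K. \<Sum>l=1..k-1. a l * a (k - l)) \<in> {0..1}"
    unfolding eq using cpos by (auto intro: sum_nonneg)
qed

text \<open>The control function may be discontinuous at \<open>T_gel v0\<close>, so the interval is
  cut there: it vanishes on the left part and is continuous on the right part, which contains the
  cut point.\<close>

lemma control_function_integrable:
  assumes "control_function v0 v \<phi>"
  shows "set_integrable lborel {0..t} \<phi>"
proof -
  let ?T = "T_gel v0"
  have zero: "\<phi> s = 0" if "0 \<le> s" "s < ?T" for s
    using assms that by (auto simp: control_function_def)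
  have cont: "continuous_on {?T..} \<phi>"
    unfolding continuous_on_eq_continuous_within
  proof
    fix s assume s: "s \<in> {?T..}"
    then obtain e L where e: "e > 0" "L-lipschitz_on (cball s e \<inter> {?T..}) \<phi>"
      using assms unfolding control_function_def by (meson atLeast_iff)
    have "continuous (at s within cball s e \<inter> {?T..}) \<phi>"
      using lipschitz_on_continuous_on[OF e(2)] s e(1) by (simp add: continuous_on_eq_continuous_within)
    moreover have "at s within cball s e \<inter> {?T..} = at s within {?T..}"
      using e(1) by (intro at_within_nhd[of s "ball s e"]) auto
    ultimately show "continuous (at s within {?T..}) \<phi>" by simp
  qed
  \<comment> \<open>With \<open>max 0\<close> the cut needs no information on the sign of
    \<open>T_gel v0\<close>.\<close>
  have "set_integrable lborel {max 0 ?T..t} \<phi>"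
    by (rule set_integrable_continuous_Icc[OF continuous_on_subset[OF cont]]) auto
  moreover have "set_integrable lborel ({0..t} \<inter> {..<max 0 ?T}) \<phi>"
  proof -
    have "set_integrable lborel ({0..t} \<inter> {..<max 0 ?T}) (\<lambda>_. 0 :: real)" by (simp add: set_integrable_def)
    then show ?thesis
      by (rule set_integrable_cong[THEN iffD1, rotated 3]) (auto simp: zero)
  qed
  ultimately have "set_integrable lborel ({max 0 ?T..t} \<union> ({0..t} \<inter> {..<max 0 ?T})) \<phi>"
    by (intro set_integrable_Un) auto
  moreover have "{max 0 ?T..t} \<union> ({0..t} \<inter> {..<max 0 ?T}) = {0..t}" by auto
  ultimately show ?thesis by simp
qed

section \<open>Identification of the law, and passage to the limit in the partial sums\<close>

context tagged_cluster
begin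

lemma v_continuous: "k \<ge> 1 \<Longrightarrow> continuous_on {0..t} (v k)"
  using forest by (auto simp: critical_forest_fire_def intro: continuous_on_subset)

lemma v_bounds: "k \<ge> 1 \<Longrightarrow> r \<ge> 0 \<Longrightarrow> 0 \<le> v k r" "k \<ge> 1 \<Longrightarrow> r \<ge> 0 \<Longrightarrow> v k r \<le> 1"
  using forest by (auto simp: critical_forest_fire_def)

lemma v_has_sum: "r \<ge> 0 \<Longrightarrow> ((\<lambda>l. v l r) has_sum 1) {1..}"
  using forest by (simp add: critical_forest_fire_def)

lemma v_derivative:
  assumes "k \<ge> 2" "r \<in> {0..t}"
  shows "(v k has_real_derivative (- real k * v k r + real k / 2 * (\<Sum>l=1..k-1. v l r * v (k - l) r)))
    (at r within {0..t})"
proof -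
  have "(v k has_real_derivative (- real k * v k r + real k / 2 * (\<Sum>l=1..k-1. v l r * v (k - l) r)))
    (at r within {0..})"
    using assms forest by (simp add: critical_forest_fire_def)
  then show ?thesis by (rule DERIV_subset) auto
qed

text \<open>The coagulation term is written with weight \<open>j\<close>, the form in which
  \<open>v\<close> satisfies the same linear equation as the law.\<close>

lemma v_forward:
  assumes k: "k \<ge> 2" and t: "t \<ge> 0"
  shows "exp (real k * t) * vp k t - vp k 0
    = (LBINT r:{0..t}. exp (real k * r) * (\<Sum>j=1..k-1. real j * vp j r * vp (k - j) r))"
proof -
  have "(LBINT r:{0..t}. exp (real k * r) * (\<Sum>j=1..k-1. real j * v j r * v (k - j) r))
      = exp (real k * t) * v k t - exp (real k * 0) * v k 0"
  proof (rule LBINT_FTC[OF t, where S = "{}"])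
    show "set_integrable lborel {0..t} (\<lambda>r. exp (real k * r) * (\<Sum>j=1..k-1. real j * v j r * v (k - j) r))"
      by (intro set_integrable_continuous_Icc continuous_intros v_continuous) auto
    show "continuous_on {0..t} (\<lambda>r. exp (real k * r) * v k r)"
      using k by (intro continuous_intros v_continuous) auto
    fix r assume r: "r \<in> {0..t} - {}"
    have e: "((\<lambda>r. exp (real k * r)) has_real_derivative exp (real k * r) * real k) (at r within {0..t})"
      by (auto intro!: derivative_eq_intros)
    have "r \<in> {0..t}" using r by simp
    from DERIV_mult[OF e v_derivative[OF k this]]
    show "((\<lambda>r. exp (real k * r) * v k r) has_real_derivative
        exp (real k * r) * (\<Sum>j=1..k-1. real j * v j r * v (k - j) r)) (at r within {0..t})"
      unfolding sum_weighted_convolution[of "\<lambda>l. v l r"]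
      by (rule DERIV_cong) (simp add: algebra_simps)
  qed auto
  moreover have "(LBINT r:{0..t}. exp (real k * r) * (\<Sum>j=1..k-1. real j * vp j r * vp (k - j) r))
    = (LBINT r:{0..t}. exp (real k * r) * (\<Sum>j=1..k-1. real j * v j r * v (k - j) r))"
    by (intro set_lebesgue_integral_cong) (auto simp: vp_eq)
  ultimately show ?thesis using t by (simp add: vp_eq)
qed

lemma law_eq_v:
  assumes "k \<ge> 1" "t \<ge> 0"
  shows "\<P>(\<omega> in M. C t \<omega> = k) = v k t"
proof -
  have "law k t = vp k t"
  proof (rule forward_equation_unique[where p = law and v = vp])
    show "law k 0 = vp k 0" if "k \<ge> 1" for k
      using process that by (simp add: law_def vp_def tagged_cluster_process_def)
    show "exp (real k * t) * law k t - law k 0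
      = (LBINT r:{0..t}. exp (real k * r) * (\<Sum>j=1..k-1. real j * law j r * vp (k - j) r))"
      if "k \<ge> 2" "t \<ge> 0" for k t
    proof (cases "t = 0")
      case True
      have "(LBINT r:{0..0}. gain k r) = 0"
        using LBINT_gain_grid[of 0 0 1 k] by simp
      then show ?thesis using True by (simp add: gain_def)
    next
      case False
      then show ?thesis
        using scaled_law_forward[of t k] that by (simp add: scaled_law_def gain_def)
    qed
    show "exp (real k * t) * vp k t - vp k 0
      = (LBINT r:{0..t}. exp (real k * r) * (\<Sum>j=1..k-1. real j * vp j r * vp (k - j) r))"
      if "k \<ge> 2" "t \<ge> 0" for k t by (rule v_forward[OF that])
  qed (use assms law_measurable vp_measurable law_bounds vp_bounds law_has_sum vp_has_sum in auto)
  then show ?thesis using assms by (simp add: law_eq vp_eq)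
qed

lemma expectation_inverse_tendsto:
  assumes t: "t \<ge> 0"
  shows "(\<lambda>K. \<Sum>k=1..K. v k t / real k) \<longlonglongrightarrow> (\<integral>\<omega>. 1 / real (C t \<omega>) \<partial>M)"
proof -
  have ev: "{\<omega> \<in> space M. C t \<omega> = k} \<in> events" for k
    using pred_C[OF t, of "\<lambda>c. c = k"] by (simp add: pred_def)
  \<comment> \<open>This is \<open>1 / C t\<close> truncated to the event
    \<open>C t \<omega> \<le> K\<close>; it is bounded by 1 because states are at least 1.\<close>
  define X where "X K \<omega> = (\<Sum>k=1..K. indicator {\<omega> \<in> space M. C t \<omega> = k} \<omega> / real k)" for K :: nat and \<omega>
  have X: "X K \<omega> = (if C t \<omega> \<le> K then 1 / real (C t \<omega>) else 0)" if "\<omega> \<in> space M" for K \<omega>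
  proof -
    have "X K \<omega> = (\<Sum>k=1..K. if k = C t \<omega> then 1 / real (C t \<omega>) else 0)"
      unfolding X_def using that by (intro sum.cong) (auto simp: indicator_def)
    then show ?thesis using C_ge_1[OF t that] by simp
  qed
  have "(\<lambda>K. \<integral>\<omega>. X K \<omega> \<partial>M) \<longlonglongrightarrow> (\<integral>\<omega>. 1 / real (C t \<omega>) \<partial>M)"
  proof (rule integral_dominated_convergence[where w = "\<lambda>_. 1"])
    show "(\<lambda>\<omega>. 1 / real (C t \<omega>)) \<in> borel_measurable M"
      by (rule measurable_compose[OF measurable_C[OF t]]) auto
    show "X K \<in> borel_measurable M" for K
      unfolding X_def using ev by (intro borel_measurable_sum borel_measurable_divide) auto
    show "AE \<omega> in M. (\<lambda>K. X K \<omega>) \<longlonglongrightarrow> 1 / real (C t \<omega>)"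
    proof (rule AE_I2)
      fix \<omega> assume "\<omega> \<in> space M"
      then have "\<forall>\<^sub>F K in sequentially. X K \<omega> = 1 / real (C t \<omega>)"
        using X by (auto simp: eventually_sequentially intro!: exI[of _ "C t \<omega>"])
      then show "(\<lambda>K. X K \<omega>) \<longlonglongrightarrow> 1 / real (C t \<omega>)" by (rule tendsto_eventually)
    qed
    show "AE \<omega> in M. norm (X K \<omega>) \<le> 1" for K
    proof (rule AE_I2)
      fix \<omega> assume \<omega>: "\<omega> \<in> space M"
      then have "1 / real (C t \<omega>) \<le> 1" using C_ge_1[OF t \<omega>] by (simp add: divide_le_eq_1)
      then show "norm (X K \<omega>) \<le> 1" using X[OF \<omega>, of K] by auto
    qed
  qed auto
  moreover have "(\<integral>\<omega>. X K \<omega> \<partial>M) = (\<Sum>k=1..K. v k t / real k)" for K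
  proof -
    have "(\<integral>\<omega>. X K \<omega> \<partial>M) = (\<Sum>k=1..K. (\<integral>\<omega>. indicator {\<omega> \<in> space M. C t \<omega> = k} \<omega> / real k \<partial>M))"
      unfolding X_def using ev
      by (intro Bochner_Integration.integral_sum integrable_divide integrable_real_indicator)
         (auto simp: emeasure_eq_measure)
    also have "\<dots> = (\<Sum>k=1..K. prob {\<omega> \<in> space M. C t \<omega> = k} / real k)"
      using ev by (intro sum.cong) (auto simp: Int_absorb2 sets.sets_into_space)
    also have "\<dots> = (\<Sum>k=1..K. v k t / real k)"
      using t by (intro sum.cong) (auto simp: law_eq_v)
    finally show ?thesis .
  qed
  ultimately show ?thesis by simp
qed

text \<open>Dividing by \<open>k\<close> cancels the factor \<open>k\<close> on the right of the
  equations and leaves partial sums of the total mass and of the convolution square, both bounded by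
  1. The control function enters through \<open>v 1\<close> alone.\<close>

lemma partial_sum_evolution:
  assumes ctrl: "control_function v0 v \<phi>" and t: "t \<ge> 0" and K: "K \<ge> 1"
  shows "(\<Sum>k=1..K. v k t / real k) - (\<Sum>k=1..K. v k 0 / real k)
    = (LBINT r:{0..t}. \<phi> r - (\<Sum>k=1..K. v k r) + 1 / 2 * (\<Sum>k=2..K. \<Sum>l=1..k-1. v l r * v (k - l) r))"
proof -
  have \<phi>i: "set_integrable lborel {0..t} \<phi>" by (rule control_function_integrable[OF ctrl])
  have v1i: "set_integrable lborel {0..t} (\<lambda>r. \<phi> r - v 1 r)"
    by (intro set_integral_diff(1) \<phi>i set_integrable_continuous_Icc v_continuous) simp
  have v1: "(LBINT r:{0..t}. \<phi> r - v 1 r) = v 1 t - v 1 0"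
  proof (rule LBINT_FTC[OF t, where S = "{T_gel v0}"])
    fix r assume r: "r \<in> {0..t} - {T_gel v0}"
    then have "(v 1 has_real_derivative (- v 1 r + \<phi> r)) (at r within {0..})"
      using ctrl by (auto simp: control_function_def)
    then have "(v 1 has_real_derivative (- v 1 r + \<phi> r)) (at r within {0..t})"
      by (rule DERIV_subset) auto
    then show "(v 1 has_real_derivative (\<phi> r - v 1 r)) (at r within {0..t})" by (simp add: algebra_simps)
  qed (use v1i v_continuous in auto)
  define h where "h k r = - v k r + 1 / 2 * (\<Sum>l=1..k-1. v l r * v (k - l) r)" for k r
  have hi: "set_integrable lborel {0..t} (h k)" if "k \<ge> 2" for k
    unfolding h_def using that by (intro set_integrable_continuous_Icc continuous_intros v_continuous) auto
  have vk: "(LBINT r:{0..t}. h k r) = v k t / real k - v k 0 / real k" if k: "k \<ge> 2" for k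
  proof (rule LBINT_FTC[OF t, where S = "{}"])
    fix r assume "r \<in> {0..t} - {}"
    then have "((\<lambda>r. v k r / real k) has_real_derivative
        (- real k * v k r + real k / 2 * (\<Sum>l=1..k-1. v l r * v (k - l) r)) / real k) (at r within {0..t})"
      by (intro DERIV_cdivide v_derivative k) simp
    moreover have "(- real k * v k r + real k / 2 * (\<Sum>l=1..k-1. v l r * v (k - l) r)) / real k = h k r"
      using k by (simp add: h_def add_divide_distrib diff_divide_distrib)
    ultimately show "((\<lambda>r. v k r / real k) has_real_derivative h k r) (at r within {0..t})" by simp
  next
    show "continuous_on {0..t} (\<lambda>r. v k r / real k)"
      using k by (intro continuous_intros v_continuous) auto
  qed (use hi k in auto)
  have split: "(\<Sum>k=1..K. f k) = f 1 + (\<Sum>k=2..K. f k)" for f :: "nat \<Rightarrow> real"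
    using K by (subst sum.atLeast_Suc_atMost) (auto simp: numeral_2_eq_2)
  have "(\<Sum>k=1..K. v k t / real k) - (\<Sum>k=1..K. v k 0 / real k)
    = (LBINT r:{0..t}. \<phi> r - v 1 r) + (\<Sum>k=2..K. (LBINT r:{0..t}. h k r))"
    unfolding split v1 by (simp add: vk sum_subtractf)
  also have "\<dots> = (LBINT r:{0..t}. (\<phi> r - v 1 r) + (\<Sum>k=2..K. h k r))"
    using v1i set_lebesgue_sum[of "{2..K}" lborel "{0..t}" h] hi by (subst set_integral_add(2)) auto
  also have "(\<lambda>r. (\<phi> r - v 1 r) + (\<Sum>k=2..K. h k r))
    = (\<lambda>r. \<phi> r - (\<Sum>k=1..K. v k r) + 1 / 2 * (\<Sum>k=2..K. \<Sum>l=1..k-1. v l r * v (k - l) r))"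
    unfolding split h_def by (simp add: sum_subtractf sum_distrib_left algebra_simps)
  finally show ?thesis .
qed

lemma expectation_inverse_evolution:
  assumes ctrl: "control_function v0 v \<phi>" and t: "t \<ge> 0"
  shows "(\<integral>\<omega>. 1 / real (C t \<omega>) \<partial>M)
    = (\<integral>\<omega>. 1 / real (C 0 \<omega>) \<partial>M) + (LBINT s:{0..t}. \<phi> s - 1 / 2)"
proof -
  have \<phi>i: "set_integrable lborel {0..t} \<phi>" by (rule control_function_integrable[OF ctrl])
  define R where "R K r = \<phi> r - (\<Sum>k=1..K. v k r) + 1 / 2 * (\<Sum>k=2..K. \<Sum>l=1..k-1. v l r * v (k - l) r)"
    for K r
  have "(\<lambda>K. LBINT r:{0..t}. R K r) \<longlonglongrightarrow> (LBINT r:{0..t}. \<phi> r - 1 / 2)"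
    unfolding set_lebesgue_integral_def
  \<comment> \<open>Both partial sums in \<open>R K r\<close> lie in \<open>[0, 1]\<close>, the
    second one with weight one half, so adding \<open>2\<close> to
    \<open>\<bar>\<phi> r\<bar>\<close> is ample.\<close>
  proof (rule integral_dominated_convergence[where w = "\<lambda>r. indicator {0..t} r *\<^sub>R (\<bar>\<phi> r\<bar> + 2)"])
    have ci: "set_integrable lborel {0..t} (\<lambda>r. c)" for c :: real
      by (rule set_integrable_continuous_Icc) (intro continuous_intros)
    have "set_integrable lborel {0..t} (\<lambda>r. \<phi> r - 1 / 2)"
      by (intro set_integral_diff(1) \<phi>i ci)
    then show "(\<lambda>r. indicator {0..t} r *\<^sub>R (\<phi> r - 1 / 2)) \<in> borel_measurable lborel"
      by (auto simp: set_integrable_def)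
    have "set_integrable lborel {0..t} (R K)" for K
      unfolding R_def
      by (intro set_integral_add(1) set_integral_diff(1) \<phi>i set_integrable_continuous_Icc
          continuous_intros v_continuous) auto
    then show "(\<lambda>r. indicator {0..t} r *\<^sub>R R K r) \<in> borel_measurable lborel" for K
      by (auto simp: set_integrable_def)
    have "set_integrable lborel {0..t} (\<lambda>r. \<bar>\<phi> r\<bar> + 2)"
      by (intro set_integral_add(1) set_integrable_abs \<phi>i ci)
    then show "integrable lborel (\<lambda>r. indicator {0..t} r *\<^sub>R (\<bar>\<phi> r\<bar> + 2))"
      by (simp add: set_integrable_def)
    show "AE r in lborel. (\<lambda>K. indicator {0..t} r *\<^sub>R R K r) \<longlonglongrightarrow> indicator {0..t} r *\<^sub>R (\<phi> r - 1 / 2)"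
    proof (rule AE_I2)
      fix r :: real
      show "(\<lambda>K. indicator {0..t} r *\<^sub>R R K r) \<longlonglongrightarrow> indicator {0..t} r *\<^sub>R (\<phi> r - 1 / 2)"
      proof (cases "r \<in> {0..t}")
        case True
        then have "(\<lambda>K. R K r) \<longlonglongrightarrow> \<phi> r - 1 + 1 / 2 * 1"
          unfolding R_def using v_bounds v_has_sum
          by (intro tendsto_intros has_sum_from_1_imp_LIMSEQ sum_convolution_tendsto(1)) auto
        then show ?thesis using True by simp
      qed simp
    qed
    show "AE r in lborel. norm (indicator {0..t} r *\<^sub>R R K r) \<le> indicator {0..t} r *\<^sub>R (\<bar>\<phi> r\<bar> + 2)" for K
    proof (rule AE_I2)
      fix r :: real
      show "norm (indicator {0..t} r *\<^sub>R R K r) \<le> indicator {0..t} r *\<^sub>R (\<bar>\<phi> r\<bar> + 2)"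
      proof (cases "r \<in> {0..t}")
        case True
        then have "(\<Sum>k=2..K. \<Sum>l=1..k-1. v l r * v (k - l) r) \<in> {0..1}"
          using v_bounds v_has_sum by (intro sum_convolution_tendsto(2)[of "\<lambda>l. v l r"]) auto
        moreover have "(\<Sum>k=1..K. v k r) \<le> 1"
          using True v_bounds by (intro has_sum_mono_neutral[OF has_sum_finite v_has_sum[of r]]) auto
        moreover have "0 \<le> (\<Sum>k=1..K. v k r)" using True v_bounds by (intro sum_nonneg) auto
        ultimately have "\<bar>R K r\<bar> \<le> \<bar>\<phi> r\<bar> + 2"
          unfolding R_def atLeastAtMost_iff by linarith
        then show ?thesis using True by simp
      qed simp
    qed
  qed
  moreover have "\<forall>\<^sub>F K in sequentially. (LBINT r:{0..t}. R K r)
      = (\<Sum>k=1..K. v k t / real k) - (\<Sum>k=1..K. v k 0 / real k)"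
    unfolding eventually_sequentially R_def using partial_sum_evolution[OF ctrl t] by (intro exI[of _ 1]) auto
  ultimately have "(\<lambda>K. (\<Sum>k=1..K. v k t / real k) - (\<Sum>k=1..K. v k 0 / real k))
      \<longlonglongrightarrow> (LBINT r:{0..t}. \<phi> r - 1 / 2)"
    by (rule Lim_transform_eventually)
  moreover have "(\<lambda>K. (\<Sum>k=1..K. v k t / real k) - (\<Sum>k=1..K. v k 0 / real k))
      \<longlonglongrightarrow> (\<integral>\<omega>. 1 / real (C t \<omega>) \<partial>M) - (\<integral>\<omega>. 1 / real (C 0 \<omega>) \<partial>M)"
    using t by (intro tendsto_intros expectation_inverse_tendsto) auto
  ultimately have "(LBINT r:{0..t}. \<phi> r - 1 / 2)
      = (\<integral>\<omega>. 1 / real (C t \<omega>) \<partial>M) - (\<integral>\<omega>. 1 / real (C 0 \<omega>) \<partial>M)"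
    by (rule LIMSEQ_unique)
  then show ?thesis by simp
qed

end

theorem lemma3p14:
  fixes v0 :: "nat \<Rightarrow> real" and v :: "nat \<Rightarrow> real \<Rightarrow> real" and \<phi> :: "real \<Rightarrow> real"
    and M :: "'a measure" and C :: "real \<Rightarrow> 'a \<Rightarrow> nat" and t :: real
  assumes "\<And>l. l \<ge> 1 \<Longrightarrow> v0 l \<ge> 0"
    and "(v0 has_sum 1) {1..}"
    and "(\<lambda>l. real l ^ 3 * v0 l) summable_on {1..}"
    and "critical_forest_fire v0 v"
    and "control_function v0 v \<phi>"
    and "tagged_cluster_process M v C"
    and "t \<ge> 0"
  shows "(\<integral>\<omega>. 1 / real (C t \<omega>) \<partial>M)
           = (\<integral>\<omega>. 1 / real (C 0 \<omega>) \<partial>M) + (LBINT s:{0..t}. \<phi> s - 1 / 2)"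
proof -
  interpret tagged_cluster v0 v M C using assms(4,6) by unfold_locales
  show ?thesis by (rule expectation_inverse_evolution[OF assms(5,7)])
qed

end
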